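(* Let $\Gamma\subset\mathsf{Homeo}(M)$ be a non-elementary convergence group and let $(\sigma, \bar\sigma, G)$ be a continuous GPS system with $\delta:=\delta_\sigma(\Gamma) < +\infty$ and $$\sum_{\gamma \in \Gamma} e^{-\delta \|\gamma\|_\sigma} = + \infty.$$ Then the flow $\psi^t$ on $(U_\Gamma, m_\Gamma)$ is conservative and ergodic, where $m_\Gamma$ is the Bowen--Margulis--Sullivan measure associated to $(\sigma, \bar\sigma, G)$.
   Context: Convergence groups. $M$ is a compact metrizable space. A subgroup $\Gamma\subset\mathsf{Homeo}(M)$ is a (discrete) convergence group if for every sequence $\{\gamma_n\}$ of distinct elements of $\Gamma$ there are $x,y\in M$ and a subsequence $\{\gamma_{n_j}\}$ such that $\gamma_{n_j}|_{M\smallsetminus\{y\}}$ converges locally uniformly to the constant $x$. The limit set $\Lambda(\Gamma)$ is the set of $x\in M$ for which there are $y\in M$ and a sequence $\{\gamma_n\}\subset\Gamma$ with $\gamma_n|_{M\smallsetminus\{y\}}\to x$ locally uniformly. $\Gamma$ is non-elementary if $\#\Lambda(\Gamma)\ge 3$. An element $\gamma$ is loxodromic if it has two fixed points $\gamma^+\ne\gamma^-$ in $\Lambda(\Gamma)$ such that $\gamma^{\pm n}|_{M\smallsetminus\{\gamma^{\mp}\}}$ converges locally uniformly to $\gamma^{\pm}$ as $n\to+\infty$. For a set $A$, $A^{(2)}=\{(x,y)\in A^2:x\ne y\}$. Compatible metrics. $\Gamma\sqcup M$ carries a unique compact metrizable topology for which the inclusions of $\Gamma$ (discrete) and of $M$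 are embeddings and the natural action of $\Gamma$ (left multiplication on $\Gamma$) is a convergence group action. A compatible metric $\mathrm{d}$ is a metric on $\Gamma\sqcup M$ inducing this topology; fix one. Continuous GPS systems. $(\sigma,\bar\sigma,G)$ is a continuous GPS system if: $\sigma,\bar\sigma\colon\Gamma\times M\to\mathbb{R}$ are continuous cocycles ($\sigma(\gamma,\cdot)$ is continuous and $\sigma(\gamma_1\gamma_2,x)=\sigma(\gamma_1,\gamma_2x)+\sigma(\gamma_2,x)$, and likewise for $\bar\sigma$); both are proper, i.e. $\sigma(\gamma_n,\gamma_n^+)\to+\infty$ whenever $\{\gamma_n\}\subset\Gamma$ is a sequence of distinct loxodromic elements with $\liminf_n\mathrm{d}(\gamma_n^-,\gamma_n^+)>0$ (likewise $\bar\sigma$); $G\colon M^{(2)}\to\mathbb{R}$ is continuous; and $\bar\sigma(\gamma,x)+\sigma(\gamma,y)=G(\gamma x,\gamma y)-G(x,y)$ for all $\gamma\in\Gamma$ and $(x,y)\in M^{(2)}$. In this case $\sigma$ (and $\bar\sigma$) is expanding: for each $\gamma\in\Gamma$ there is a number $\|\gamma\|_\sigma\in\mathbb{R}$ (the $\sigma$-magnitude, unique up to bounded error) such that for every $\epsilon>0$ there is $C>0$ with $\|\gamma\|_\sigma-C\le\sigma(\gamma,x)\le\|\gamma\|_\sigma+C$ whenever $\mathrm{d}(x,\gamma^{-1})>\epsilon$ (with $\gamma^{-1}\in\Gamma\sqcup M$). The critical exponent is $\delta_\sigma(\Gamma)=\inf\{s>0:\sum_{\gamma\in\Gamma}e^{-s\|\gamma\|_\sigma}<+\infty\}$.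 Flow space and BMS measure. $\Gamma$ acts on $\Lambda(\Gamma)^{(2)}\times\mathbb{R}$ by $\gamma\cdot(x,y,t)=(\gamma x,\gamma y,t+\sigma(\gamma,y))$; this action is properly discontinuous, $U_\Gamma:=\Gamma\backslash(\Lambda(\Gamma)^{(2)}\times\mathbb{R})$ is locally compact metrizable, and the flow $\psi^t(x,y,s)=(x,y,s+t)$ commutes with $\Gamma$ and descends to a continuous flow $\psi^t$ on $U_\Gamma$. Under the divergence hypothesis there are unique Borel probability measures $\mu,\bar\mu$ on $M$ with $\frac{d\gamma_*\mu}{d\mu}=e^{-\delta\sigma(\gamma^{-1},\cdot)}$ and $\frac{d\gamma_*\bar\mu}{d\bar\mu}=e^{-\delta\bar\sigma(\gamma^{-1},\cdot)}$ for all $\gamma\in\Gamma$, and both are supported on $\Lambda(\Gamma)$. The measure $\tilde m=e^{\delta G}\,d\bar\mu\otimes d\mu\otimes dt$ on $\Lambda(\Gamma)^{(2)}\times\mathbb{R}$ is $\Gamma$- and $\psi^t$-invariant and descends to the $\psi^t$-invariant measure $m_\Gamma$ on $U_\Gamma$, characterized by $\int f\,d\tilde m=\int_{U_\Gamma}\sum_{\gamma\in\Gamma}f(\gamma v)\,dm_\Gamma([v])$ for all measurable $f\ge0$. Conservativity: a measurable $W\subset U_\Gamma$ is wandering if $\{t\in\mathbb{R}:\psi^t(v)\in W\}$ is relatively compact for $m_\Gamma$-almost every $v\in W$; the flow is conservative if every wandering set has $m_\Gamma$-measure zero. *)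

theory Defs
  imports "HOL-Probability.Probability"
begin

text \<open>Uniform convergence to a constant only depends on the topology, so locally uniform
  convergence of \<open>f n\<close> on \<open>S\<close> to the constant \<open>x\<close> can be phrased in an arbitrary topology.
  For metric spaces, see \<open>loc_unif_to_const_euclidean\<close> below.\<close>

definition loc_unif_to_const :: "'a topology \<Rightarrow> (nat \<Rightarrow> 'a \<Rightarrow> 'a) \<Rightarrow> 'a set \<Rightarrow> 'a \<Rightarrow> bool" where
  "loc_unif_to_const X f S x \<longleftrightarrow>
     (\<forall>z\<in>S. \<exists>W. openin X W \<and> z \<in> W \<and>
        (\<forall>U. openin X U \<and> x \<in> U \<longrightarrow> (\<forall>\<^sub>F n in sequentially. f n ` (W \<inter> S) \<subseteq> U)))"

lemma loc_unif_to_const_euclidean: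
  fixes f :: "nat \<Rightarrow> 'a::metric_space \<Rightarrow> 'a"
  shows "loc_unif_to_const euclidean f S x \<longleftrightarrow>
     (\<forall>z\<in>S. \<exists>W. open W \<and> z \<in> W \<and> uniform_limit (W \<inter> S) f (\<lambda>_. x) sequentially)"
proof -
  have "(\<forall>U. open U \<and> x \<in> U \<longrightarrow> (\<forall>\<^sub>F n in sequentially. f n ` T \<subseteq> U))
     \<longleftrightarrow> uniform_limit T f (\<lambda>_. x) sequentially" for T
  proof
    assume *: "\<forall>U. open U \<and> x \<in> U \<longrightarrow> (\<forall>\<^sub>F n in sequentially. f n ` T \<subseteq> U)"
    show "uniform_limit T f (\<lambda>_. x) sequentially"
    proof (rule uniform_limitI)
      fix e :: real assume "0 < e"
      with *[rule_format, of "ball x e"] have "\<forall>\<^sub>F n in sequentially. f n ` T \<subseteq> ball x e" by simp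
      then show "\<forall>\<^sub>F n in sequentially. \<forall>y\<in>T. dist (f n y) x < e"
        by eventually_elim (auto simp: dist_commute)
    qed
  next
    assume lim: "uniform_limit T f (\<lambda>_. x) sequentially"
    show "\<forall>U. open U \<and> x \<in> U \<longrightarrow> (\<forall>\<^sub>F n in sequentially. f n ` T \<subseteq> U)"
    proof safe
      fix U assume "open U" "x \<in> U"
      then obtain e where e: "0 < e" "ball x e \<subseteq> U" by (meson openE)
      from uniform_limitD[OF lim e(1)]
      show "\<forall>\<^sub>F n in sequentially. f n ` T \<subseteq> U"
        by eventually_elim (use e(2) in \<open>auto simp: dist_commute subset_iff\<close>)
    qed
  qed
  then show ?thesis
    by (simp add: loc_unif_to_const_def)
qed

definition convergence_action :: "'a topology \<Rightarrow> 'g set \<Rightarrow> ('g \<Rightarrow> 'a \<Rightarrow> 'a) \<Rightarrow> bool" where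
  "convergence_action X \<Gamma> act \<longleftrightarrow>
     (\<forall>\<gamma>\<in>\<Gamma>. homeomorphic_map X X (act \<gamma>)) \<and>
     (\<forall>\<gamma>s :: nat \<Rightarrow> 'g. inj \<gamma>s \<and> range \<gamma>s \<subseteq> \<Gamma> \<longrightarrow>
        (\<exists>x\<in>topspace X. \<exists>y\<in>topspace X. \<exists>r :: nat \<Rightarrow> nat. strict_mono r \<and>
           loc_unif_to_const X (\<lambda>n. act (\<gamma>s (r n))) (topspace X - {y}) x))"

definition homeo_subgroup :: "('m::topological_space \<Rightarrow> 'm) set \<Rightarrow> bool" where
  "homeo_subgroup \<Gamma> \<longleftrightarrow>
     id \<in> \<Gamma> \<and>
     (\<forall>\<gamma>\<in>\<Gamma>. homeomorphic_map euclidean euclidean \<gamma> \<and> inv \<gamma> \<in> \<Gamma>) \<and>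
     (\<forall>\<gamma>\<^sub>1\<in>\<Gamma>. \<forall>\<gamma>\<^sub>2\<in>\<Gamma>. \<gamma>\<^sub>1 \<circ> \<gamma>\<^sub>2 \<in> \<Gamma>)"

definition convergence_group :: "('m::topological_space \<Rightarrow> 'm) set \<Rightarrow> bool" where
  "convergence_group \<Gamma> \<longleftrightarrow> homeo_subgroup \<Gamma> \<and> convergence_action euclidean \<Gamma> (\<lambda>\<gamma>. \<gamma>)"

definition limit_set :: "('m::topological_space \<Rightarrow> 'm) set \<Rightarrow> 'm set" where
  "limit_set \<Gamma> = {x. \<exists>y. \<exists>\<gamma>s :: nat \<Rightarrow> 'm \<Rightarrow> 'm.
     range \<gamma>s \<subseteq> \<Gamma> \<and> loc_unif_to_const euclidean \<gamma>s (- {y}) x}"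

definition non_elementary :: "('m::topological_space \<Rightarrow> 'm) set \<Rightarrow> bool" where
  "non_elementary \<Gamma> \<longleftrightarrow> (\<exists>A \<subseteq> limit_set \<Gamma>. card A = 3)"

text \<open>\<open>loxodromic_with \<Gamma> \<gamma> p q\<close>: \<open>\<gamma>\<close> is loxodromic with attracting fixed point \<open>p\<close> (that is,
  \<open>\<gamma>\<^sup>+\<close>) and repelling fixed point \<open>q\<close> (that is, \<open>\<gamma>\<^sup>-\<close>).\<close>

definition loxodromic_with ::
    "('m::topological_space \<Rightarrow> 'm) set \<Rightarrow> ('m \<Rightarrow> 'm) \<Rightarrow> 'm \<Rightarrow> 'm \<Rightarrow> bool" where
  "loxodromic_with \<Gamma> \<gamma> p q \<longleftrightarrow>
     \<gamma> \<in> \<Gamma> \<and> p \<in> limit_set \<Gamma> \<and> q \<in> limit_set \<Gamma> \<and> p \<noteq> q \<and> \<gamma> p = p \<and> \<gamma> q = q \<and>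
     loc_unif_to_const euclidean (\<lambda>n. \<gamma> ^^ n) (- {q}) p \<and>
     loc_unif_to_const euclidean (\<lambda>n. (inv \<gamma>) ^^ n) (- {p}) q"

text \<open>The disjoint union of \<open>\<Gamma>\<close> and \<open>M\<close> is the subset \<open>\<Gamma> <+> UNIV\<close> of the sum type.\<close>

definition compatible_metric ::
    "('m::topological_space \<Rightarrow> 'm) set \<Rightarrow> (('m \<Rightarrow> 'm) + 'm \<Rightarrow> ('m \<Rightarrow> 'm) + 'm \<Rightarrow> real) \<Rightarrow> bool" where
  "compatible_metric \<Gamma> d \<longleftrightarrow>
     Metric_space (\<Gamma> <+> UNIV) d \<and>
     (let X = Metric_space.mtopology (\<Gamma> <+> UNIV) d in
        compact_space X \<and>
        embedding_map (discrete_topology \<Gamma>) X Inl \<and>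
        embedding_map euclidean X Inr \<and>
        convergence_action X \<Gamma> (\<lambda>\<gamma>. map_sum (\<lambda>\<eta>. \<gamma> \<circ> \<eta>) \<gamma>))"

definition continuous_cocycle ::
    "('m::topological_space \<Rightarrow> 'm) set \<Rightarrow> (('m \<Rightarrow> 'm) \<Rightarrow> 'm \<Rightarrow> real) \<Rightarrow> bool" where
  "continuous_cocycle \<Gamma> \<sigma> \<longleftrightarrow>
     (\<forall>\<gamma>\<in>\<Gamma>. continuous_on UNIV (\<sigma> \<gamma>)) \<and>
     (\<forall>\<gamma>\<^sub>1\<in>\<Gamma>. \<forall>\<gamma>\<^sub>2\<in>\<Gamma>. \<forall>x. \<sigma> (\<gamma>\<^sub>1 \<circ> \<gamma>\<^sub>2) x = \<sigma> \<gamma>\<^sub>1 (\<gamma>\<^sub>2 x) + \<sigma> \<gamma>\<^sub>2 x)"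

definition proper_cocycle ::
    "('m::topological_space \<Rightarrow> 'm) set \<Rightarrow> (('m \<Rightarrow> 'm) + 'm \<Rightarrow> ('m \<Rightarrow> 'm) + 'm \<Rightarrow> real)
       \<Rightarrow> (('m \<Rightarrow> 'm) \<Rightarrow> 'm \<Rightarrow> real) \<Rightarrow> bool" where
  "proper_cocycle \<Gamma> d \<sigma> \<longleftrightarrow>
     (\<forall>(\<gamma>s :: nat \<Rightarrow> 'm \<Rightarrow> 'm) p q.
        inj \<gamma>s \<and> (\<forall>n. loxodromic_with \<Gamma> (\<gamma>s n) (p n) (q n)) \<and>
        liminf (\<lambda>n. ereal (d (Inr (q n)) (Inr (p n)))) > 0 \<longrightarrow>
        filterlim (\<lambda>n. \<sigma> (\<gamma>s n) (p n)) at_top sequentially)"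

definition continuous_GPS_system ::
    "('m::topological_space \<Rightarrow> 'm) set \<Rightarrow> (('m \<Rightarrow> 'm) + 'm \<Rightarrow> ('m \<Rightarrow> 'm) + 'm \<Rightarrow> real)
       \<Rightarrow> (('m \<Rightarrow> 'm) \<Rightarrow> 'm \<Rightarrow> real) \<Rightarrow> (('m \<Rightarrow> 'm) \<Rightarrow> 'm \<Rightarrow> real) \<Rightarrow> ('m \<times> 'm \<Rightarrow> real) \<Rightarrow> bool" where
  "continuous_GPS_system \<Gamma> d \<sigma> \<sigma>' G \<longleftrightarrow>
     continuous_cocycle \<Gamma> \<sigma> \<and> continuous_cocycle \<Gamma> \<sigma>' \<and>
     proper_cocycle \<Gamma> d \<sigma> \<and> proper_cocycle \<Gamma> d \<sigma>' \<and>
     continuous_on {(x, y). x \<noteq> y} G \<and>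
     (\<forall>\<gamma>\<in>\<Gamma>. \<forall>x y. x \<noteq> y \<longrightarrow> \<sigma>' \<gamma> x + \<sigma> \<gamma> y = G (\<gamma> x, \<gamma> y) - G (x, y))"

text \<open>\<open>is_magnitude \<Gamma> d \<sigma> N\<close>: the function \<open>N\<close> is a choice of the \<open>\<sigma>\<close>-magnitude, which is only
  determined up to bounded error. The constant \<open>C\<close> depends on \<open>\<epsilon>\<close> but not on \<open>\<gamma>\<close>.\<close>

definition is_magnitude ::
    "('m::topological_space \<Rightarrow> 'm) set \<Rightarrow> (('m \<Rightarrow> 'm) + 'm \<Rightarrow> ('m \<Rightarrow> 'm) + 'm \<Rightarrow> real)
       \<Rightarrow> (('m \<Rightarrow> 'm) \<Rightarrow> 'm \<Rightarrow> real) \<Rightarrow> (('m \<Rightarrow> 'm) \<Rightarrow> real) \<Rightarrow> bool" where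
  "is_magnitude \<Gamma> d \<sigma> N \<longleftrightarrow>
     (\<forall>\<epsilon>>0. \<exists>C>0. \<forall>\<gamma>\<in>\<Gamma>. \<forall>x. d (Inr x) (Inl (inv \<gamma>)) > \<epsilon> \<longrightarrow>
        N \<gamma> - C \<le> \<sigma> \<gamma> x \<and> \<sigma> \<gamma> x \<le> N \<gamma> + C)"

definition poincare_series :: "'g set \<Rightarrow> ('g \<Rightarrow> real) \<Rightarrow> real \<Rightarrow> ennreal" where
  "poincare_series \<Gamma> N s = (\<Sum>\<^sub>\<infinity>\<gamma>\<in>\<Gamma>. ennreal (exp (- s * N \<gamma>)))"

definition critical_exponent :: "'g set \<Rightarrow> ('g \<Rightarrow> real) \<Rightarrow> ereal" where
  "critical_exponent \<Gamma> N = Inf {ereal s | s. s > 0 \<and> poincare_series \<Gamma> N s < \<infinity>}"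

definition conformal_measure ::
    "('m::topological_space \<Rightarrow> 'm) set \<Rightarrow> (('m \<Rightarrow> 'm) \<Rightarrow> 'm \<Rightarrow> real) \<Rightarrow> real \<Rightarrow> 'm measure \<Rightarrow> bool" where
  "conformal_measure \<Gamma> \<sigma> \<delta> \<mu> \<longleftrightarrow>
     prob_space \<mu> \<and> sets \<mu> = sets borel \<and>
     (\<forall>\<gamma>\<in>\<Gamma>. distr \<mu> borel \<gamma> = density \<mu> (\<lambda>x. ennreal (exp (- \<delta> * \<sigma> (inv \<gamma>) x))))"

definition cover_space :: "('m::topological_space \<Rightarrow> 'm) set \<Rightarrow> ('m \<times> 'm \<times> real) set" where
  "cover_space \<Gamma> = {(x, y, t). x \<in> limit_set \<Gamma> \<and> y \<in> limit_set \<Gamma> \<and> x \<noteq> y}"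

definition cover_act ::
    "(('m \<Rightarrow> 'm) \<Rightarrow> 'm \<Rightarrow> real) \<Rightarrow> ('m \<Rightarrow> 'm) \<Rightarrow> 'm \<times> 'm \<times> real \<Rightarrow> 'm \<times> 'm \<times> real" where
  "cover_act \<sigma> \<gamma> = (\<lambda>(x, y, t). (\<gamma> x, \<gamma> y, t + \<sigma> \<gamma> y))"

definition cover_flow :: "real \<Rightarrow> 'm \<times> 'm \<times> real \<Rightarrow> 'm \<times> 'm \<times> real" where
  "cover_flow t = (\<lambda>(x, y, s). (x, y, s + t))"

text \<open>Points of the flow space \<open>U\<^sub>\<Gamma>\<close> are the \<open>\<Gamma>\<close>-orbits in the cover.\<close>

definition flow_orbit ::
    "('m \<Rightarrow> 'm) set \<Rightarrow> (('m \<Rightarrow> 'm) \<Rightarrow> 'm \<Rightarrow> real) \<Rightarrow> 'm \<times> 'm \<times> real \<Rightarrow> ('m \<times> 'm \<times> real) set" where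
  "flow_orbit \<Gamma> \<sigma> v = (\<lambda>\<gamma>. cover_act \<sigma> \<gamma> v) ` \<Gamma>"

definition flow_space ::
    "('m::topological_space \<Rightarrow> 'm) set \<Rightarrow> (('m \<Rightarrow> 'm) \<Rightarrow> 'm \<Rightarrow> real) \<Rightarrow> ('m \<times> 'm \<times> real) set set" where
  "flow_space \<Gamma> \<sigma> = flow_orbit \<Gamma> \<sigma> ` cover_space \<Gamma>"

definition flow_space_topology ::
    "('m::topological_space \<Rightarrow> 'm) set \<Rightarrow> (('m \<Rightarrow> 'm) \<Rightarrow> 'm \<Rightarrow> real) \<Rightarrow> ('m \<times> 'm \<times> real) set topology" where
  "flow_space_topology \<Gamma> \<sigma> = topology (\<lambda>W. W \<subseteq> flow_space \<Gamma> \<sigma> \<and>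
     openin (top_of_set (cover_space \<Gamma>)) {v \<in> cover_space \<Gamma>. flow_orbit \<Gamma> \<sigma> v \<in> W})"

lemma openin_flow_space_topology:
  "openin (flow_space_topology \<Gamma> \<sigma>) W \<longleftrightarrow> W \<subseteq> flow_space \<Gamma> \<sigma> \<and>
     openin (top_of_set (cover_space \<Gamma>)) {v \<in> cover_space \<Gamma>. flow_orbit \<Gamma> \<sigma> v \<in> W}"
proof -
  let ?Q = "\<lambda>W. {v \<in> cover_space \<Gamma>. flow_orbit \<Gamma> \<sigma> v \<in> W}"
  have "istopology (\<lambda>W. W \<subseteq> flow_space \<Gamma> \<sigma> \<and> openin (top_of_set (cover_space \<Gamma>)) (?Q W))"
    unfolding istopology_def
  proof (intro conjI allI impI)
    fix S T
    assume "S \<subseteq> flow_space \<Gamma> \<sigma> \<and> openin (top_of_set (cover_space \<Gamma>)) (?Q S)"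
       and "T \<subseteq> flow_space \<Gamma> \<sigma> \<and> openin (top_of_set (cover_space \<Gamma>)) (?Q T)"
    moreover have "?Q (S \<inter> T) = ?Q S \<inter> ?Q T" by auto
    ultimately show "S \<inter> T \<subseteq> flow_space \<Gamma> \<sigma>"
      and "openin (top_of_set (cover_space \<Gamma>)) (?Q (S \<inter> T))" by (auto simp: openin_Int)
  next
    fix K
    assume *: "\<forall>W\<in>K. W \<subseteq> flow_space \<Gamma> \<sigma> \<and> openin (top_of_set (cover_space \<Gamma>)) (?Q W)"
    have "?Q (\<Union>K) = \<Union> (?Q ` K)" by auto
    then show "openin (top_of_set (cover_space \<Gamma>)) (?Q (\<Union>K))"
      using * by (simp only:) blast
    show "\<Union>K \<subseteq> flow_space \<Gamma> \<sigma>" using * by blast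
  qed
  then show ?thesis by (simp add: flow_space_topology_def)
qed

lemma topspace_flow_space_topology: "topspace (flow_space_topology \<Gamma> \<sigma>) = flow_space \<Gamma> \<sigma>"
proof
  have "{v \<in> cover_space \<Gamma>. flow_orbit \<Gamma> \<sigma> v \<in> flow_space \<Gamma> \<sigma>} = cover_space \<Gamma>"
    by (auto simp: flow_space_def)
  then have "openin (flow_space_topology \<Gamma> \<sigma>) (flow_space \<Gamma> \<sigma>)"
    by (simp add: openin_flow_space_topology)
  then show "flow_space \<Gamma> \<sigma> \<subseteq> topspace (flow_space_topology \<Gamma> \<sigma>)" by (rule openin_subset)
  show "topspace (flow_space_topology \<Gamma> \<sigma>) \<subseteq> flow_space \<Gamma> \<sigma>"
    using openin_flow_space_topology openin_topspace by blast
qed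

lemma quotient_map_flow_orbit:
  "quotient_map (top_of_set (cover_space \<Gamma>)) (flow_space_topology \<Gamma> \<sigma>) (flow_orbit \<Gamma> \<sigma>)"
  by (auto simp: quotient_map_def topspace_flow_space_topology flow_space_def
      openin_flow_space_topology)

text \<open>The flow commutes with the action, so it acts on orbits by taking images.\<close>

definition quotient_flow :: "real \<Rightarrow> ('m \<times> 'm \<times> real) set \<Rightarrow> ('m \<times> 'm \<times> real) set" where
  "quotient_flow t u = cover_flow t ` u"

lemma quotient_flow_orbit: "quotient_flow t (flow_orbit \<Gamma> \<sigma> v) = flow_orbit \<Gamma> \<sigma> (cover_flow t v)"
  by (auto simp: quotient_flow_def flow_orbit_def cover_flow_def cover_act_def image_image
      split: prod.splits intro!: image_cong)

text \<open>Here \<open>\<mu>'\<close> is the measure attached to \<open>\<sigma>'\<close> (written with a bar in the literature); it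
  governs the first coordinate and \<open>\<mu>\<close> the second. For second countable \<open>M\<close> (automatic for compact
  metrizable \<open>M\<close>) the product sigma-algebra is the Borel one.\<close>

definition BMS_cover_measure ::
    "('m::topological_space \<Rightarrow> 'm) set \<Rightarrow> ('m \<times> 'm \<Rightarrow> real) \<Rightarrow> real \<Rightarrow> 'm measure \<Rightarrow> 'm measure
       \<Rightarrow> ('m \<times> 'm \<times> real) measure" where
  "BMS_cover_measure \<Gamma> G \<delta> \<mu>' \<mu> =
     density (restrict_space (\<mu>' \<Otimes>\<^sub>M (\<mu> \<Otimes>\<^sub>M lborel)) (cover_space \<Gamma>))
       (\<lambda>(x, y, t). ennreal (exp (\<delta> * G (x, y))))"

text \<open>The Borel measure \<open>m\<close> on the flow space is the descent of the invariant measure \<open>m'\<close> on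
  the cover. The function \<open>h\<close> below is the function on the flow space that
  \<open>v \<mapsto> \<Sum>\<gamma>. f (\<gamma> v)\<close> induces.\<close>

definition descends_to ::
    "('m::topological_space \<Rightarrow> 'm) set \<Rightarrow> (('m \<Rightarrow> 'm) \<Rightarrow> 'm \<Rightarrow> real) \<Rightarrow> ('m \<times> 'm \<times> real) measure
       \<Rightarrow> ('m \<times> 'm \<times> real) set measure \<Rightarrow> bool" where
  "descends_to \<Gamma> \<sigma> m' m \<longleftrightarrow>
     space m = flow_space \<Gamma> \<sigma> \<and>
     sets m = sigma_sets (flow_space \<Gamma> \<sigma>) {W. openin (flow_space_topology \<Gamma> \<sigma>) W} \<and>
     (\<forall>(f :: 'm \<times> 'm \<times> real \<Rightarrow> ennreal) h. f \<in> borel_measurable m' \<and>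
        (\<forall>v\<in>cover_space \<Gamma>. h (flow_orbit \<Gamma> \<sigma> v) = (\<Sum>\<^sub>\<infinity>\<gamma>\<in>\<Gamma>. f (cover_act \<sigma> \<gamma> v))) \<longrightarrow>
        (\<integral>\<^sup>+v. f v \<partial>m') = (\<integral>\<^sup>+u. h u \<partial>m))"

definition is_BMS_measure ::
    "('m::topological_space \<Rightarrow> 'm) set \<Rightarrow> (('m \<Rightarrow> 'm) \<Rightarrow> 'm \<Rightarrow> real) \<Rightarrow> (('m \<Rightarrow> 'm) \<Rightarrow> 'm \<Rightarrow> real)
       \<Rightarrow> ('m \<times> 'm \<Rightarrow> real) \<Rightarrow> real \<Rightarrow> ('m \<times> 'm \<times> real) set measure \<Rightarrow> bool" where
  "is_BMS_measure \<Gamma> \<sigma> \<sigma>' G \<delta> m \<longleftrightarrow>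
     (\<exists>\<mu> \<mu>'. conformal_measure \<Gamma> \<sigma> \<delta> \<mu> \<and> conformal_measure \<Gamma> \<sigma>' \<delta> \<mu>' \<and>
        descends_to \<Gamma> \<sigma> (BMS_cover_measure \<Gamma> G \<delta> \<mu>' \<mu>) m)"

definition wandering_set :: "'a measure \<Rightarrow> (real \<Rightarrow> 'a \<Rightarrow> 'a) \<Rightarrow> 'a set \<Rightarrow> bool" where
  "wandering_set m \<psi> W \<longleftrightarrow>
     W \<in> sets m \<and> (AE u in m. u \<in> W \<longrightarrow> compact (closure {t. \<psi> t u \<in> W}))"

definition conservative_flow :: "'a measure \<Rightarrow> (real \<Rightarrow> 'a \<Rightarrow> 'a) \<Rightarrow> bool" where
  "conservative_flow m \<psi> \<longleftrightarrow> (\<forall>W. wandering_set m \<psi> W \<longrightarrow> emeasure m W = 0)"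

definition ergodic_flow :: "'a measure \<Rightarrow> (real \<Rightarrow> 'a \<Rightarrow> 'a) \<Rightarrow> bool" where
  "ergodic_flow m \<psi> \<longleftrightarrow>
     (\<forall>A\<in>sets m. (\<forall>t. \<psi> t -` A \<inter> space m = A) \<longrightarrow>
        emeasure m A = 0 \<or> emeasure m (space m - A) = 0)"

end

(* The Hopf--Tsuji--Sullivan argument. Intersecting shadows have almost additive magnitudes, so
   divergence of the Poincare series and a second moment estimate give the set of conical limit points
   positive mass; applying this to the restriction of the conformal measure to its complement shows
   that almost every point is conical. A conical point returns infinitely often to a set of finite
   measure, which makes the flow conservative. For ergodicity, two points of the flow space with the
   same forward endpoint y and the same time have asymptotic forward orbits. A maximal inequality
   compares the Birkhoff sums of an invariant set with those of a continuous approximation of it, and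
   these sums diverge, so an invariant set essentially depends only on y; exchanging the two
   endpoints, it essentially depends only on x, hence is null or conull.

   No ergodic theory is done on the quotient. Every function used there is an orbit sum of a function
   on the cover, so only the comparison "orbit sum of f <= orbit sum of g implies
   integral of f <= integral of g" on the cover is needed. *)

theory Submission
  imports Defs
begin

section \<open>Dynamics on the compactification\<close>

text \<open>The invariant measure may be infinite, so there are no Birkhoff averages to compare.
  Everything is measured against the sums of one fixed integrable function, \<open>bump\<close>: off
  a set of small \<open>bump\<close>-mass the error of the approximation has, for every number of
  steps, at most a sixth of the sum of \<open>bump\<close>, and this is what the Hopf argument works
  with.

  The dynamics enters through one uniform statement, \<open>contraction\<close>: for each radius,
  all but finitely many \<open>g\<close> send the complement of the ball about \<open>inv g\<close>
  into the ball about \<open>g\<close>. The magnitude controls \<sigma> on the same complement. Most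
  estimates choose a radius, set aside finitely many elements, and use the triangle inequality in
  the compactification.

  The obstacle is that a sequence of distinct elements may have equal attracting and repelling
  limits, while properness speaks of loxodromic elements with separated fixed points. Composing with
  an element that moves the attracting limit repairs this; such an element exists because \<Gamma>
  fixes no point, which is itself a consequence of properness.\<close>

locale conv_group =
  fixes \<Gamma> :: "('m::{metric_space, second_countable_topology} \<Rightarrow> 'm) set"
    and d :: "('m \<Rightarrow> 'm) + 'm \<Rightarrow> ('m \<Rightarrow> 'm) + 'm \<Rightarrow> real"
  assumes compact_M: "compact (UNIV :: 'm set)"
    and conv: "convergence_group \<Gamma>"
    and nonel: "non_elementary \<Gamma>"
    and compat: "compatible_metric \<Gamma> d"
begin

abbreviation X :: "(('m \<Rightarrow> 'm) + 'm) set" where "X \<equiv> \<Gamma> <+> UNIV"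

abbreviation act :: "('m \<Rightarrow> 'm) \<Rightarrow> ('m \<Rightarrow> 'm) + 'm \<Rightarrow> ('m \<Rightarrow> 'm) + 'm" where
  "act g \<equiv> map_sum (\<lambda>\<eta>. g \<circ> \<eta>) g"

declare PlusE [rule del]

sublocale ms: Metric_space X d
  using compat by (simp add: compatible_metric_def)

lemma X_Inr [simp]: "Inr x \<in> X" and X_Inl [simp]: "Inl g \<in> X \<longleftrightarrow> g \<in> \<Gamma>"
  by (auto simp: Plus_def)

lemma compact_X: "compact_space ms.mtopology"
  and emb_Inl: "embedding_map (discrete_topology \<Gamma>) ms.mtopology Inl"
  and emb_Inr: "embedding_map euclidean ms.mtopology Inr"
  and conv_X: "convergence_action ms.mtopology \<Gamma> act"
  using compat by (auto simp: compatible_metric_def Let_def)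

lemma homeo_subgroup: "homeo_subgroup \<Gamma>"
  using conv by (simp add: convergence_group_def)

lemma id_in [simp]: "id \<in> \<Gamma>"
  using homeo_subgroup by (simp add: homeo_subgroup_def)

lemma comp_in [simp]: "g \<in> \<Gamma> \<Longrightarrow> h \<in> \<Gamma> \<Longrightarrow> g \<circ> h \<in> \<Gamma>"
  using homeo_subgroup by (simp add: homeo_subgroup_def)

lemma inv_in [simp]: "g \<in> \<Gamma> \<Longrightarrow> inv g \<in> \<Gamma>"
  using homeo_subgroup by (simp add: homeo_subgroup_def)

lemma homeo: "g \<in> \<Gamma> \<Longrightarrow> homeomorphic_map euclidean euclidean g"
  using homeo_subgroup by (simp add: homeo_subgroup_def)

lemma bij: "g \<in> \<Gamma> \<Longrightarrow> bij g"
  using homeo[of g] unfolding bij_def homeomorphic_map_def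
  by (metis UNIV_def injective_quotient_map quotient_imp_surjective_map topspace_euclidean
      homeo homeomorphic_imp_injective_map homeomorphic_imp_surjective_map)

lemma inv_app [simp]: "g \<in> \<Gamma> \<Longrightarrow> inv g (g x) = x" "g \<in> \<Gamma> \<Longrightarrow> g (inv g x) = x"
  using bij[of g] by (auto simp: bij_def inv_f_f surj_f_inv_f)

lemma inv_comp [simp]: "g \<in> \<Gamma> \<Longrightarrow> inv g \<circ> g = id" "g \<in> \<Gamma> \<Longrightarrow> g \<circ> inv g = id"
  by (auto simp: fun_eq_iff)

lemma inv_inv [simp]: "g \<in> \<Gamma> \<Longrightarrow> inv (inv g) = g"
  using bij[of g] by (simp add: inv_inv_eq)

lemma inv_o: "g \<in> \<Gamma> \<Longrightarrow> h \<in> \<Gamma> \<Longrightarrow> inv (g \<circ> h) = inv h \<circ> inv g"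
  using bij[of g] bij[of h] by (simp add: o_inv_distrib)

lemma inj_inv: "inj_on inv \<Gamma>"
  by (metis inj_onI inv_inv)

lemma inv_image [simp]: "inv ` \<Gamma> = \<Gamma>"
proof
  show "\<Gamma> \<subseteq> inv ` \<Gamma>" using inv_inv inv_in by (metis image_eqI subsetI)
qed auto

lemma cont: "g \<in> \<Gamma> \<Longrightarrow> continuous_on UNIV g"
  using homeo[of g] homeomorphic_imp_continuous_map continuous_map_iff_continuous2 by fastforce

lemma meas [measurable (raw)]: "g \<in> \<Gamma> \<Longrightarrow> g \<in> borel_measurable borel"
  using cont by (rule borel_measurable_continuous_onI)

lemma act_in [simp]: "g \<in> \<Gamma> \<Longrightarrow> p \<in> X \<Longrightarrow> act g p \<in> X"
  by (cases p) auto

lemma act_comp: "act g (act h p) = act (g \<circ> h) p"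
  by (cases p) (auto simp: o_assoc)

lemma act_id [simp]: "act id p = p"
  by (cases p) auto

lemma act_inv [simp]: "g \<in> \<Gamma> \<Longrightarrow> act (inv g) (act g p) = p" "g \<in> \<Gamma> \<Longrightarrow> act g (act (inv g) p) = p"
  by (simp_all only: act_comp inv_comp act_id)

text \<open>All terms are required to lie in \<open>X\<close>, because \<open>d\<close> is a metric
  only there; \<open>limitin\<close> asks for this only eventually.\<close>

definition cv :: "(nat \<Rightarrow> ('m \<Rightarrow> 'm) + 'm) \<Rightarrow> ('m \<Rightarrow> 'm) + 'm \<Rightarrow> bool" where
  "cv f l \<longleftrightarrow> l \<in> X \<and> (\<forall>n. f n \<in> X) \<and> (\<lambda>n. d (f n) l) \<longlonglongrightarrow> 0"

lemma cv_limitin: "cv f l \<longleftrightarrow> (\<forall>n. f n \<in> X) \<and> limitin ms.mtopology f l sequentially"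
  by (auto simp: cv_def ms.limitin_metric_dist_null)

lemma cv_unique: "cv f l \<Longrightarrow> cv f l' \<Longrightarrow> l = l'"
  by (auto simp: cv_limitin intro: ms.limitin_metric_unique)

lemma cv_subseq: "cv f l \<Longrightarrow> strict_mono r \<Longrightarrow> cv (\<lambda>n. f (r n)) l"
  unfolding cv_def using LIMSEQ_subseq_LIMSEQ[of "\<lambda>n. d (f n) l" 0 r] by (auto simp: o_def)

lemma cv_D: "cv f l \<Longrightarrow> e > 0 \<Longrightarrow> \<forall>\<^sub>F n in sequentially. d (f n) l < e"
  unfolding cv_def by (auto simp: tendsto_iff)

lemma cv_I: "l \<in> X \<Longrightarrow> (\<And>n. f n \<in> X) \<Longrightarrow> (\<And>e. e > 0 \<Longrightarrow> \<forall>\<^sub>F n in sequentially. d (f n) l < e) \<Longrightarrow> cv f l"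
  unfolding cv_def by (auto simp: tendsto_iff)

lemma cv_mem: "cv f l \<Longrightarrow> l \<in> X" "cv f l \<Longrightarrow> f n \<in> X"
  by (auto simp: cv_def)

lemma cv_dist: "cv f l \<Longrightarrow> cv g l' \<Longrightarrow> (\<lambda>n. d (f n) (g n)) \<longlonglongrightarrow> d l l'"
proof -
  assume a: "cv f l" "cv g l'"
  have "\<bar>d (f n) (g n) - d l l'\<bar> \<le> d (f n) l + d (g n) l'" for n
  proof -
    have m: "f n \<in> X" "g n \<in> X" "l \<in> X" "l' \<in> X" using a by (auto simp: cv_def)
    show ?thesis
      using ms.triangle[OF m(1,3,4)] ms.triangle[OF m(1,4,2)] ms.triangle[OF m(3,1,2)]
        ms.triangle[OF m(3,2,4)]
        ms.commute[of l "f n"] ms.commute[of l' "g n"] ms.commute[of l' "f n"] by linarith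
  qed
  moreover have "(\<lambda>n. d (f n) l + d (g n) l') \<longlonglongrightarrow> 0"
    using a tendsto_add[of "\<lambda>n. d (f n) l" 0 _ "\<lambda>n. d (g n) l'" 0] by (auto simp: cv_def)
  ultimately have "(\<lambda>n. d (f n) (g n) - d l l') \<longlonglongrightarrow> 0"
    by (intro tendsto_rabs_zero_cancel[of "\<lambda>n. d (f n) (g n) - d l l'"])
      (auto intro: tendsto_sandwich[of "\<lambda>_. 0" _ _ "\<lambda>n. d (f n) l + d (g n) l'"])
  then show ?thesis by (simp add: LIM_zero_iff)
qed

lemma cv_const [simp]: "l \<in> X \<Longrightarrow> cv (\<lambda>_. l) l"
  by (auto simp: cv_def)

lemma seq_compact: "\<forall>n. f n \<in> X \<Longrightarrow> \<exists>l r. strict_mono (r :: nat \<Rightarrow> nat) \<and> cv (\<lambda>n. f (r n)) l"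
proof -
  assume f: "\<forall>n. f n \<in> X"
  then have "range f \<subseteq> X" by auto
  then obtain l r where "l \<in> X" "strict_mono r" "limitin ms.mtopology (f \<circ> r) l sequentially"
    using compact_X[unfolded ms.compact_space_sequentially, rule_format, OF \<open>range f \<subseteq> X\<close>] by (elim exE conjE)
  then show ?thesis using f unfolding cv_limitin by (auto simp: o_def)
qed

lemma continuous_map_cv:
  assumes "continuous_map ms.mtopology ms.mtopology f" "cv p l" "\<And>q. q \<in> X \<Longrightarrow> f q \<in> X"
  shows "cv (\<lambda>n. f (p n)) (f l)"
  using continuous_map_limit[OF assms(1), of p l sequentially] assms(2,3)
  by (auto simp: cv_limitin o_def)

lemma cv_act: "g \<in> \<Gamma> \<Longrightarrow> cv p l \<Longrightarrow> cv (\<lambda>n. act g (p n)) (act g l)"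
  using conv_X continuous_map_cv[of "act g" p l] homeomorphic_imp_continuous_map[of ms.mtopology ms.mtopology "act g"]
  by (simp add: convergence_action_def)

lemma cv_Inr: "cv (\<lambda>n. Inr (x n)) (Inr l) \<longleftrightarrow> x \<longlonglongrightarrow> l"
proof
  have c: "continuous_map euclidean ms.mtopology Inr"
    using emb_Inr unfolding embedding_map_def
    by (auto dest!: homeomorphic_imp_continuous_map simp: continuous_map_in_subtopology)
  show "cv (\<lambda>n. Inr (x n)) (Inr l)" if "x \<longlonglongrightarrow> l"
    using continuous_map_limit[OF c, of x l sequentially] that
    by (auto simp: cv_limitin o_def)
  assume *: "cv (\<lambda>n. Inr (x n)) (Inr l)"
  show "x \<longlonglongrightarrow> l"
  proof (rule topological_tendstoI)
    fix S assume S: "open S" "l \<in> S"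
    have "openin (subtopology ms.mtopology (range Inr)) (Inr ` S)"
      using emb_Inr S(1) unfolding embedding_map_def by (simp add: homeomorphic_map_openness)
    then obtain T where T: "openin ms.mtopology T" "Inr ` S = T \<inter> range Inr"
      unfolding openin_subtopology by auto
    have "Inr l \<in> T" using T S by blast
    then have "\<forall>\<^sub>F n in sequentially. Inr (x n) \<in> T"
      using * T(1) unfolding cv_limitin limitin_def by auto
    then show "\<forall>\<^sub>F n in sequentially. x n \<in> S"
    proof eventually_elim
      case (elim n)
      then have "Inr (x n) \<in> T \<inter> range Inr" by (rule IntI) (rule rangeI)
      then show ?case unfolding T(2)[symmetric] by auto
    qed
  qed
qed

lemma M_seq_compact: "\<exists>l r. strict_mono (r :: nat \<Rightarrow> nat) \<and> (\<lambda>n. (x :: nat \<Rightarrow> 'm) (r n)) \<longlonglongrightarrow> l"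
proof -
  have "seq_compact (UNIV :: 'm set)" using compact_M by (simp add: compact_eq_seq_compact_metric)
  then show ?thesis by (auto simp: seq_compact_def o_def)
qed

text \<open>The copy of \<open>M\<close> is compact, hence closed, so the copy of \<Gamma> is open.
  Its subspace topology is discrete, so its points are isolated in the whole space.\<close>

lemma isolated: "g \<in> \<Gamma> \<Longrightarrow> \<exists>r>0. \<forall>p\<in>X. d p (Inl g) < r \<longrightarrow> p = Inl g"
proof -
  assume g: "g \<in> \<Gamma>"
  have c: "continuous_map euclidean ms.mtopology Inr"
    using emb_Inr unfolding embedding_map_def
    by (auto dest!: homeomorphic_imp_continuous_map simp: continuous_map_in_subtopology)
  have "compactin ms.mtopology (range Inr)"
    using image_compactin[OF _ c, of UNIV] compact_M by simp
  then have "closedin ms.mtopology (range Inr)"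
    using compactin_imp_closedin ms.Hausdorff_space_mtopology by blast
  then have "openin ms.mtopology (X - range Inr)" by (metis openin_diff openin_topspace ms.topspace_mtopology)
  moreover have "X - range Inr = Inl ` \<Gamma>" by (auto elim: PlusE)
  ultimately have o: "openin ms.mtopology (Inl ` \<Gamma>)" by simp
  have "openin (subtopology ms.mtopology (Inl ` \<Gamma>)) (Inl ` {g})"
    using homeomorphic_map_openness[of "discrete_topology \<Gamma>" _ Inl "{g}"] emb_Inl g
    unfolding embedding_map_def by auto
  then have "openin ms.mtopology {Inl g}" using o by (simp add: openin_open_subtopology)
  then obtain r where "r > 0" "ms.mball (Inl g) r \<subseteq> {Inl g}"
    by (auto simp: ms.openin_mtopology)
  then show ?thesis using g ms.commute by (intro exI[of _ r]) (auto simp: subset_iff)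
qed

lemma cv_Inl_imp: "cv f (Inl g) \<Longrightarrow> \<forall>\<^sub>F n in sequentially. f n = Inl g"
proof -
  assume c: "cv f (Inl g)"
  then have "g \<in> \<Gamma>" using cv_mem(1)[of f "Inl g"] by (simp only: X_Inl)
  then obtain r where r: "r > 0" "\<forall>p\<in>X. d p (Inl g) < r \<longrightarrow> p = Inl g" using isolated by meson
  from cv_D[OF c r(1)] show ?thesis
  proof eventually_elim
    case (elim n)
    then show ?case using bspec[OF r(2), of "f n"] cv_mem(2)[OF c] by (simp only: simp_thms)
  qed
qed

lemma cv_inj_Inr:
  assumes "inj g" "cv (\<lambda>n. Inl (g n)) l"
  shows "\<exists>x. l = Inr x"
proof (cases l)
  case (Inl h)
  then have "\<forall>\<^sub>F n in sequentially. g n = h" using cv_Inl_imp[of "\<lambda>n. Inl (g n)" h] assms by auto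
  then obtain k where "\<forall>n\<ge>k. g n = h" unfolding eventually_sequentially by auto
  then have k: "g k = h" "g (Suc k) = h" by auto
  then have "k = Suc k" using assms(1) by (metis injD)
  then show ?thesis by simp
qed auto

text \<open>Locally uniform convergence lets the argument move with \<open>n\<close>, as long as its
  limit avoids the exceptional point \<open>y\<close>. Eventually \<open>p n\<close> is closer to
  \<open>l\<close> than \<open>y\<close> is, so \<open>p n\<close> itself avoids
  \<open>y\<close>.\<close>

lemma luc_cv:
  assumes "loc_unif_to_const ms.mtopology f (X - {y}) x" "x \<in> X" "y \<in> X" "\<And>n p. p \<in> X \<Longrightarrow> f n p \<in> X"
    and "cv p l" "l \<noteq> y" "strict_mono r"
  shows "cv (\<lambda>n. f (r n) (p n)) x"
proof (rule cv_I)
  have lX: "l \<in> X" "\<And>n. p n \<in> X" using assms(5) cv_mem by auto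
  then obtain W where W: "openin ms.mtopology W" "l \<in> W"
    "\<And>U. openin ms.mtopology U \<Longrightarrow> x \<in> U \<Longrightarrow> (\<forall>\<^sub>F n in sequentially. f n ` (W \<inter> (X - {y})) \<subseteq> U)"
    using assms(1,6) unfolding loc_unif_to_const_def by (metis DiffI singletonD)
  fix e :: real assume "e > 0"
  then have "\<forall>\<^sub>F n in sequentially. f n ` (W \<inter> (X - {y})) \<subseteq> ms.mball x e"
    using assms(2) by (intro W) auto
  then have 1: "\<forall>\<^sub>F n in sequentially. f (r n) ` (W \<inter> (X - {y})) \<subseteq> ms.mball x e"
    by (rule eventually_subseq[OF assms(7)])
  have 2: "\<forall>\<^sub>F n in sequentially. p n \<in> W"
    using assms(5) W unfolding cv_limitin limitin_def by auto
  have 3: "\<forall>\<^sub>F n in sequentially. d (p n) l < d l y"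
    using assms(3,6) lX by (intro cv_D[OF assms(5)]) (auto simp: ms.mdist_pos_eq)
  show "\<forall>\<^sub>F n in sequentially. d (f (r n) (p n)) x < e"
    using 1 2 3
  proof eventually_elim
    case (elim n)
    then have "p n \<noteq> y" by (auto simp: ms.commute)
    then have "p n \<in> W \<inter> (X - {y})" using elim lX by auto
    then have "f (r n) (p n) \<in> ms.mball x e" using elim(1) by blast
    then show ?case by (simp add: ms.commute)
  qed
qed (use assms cv_mem in auto)

text \<open>The convergence property provides an attracting point \<open>x\<close> and a repelling
  point \<open>y\<close> without relating them to the sequence. Evaluating \<open>g n\<close> at
  \<open>inv (g n)\<close> gives the identity, so if a limit of the inverses were not
  \<open>y\<close>, the identity would be attracting; being isolated, it would equal
  \<open>g n \<circ> h\<close> for a fixed \<open>h\<close> and all large \<open>n\<close> of a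
  subsequence. Hence \<open>y\<close> is the limit of the inverses, and evaluating at the identity
  shows that \<open>x\<close> is the limit of the elements.\<close>

lemma conv_subseq:
  assumes "inj g" "\<forall>n. g n \<in> \<Gamma>"
  shows "\<exists>r a b. strict_mono (r :: nat \<Rightarrow> nat) \<and> cv (\<lambda>n. Inl (g (r n))) (Inr a) \<and> cv (\<lambda>n. Inl (inv (g (r n)))) (Inr b) \<and>
     (\<forall>p l s. cv p l \<longrightarrow> l \<noteq> Inr b \<longrightarrow> strict_mono s \<longrightarrow> cv (\<lambda>n. act (g (r (s n))) (p n)) (Inr a))"
proof -
  have rg: "range g \<subseteq> \<Gamma>" using assms(2) by auto
  have "\<exists>x\<in>topspace ms.mtopology. \<exists>y\<in>topspace ms.mtopology. \<exists>r :: nat \<Rightarrow> nat. strict_mono r \<and>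
           loc_unif_to_const ms.mtopology (\<lambda>n. act (g (r n))) (topspace ms.mtopology - {y}) x"
    using conv_X assms(1) rg unfolding convergence_action_def by (elim conjE allE[of _ g]) blast
  then obtain x y r where xy: "x \<in> X" "y \<in> X" and r: "strict_mono (r :: nat \<Rightarrow> nat)"
    and luc: "loc_unif_to_const ms.mtopology (\<lambda>n. act (g (r n))) (X - {y}) x"
    by auto
  have L: "cv (\<lambda>n. act (g (r (s n))) (p n)) x" if "cv p l" "l \<noteq> y" "strict_mono s" for p l s
    using luc_cv[OF luc xy _ that] assms(2) by simp
  have "\<forall>n. Inl (inv (g (r n))) \<in> X" using assms(2) by auto
  then obtain b s where s: "strict_mono (s :: nat \<Rightarrow> nat)" "cv (\<lambda>n. Inl (inv (g (r (s n))))) b"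
    using seq_compact[of "\<lambda>n. Inl (inv (g (r n)))"] by auto
  have injr: "inj (\<lambda>n. g (r (s n)))"
  proof (rule injI)
    fix x y assume "g (r (s x)) = g (r (s y))"
    then have "r (s x) = r (s y)" by (rule injD[OF assms(1)])
    then show "x = y" using r s(1) by (simp add: strict_mono_eq)
  qed
  have inji: "inj (\<lambda>n. inv (g (r (s n))))"
  proof (rule injI)
    fix x y assume "inv (g (r (s x))) = inv (g (r (s y)))"
    then have "g (r (s x)) = g (r (s y))" using inj_onD[OF inj_inv] assms(2) by blast
    then show "x = y" by (rule injD[OF injr])
  qed
  have beq: "b = y"
  proof (rule ccontr)
    assume "b \<noteq> y"
    from L[OF s(2) this s(1)] have "cv (\<lambda>n. Inl id) x" using assms(2) by simp
    moreover have "cv (\<lambda>n. Inl id) (Inl id)" by simp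
    ultimately have x: "x = Inl id" using cv_unique by blast
    have "g 0 \<noteq> g 1" using injD[OF assms(1), of 0 1] by auto
    then have "Inl (g 0) \<noteq> y \<or> Inl (g 1) \<noteq> y" by auto
    then obtain h where h: "h \<in> \<Gamma>" "Inl h \<noteq> y" using assms(2) by metis
    have "cv (\<lambda>n. Inl h) (Inl h)" using h by simp
    from L[OF this h(2) s(1)] have "cv (\<lambda>n. Inl (g (r (s n)) \<circ> h)) (Inl id)" unfolding x by simp
    from cv_Inl_imp[OF this] have "\<forall>\<^sub>F n in sequentially. g (r (s n)) \<circ> h = id" by simp
    then have "\<forall>\<^sub>F n in sequentially. g (r (s n)) = inv h"
    proof eventually_elim
      case (elim n)
      then have "g (r (s n)) \<circ> (h \<circ> inv h) = inv h" by (simp add: o_assoc)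
      then show ?case using h by simp
    qed
    then obtain k where "\<forall>n\<ge>k. g (r (s n)) = inv h" unfolding eventually_sequentially by auto
    then have "g (r (s k)) = inv h" "g (r (s (Suc k))) = inv h" by auto
    then have "k = Suc k" using injr by (metis (mono_tags, lifting) injD)
    then show False by simp
  qed
  obtain b' where b': "b = Inr b'" using cv_inj_Inr[OF inji s(2)] by auto
  have "Inl id \<noteq> y" using beq b' by auto
  from L[OF cv_const this s(1)] have xc: "cv (\<lambda>n. Inl (g (r (s n)))) x" by simp
  obtain a where a: "x = Inr a" using cv_inj_Inr[OF injr xc] by auto
  show ?thesis
  proof (intro exI conjI allI impI)
    show "strict_mono (\<lambda>n. r (s n))" using r s(1) by (auto simp: strict_mono_def)
    show "cv (\<lambda>n. Inl (g (r (s n)))) (Inr a)" using xc a by simp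
    show "cv (\<lambda>n. Inl (inv (g (r (s n))))) (Inr b')" using s(2) b' by simp
    fix p l t assume "cv p l" "l \<noteq> Inr b'" "strict_mono (t :: nat \<Rightarrow> nat)"
    moreover have "strict_mono (\<lambda>n. s (t n))" using \<open>strict_mono t\<close> s(1) by (auto simp: strict_mono_def)
    ultimately show "cv (\<lambda>n. act (g (r (s (t n)))) (p n)) (Inr a)"
      using L[of p l "\<lambda>n. s (t n)"] beq b' a by simp
  qed
qed

lemma infinite_seq: "infinite (B :: 'a set) \<Longrightarrow> \<exists>g :: nat \<Rightarrow> 'a. inj g \<and> (\<forall>n. g n \<in> B)"
  using infinite_countable_subset[of B] by (auto simp: image_subset_iff)

text \<open>Infinitely many exceptions would contain a sequence as in \<open>conv_subseq\<close>,
  with points \<open>p\<close> whose limit stays at distance \<open>e\<close> from the limit of the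
  inverses. Then the images of \<open>p\<close> and the elements themselves have the same limit,
  contradicting their distance \<open>e\<close>.\<close>

lemma contraction:
  assumes "e > 0"
  shows "\<exists>F. finite F \<and> (\<forall>g\<in>\<Gamma> - F. \<forall>p\<in>X. d p (Inl (inv g)) > e \<longrightarrow> d (act g p) (Inl g) < e)"
proof -
  define B where "B = {g \<in> \<Gamma>. \<exists>p\<in>X. d p (Inl (inv g)) > e \<and> d (act g p) (Inl g) \<ge> e}"
  have "finite B"
  proof (rule ccontr)
    assume "infinite B"
    then obtain g where g: "inj (g :: nat \<Rightarrow> _)" "\<And>n. g n \<in> B" using infinite_seq[of B] by auto
    have "\<forall>n. \<exists>p. p \<in> X \<and> d p (Inl (inv (g n))) > e \<and> d (act (g n) p) (Inl (g n)) \<ge> e"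
      using g(2) by (simp add: B_def Bex_def)
    then have "\<exists>p. \<forall>n. p n \<in> X \<and> d (p n) (Inl (inv (g n))) > e \<and> d (act (g n) (p n)) (Inl (g n)) \<ge> e"
      by (rule choice)
    then obtain p where p: "\<And>n. p n \<in> X" "\<And>n. d (p n) (Inl (inv (g n))) > e"
      "\<And>n. d (act (g n) (p n)) (Inl (g n)) \<ge> e" by auto
    have gG: "\<forall>n. g n \<in> \<Gamma>" using g(2) by (auto simp: B_def)
    obtain r a b where r: "strict_mono (r :: nat \<Rightarrow> nat)" and A: "cv (\<lambda>n. Inl (g (r n))) (Inr a)"
      and Bc: "cv (\<lambda>n. Inl (inv (g (r n)))) (Inr b)"
      and L: "\<forall>p l s. cv p l \<longrightarrow> l \<noteq> Inr b \<longrightarrow> strict_mono s \<longrightarrow> cv (\<lambda>n. act (g (r (s n))) (p n)) (Inr a)"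
      using conv_subseq[OF g(1) gG] by auto
    obtain l s where s: "strict_mono (s :: nat \<Rightarrow> nat)" "cv (\<lambda>n. p (r (s n))) l"
      using seq_compact[of "\<lambda>n. p (r n)"] p(1) by auto
    have "(\<lambda>n. d (p (r (s n))) (Inl (inv (g (r (s n)))))) \<longlonglongrightarrow> d l (Inr b)"
      using cv_dist[OF s(2) cv_subseq[OF Bc s(1)]] .
    then have "d l (Inr b) \<ge> e"
      by (rule LIMSEQ_le_const) (use p(2) in \<open>auto intro: less_imp_le\<close>)
    then have "l \<noteq> Inr b" using assms by (auto simp: )
    then have "cv (\<lambda>n. act (g (r (s n))) (p (r (s n)))) (Inr a)" using L s by auto
    from cv_dist[OF this cv_subseq[OF A s(1)]]
    have "(\<lambda>n. d (act (g (r (s n))) (p (r (s n)))) (Inl (g (r (s n))))) \<longlonglongrightarrow> 0" by simp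
    then have "0 \<ge> e" by (rule LIMSEQ_le_const) (use p(3) in auto)
    then show False using assms by simp
  qed
  then show ?thesis unfolding B_def by (intro exI[of _ B] conjI ballI impI)
    (auto simp: B_def not_le)
qed

end

section \<open>Limits of group elements, the limit set and loxodromic elements\<close>

context conv_group
begin

lemma cv_ball: "cv f l \<Longrightarrow> p \<in> X \<Longrightarrow> (\<And>n. d (f n) p \<le> e) \<Longrightarrow> d l p \<le> e"
  using cv_dist[of f l "\<lambda>_. p" p] by (auto intro: LIMSEQ_le_const2)

lemma cv_subsub:
  assumes "l \<in> X" "\<And>n. f n \<in> X"
    and "\<And>s. strict_mono (s :: nat \<Rightarrow> nat) \<Longrightarrow> \<exists>r. strict_mono (r :: nat \<Rightarrow> nat) \<and> cv (\<lambda>n. f (s (r n))) l"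
  shows "cv f l"
proof (rule cv_I)
  fix e :: real assume e: "e > 0"
  show "\<forall>\<^sub>F n in sequentially. d (f n) l < e"
  proof (rule ccontr)
    assume "\<not> ?thesis"
    from not_eventually_sequentiallyD[OF this] obtain s where
      s: "strict_mono (s :: nat \<Rightarrow> nat)" "\<And>n. \<not> d (f (s n)) l < e" by auto
    from assms(3)[OF s(1)] obtain r where "cv (\<lambda>n. f (s (r n))) l" by auto
    from cv_D[OF this e] s(2) show False by (simp add: eventually_sequentially)
  qed
qed (use assms in auto)

lemma cv_notin:
  assumes "cv (\<lambda>n. Inl (g n)) (Inr a)" "finite F"
  shows "\<forall>\<^sub>F n in sequentially. g n \<notin> F"
proof -
  have gG: "g n \<in> \<Gamma>" for n using cv_mem(2)[OF assms(1), of n] by (simp only: X_Inl)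
  have "\<forall>h\<in>F. \<forall>\<^sub>F n in sequentially. g n \<noteq> h"
  proof
    fix h assume "h \<in> F"
    show "\<forall>\<^sub>F n in sequentially. g n \<noteq> h"
    proof (cases "h \<in> \<Gamma>")
      case True
      then have "d (Inl h) (Inr a) > 0" by (subst ms.mdist_pos_eq) auto
      from cv_D[OF assms(1) this] show ?thesis by (rule eventually_mono) auto
    next
      case False
      then show ?thesis using gG by (intro always_eventually) auto
    qed
  qed
  then have "\<forall>\<^sub>F n in sequentially. \<forall>h\<in>F. g n \<noteq> h" using assms(2) by (simp add: eventually_ball_finite)
  then show ?thesis by (rule eventually_mono) auto
qed

text \<open>In contrast to \<open>conv_subseq\<close>, the full sequence converges: the limits of
  \<open>g n\<close> and \<open>inv (g n)\<close> alone determine the behaviour.\<close>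

lemma cv_contract:
  assumes a: "cv (\<lambda>n. Inl (g n)) (Inr a)" and b: "cv (\<lambda>n. Inl (inv (g n))) (Inr b)"
    and p: "cv p l" and l: "l \<noteq> Inr b"
  shows "cv (\<lambda>n. act (g n) (p n)) (Inr a)"
proof (rule cv_I)
  have gG: "g n \<in> \<Gamma>" for n using cv_mem(2)[OF a, of n] by (simp only: X_Inl)
  have pX: "p n \<in> X" "l \<in> X" for n using cv_mem[OF p] by auto
  then show "act (g n) (p n) \<in> X" for n using gG by simp
  fix e :: real assume "e > 0"
  define r where "r = d l (Inr b)"
  have r: "r > 0" unfolding r_def using l pX by (subst ms.mdist_pos_eq) auto
  define e' where "e' = min (e/2) (r/2)"
  have e': "e' > 0" using r \<open>e > 0\<close> by (auto simp: e'_def)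
  obtain F where F: "finite F" "\<forall>g\<in>\<Gamma> - F. \<forall>p\<in>X. d p (Inl (inv g)) > e' \<longrightarrow> d (act g p) (Inl g) < e'"
    using contraction[OF e'] by auto
  have 1: "\<forall>\<^sub>F n in sequentially. d (p n) (Inl (inv (g n))) > e'"
    using cv_dist[OF p b] r by (auto simp: r_def[symmetric] e'_def intro!: order_tendstoD(1))
  have "e/2 > 0" using \<open>e > 0\<close> by simp
  from 1 cv_notin[OF a F(1)] cv_D[OF a this]
  show "\<forall>\<^sub>F n in sequentially. d (act (g n) (p n)) (Inr a) < e"
  proof eventually_elim
    case (elim n)
    then have "d (act (g n) (p n)) (Inl (g n)) < e'" using F(2) gG pX by (metis DiffI)
    moreover have "d (act (g n) (p n)) (Inr a) \<le> d (act (g n) (p n)) (Inl (g n)) + d (Inl (g n)) (Inr a)"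
      using gG pX by (intro ms.triangle) auto
    ultimately show ?case using elim by (auto simp: e'_def)
  qed
qed auto

lemma cont_dist: "p \<in> X \<Longrightarrow> continuous_on UNIV (\<lambda>w. d (Inr w) p)"
  unfolding continuous_on_sequentially
proof (intro allI ballI impI)
  fix x a assume p: "p \<in> X" and a: "(\<forall>n. x n \<in> (UNIV::'m set)) \<and> x \<longlonglongrightarrow> a"
  then have "cv (\<lambda>n. Inr (x n)) (Inr a)" by (simp add: cv_Inr)
  from cv_dist[OF this cv_const[OF p]] show "((\<lambda>w. d (Inr w) p) \<circ> x) \<longlonglongrightarrow> d (Inr a) p" by (simp add: o_def)
qed

lemma cont_D: "continuous_on UNIV (\<lambda>z. d (Inr (fst z)) (Inr (snd z)))"
  unfolding continuous_on_sequentially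
proof (intro allI ballI impI)
  fix x a assume a: "(\<forall>n. x n \<in> (UNIV::('m \<times> 'm) set)) \<and> x \<longlonglongrightarrow> a"
  then have "cv (\<lambda>n. Inr (fst (x n))) (Inr (fst a))" "cv (\<lambda>n. Inr (snd (x n))) (Inr (snd a))"
    by (auto simp: cv_Inr intro: tendsto_intros)
  from cv_dist[OF this] show "((\<lambda>z. d (Inr (fst z)) (Inr (snd z))) \<circ> x) \<longlonglongrightarrow> d (Inr (fst a)) (Inr (snd a))"
    by (simp add: o_def)
qed

text \<open>On \<open>M\<close> both \<open>d\<close> and \<open>dist\<close> induce the same
  compact topology, so closeness in \<open>d\<close> forces closeness in \<open>dist\<close>
  uniformly. This carries estimates obtained from \<open>contraction\<close> over to neighbourhoods
  and moduli of continuity in \<open>M\<close>.\<close>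

lemma D_uniform:
  assumes "e > 0"
  shows "\<exists>s>0. \<forall>x y. d (Inr x) (Inr y) < s \<longrightarrow> dist x y < e"
proof (rule ccontr)
  assume *: "\<not> ?thesis"
  have "\<forall>n. \<exists>z. d (Inr (fst z)) (Inr (snd z)) < inverse (Suc n) \<and> \<not> dist (fst z) (snd z) < e"
  proof
    fix n :: nat
    have "(0::real) < inverse (Suc n)" by simp
    with * show "\<exists>z. d (Inr (fst z)) (Inr (snd z)) < inverse (Suc n) \<and> \<not> dist (fst z) (snd z) < e"
      by fastforce
  qed
  from choice[OF this] obtain z where z: "\<And>n. d (Inr (fst (z n))) (Inr (snd (z n))) < inverse (Suc n)"
    "\<And>n. \<not> dist (fst (z n)) (snd (z n)) < e" by auto
  obtain l r where r: "strict_mono (r :: nat \<Rightarrow> nat)" "(\<lambda>n. fst (z (r n))) \<longlonglongrightarrow> l"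
    using M_seq_compact[of "\<lambda>n. fst (z n)"] by auto
  have A: "cv (\<lambda>n. Inr (fst (z (r n)))) (Inr l)" using r(2) by (simp add: cv_Inr)
  have "cv (\<lambda>n. Inr (snd (z (r n)))) (Inr l)"
    unfolding cv_def
  proof (intro conjI allI)
    have 0: "(\<lambda>n. inverse (real (Suc (r n)))) \<longlonglongrightarrow> 0"
      using LIMSEQ_subseq_LIMSEQ[OF LIMSEQ_inverse_real_of_nat r(1)] by (simp add: o_def)
    show "(\<lambda>n. d (Inr (snd (z (r n)))) (Inr l)) \<longlonglongrightarrow> 0"
    proof (rule tendsto_sandwich[OF _ _ tendsto_const])
      show "(\<lambda>n. inverse (real (Suc (r n))) + d (Inr (fst (z (r n)))) (Inr l)) \<longlonglongrightarrow> 0"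
        using tendsto_add[OF 0, of "\<lambda>n. d (Inr (fst (z (r n)))) (Inr l)" 0] A by (auto simp: cv_def)
      have "d (Inr (snd (z (r n)))) (Inr l) \<le> inverse (real (Suc (r n))) + d (Inr (fst (z (r n)))) (Inr l)" for n
        using z(1)[of "r n"] ms.triangle[of "Inr (snd (z (r n)))" "Inr (fst (z (r n)))" "Inr l"]
        by (simp add: ms.commute)
      then show "\<forall>\<^sub>F n in sequentially. d (Inr (snd (z (r n)))) (Inr l) \<le> inverse (real (Suc (r n))) + d (Inr (fst (z (r n)))) (Inr l)"
        by simp
    qed simp
  qed auto
  then have "(\<lambda>n. snd (z (r n))) \<longlonglongrightarrow> l" by (simp add: cv_Inr)
  then have "(\<lambda>n. dist (fst (z (r n))) (snd (z (r n)))) \<longlonglongrightarrow> dist l l" by (intro tendsto_dist r(2))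
  then have "0 \<ge> e" by (intro LIMSEQ_le_const[where X="\<lambda>n. dist (fst (z (r n))) (snd (z (r n)))"])
    (use z(2) in \<open>auto simp: not_less\<close>)
  then show False using assms by simp
qed

text \<open>Leads back from the metric description to the topological one, in which limit points and
  loxodromic elements are defined.\<close>

lemma cv_luc:
  assumes a: "cv (\<lambda>n. Inl (g n)) (Inr a)" and b: "cv (\<lambda>n. Inl (inv (g n))) (Inr b)"
  shows "loc_unif_to_const euclidean g (- {b}) a"
  unfolding loc_unif_to_const_def
proof
  fix z assume "z \<in> - {b}"
  have gG: "g n \<in> \<Gamma>" for n using cv_mem(2)[OF a, of n] by (simp only: X_Inl)
  define r where "r = d (Inr z) (Inr b)"
  have r: "r > 0" unfolding r_def using \<open>z \<in> - {b}\<close> by (subst ms.mdist_pos_eq) auto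
  define W where "W = {w. d (Inr w) (Inr z) < r/2}"
  have "open W" unfolding W_def by (intro open_Collect_less cont_dist continuous_intros) auto
  moreover have "z \<in> W" using r by (simp add: W_def)
  moreover have "\<forall>\<^sub>F n in sequentially. g n ` (W \<inter> - {b}) \<subseteq> U" if U: "open U" "a \<in> U" for U
  proof -
    obtain e1 where e1: "e1 > 0" "ball a e1 \<subseteq> U" using U by (meson openE)
    obtain e where e: "e > 0" "\<forall>x y. d (Inr x) (Inr y) < e \<longrightarrow> dist x y < e1" using D_uniform[OF e1(1)] by auto
    \<comment> \<open>Points of \<open>W\<close> are within \<open>r/2\<close> of \<open>z\<close>,
      and eventually \<open>inv (g n)\<close> is within \<open>r/4\<close> of \<open>b\<close>. This
      leaves a distance above \<open>r/4\<close> between them, more than \<open>e'\<close>.\<close>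
    define e' where "e' = min (e/2) (r/8)"
    have e': "e' > 0" using r e by (auto simp: e'_def)
    obtain F where F: "finite F" "\<forall>g\<in>\<Gamma> - F. \<forall>p\<in>X. d p (Inl (inv g)) > e' \<longrightarrow> d (act g p) (Inl g) < e'"
      using contraction[OF e'] by auto
    have "r/4 > 0" "e/2 > 0" using r e by auto
    from cv_notin[OF a F(1)] cv_D[OF a this(2)] cv_D[OF b this(1)]
    show ?thesis
    proof eventually_elim
      case (elim n)
      show ?case
      proof
        fix y assume "y \<in> g n ` (W \<inter> - {b})"
        then obtain w where w: "w \<in> W" "y = g n w" by auto
        have "d (Inr z) (Inr b) \<le> d (Inr z) (Inr w) + d (Inr w) (Inr b)"
          "d (Inr w) (Inr b) \<le> d (Inr w) (Inl (inv (g n))) + d (Inl (inv (g n))) (Inr b)"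
          using gG by (intro ms.triangle; simp)+
        moreover have "d (Inr z) (Inr w) < r/2" using w by (simp add: W_def ms.commute)
        ultimately have "d (Inr w) (Inl (inv (g n))) > r/4" using elim(3) unfolding r_def by linarith
        then have "d (Inr w) (Inl (inv (g n))) > e'" using r by (simp add: e'_def)
        then have "d (act (g n) (Inr w)) (Inl (g n)) < e'"
          using bspec[OF bspec[OF F(2), of "g n"], of "Inr w"] gG elim by simp
        moreover have "d (Inr y) (Inr a) \<le> d (Inr y) (Inl (g n)) + d (Inl (g n)) (Inr a)"
          using gG by (intro ms.triangle) auto
        ultimately have "d (Inr y) (Inr a) < e" using elim w by (auto simp: e'_def)
        then have "dist y a < e1" using e(2) by blast
        then have "y \<in> ball a e1" by (simp add: dist_commute)
        then show "y \<in> U" using e1(2) by blast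
      qed
    qed
  qed
  ultimately show "\<exists>W. openin euclidean W \<and> z \<in> W \<and>
      (\<forall>U. openin euclidean U \<and> a \<in> U \<longrightarrow> (\<forall>\<^sub>F n in sequentially. g n ` (W \<inter> - {b}) \<subseteq> U))"
    by (intro exI[of _ W]) auto
qed

lemma luc_pt:
  assumes "loc_unif_to_const euclidean f S x" "z \<in> S"
  shows "(\<lambda>n. f n z) \<longlonglongrightarrow> x"
proof (rule topological_tendstoI)
  fix U assume U: "open U" "x \<in> U"
  obtain W where W: "z \<in> W" "\<forall>U. openin euclidean U \<and> x \<in> U \<longrightarrow> (\<forall>\<^sub>F n in sequentially. f n ` (W \<inter> S) \<subseteq> U)"
    using bspec[OF assms(1)[unfolded loc_unif_to_const_def] assms(2)] by auto
  then have "\<forall>\<^sub>F n in sequentially. f n ` (W \<inter> S) \<subseteq> U" using U by simp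
  then show "\<forall>\<^sub>F n in sequentially. f n z \<in> U" by eventually_elim (use W assms in auto)
qed

text \<open>The indices at which a value occurs for the first time form an infinite set on which
  \<open>g\<close> is injective.\<close>

lemma inj_subseq:
  fixes g :: "nat \<Rightarrow> 'a"
  assumes "\<And>h. finite {n. g n = h}"
  shows "\<exists>r. strict_mono (r :: nat \<Rightarrow> nat) \<and> inj (\<lambda>n. g (r n))"
proof -
  define A where "A = {n. \<forall>m<n. g m \<noteq> g n}"
  have inj: "inj_on g A" unfolding A_def by (rule inj_onI) (metis (mono_tags, lifting) linorder_neqE_nat mem_Collect_eq)
  have "range g \<subseteq> g ` A"
  proof clarify
    fix n
    define k where "k = (LEAST k. g k = g n)"
    have "g k = g n" unfolding k_def by (rule LeastI[of _ n]) simp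
    moreover have "k \<in> A" using \<open>g k = g n\<close> by (auto simp: A_def k_def dest: not_less_Least)
    ultimately show "g n \<in> g ` A" by (metis imageI)
  qed
  moreover have "infinite (range g)"
  proof
    assume "finite (range g)"
    moreover have "(UNIV :: nat set) = (\<Union>h\<in>range g. {n. g n = h})" by auto
    ultimately have "finite (UNIV :: nat set)" using assms by (metis finite_UN_I)
    then show False by simp
  qed
  ultimately have A: "infinite A" by (meson finite_imageI finite_subset)
  show ?thesis
  proof (intro exI conjI)
    show "strict_mono (enumerate A)" using A by (rule strict_mono_enumerate)
    show "inj (\<lambda>n. g (enumerate A n))"
      using inj_onD[OF inj] enumerate_in_set[OF A] strict_mono_eq[OF strict_mono_enumerate[OF A]]
      by (intro injI) metis
  qed
qed

lemma three_points: "\<exists>z::'m. z \<noteq> x \<and> z \<noteq> y \<and> z \<in> limit_set \<Gamma>"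
proof -
  obtain A where A: "A \<subseteq> limit_set \<Gamma>" "card A = 3" using nonel by (auto simp: non_elementary_def)
  have "\<not> A \<subseteq> {x, y}"
  proof
    assume "A \<subseteq> {x, y}"
    then have "card A \<le> card {x, y}" by (intro card_mono) auto
    then show False using A(2) card_insert_le_m1[of 2 "{y}" x] by simp
  qed
  then show ?thesis using A by auto
qed

text \<open>The sequence in the definition of a limit point may repeat elements. An element repeated
  infinitely often would be constant off \<open>y\<close>, contrary to injectivity, so an injective
  subsequence exists. Its attracting limit is \<open>x\<close>, as evaluation at a point different
  from \<open>y\<close> and from the new repelling limit shows.\<close>

lemma limit_set_seq:
  assumes "x \<in> limit_set \<Gamma>"
  shows "\<exists>g b. inj (g :: nat \<Rightarrow> _) \<and> (\<forall>n. g n \<in> \<Gamma>) \<and> cv (\<lambda>n. Inl (g n)) (Inr x) \<and> cv (\<lambda>n. Inl (inv (g n))) (Inr b)"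
proof -
  obtain y g where g: "range (g :: nat \<Rightarrow> _) \<subseteq> \<Gamma>" "loc_unif_to_const euclidean g (- {y}) x"
    using assms by (auto simp: limit_set_def)
  have gG: "\<forall>n. g n \<in> \<Gamma>" using g(1) by auto
  have pt: "(\<lambda>n. g n z) \<longlonglongrightarrow> x" if "z \<noteq> y" for z using luc_pt[OF g(2)] that by simp
  have "finite {n. g n = h}" for h
  proof (rule ccontr)
    assume inf: "infinite {n. g n = h}"
    then have "h \<in> \<Gamma>" using gG not_finite_existsD by auto
    have hx: "h z = x" if "z \<noteq> y" for z
    proof -
      let ?r = "enumerate {n. g n = h}"
      have "(\<lambda>n. g (?r n) z) \<longlonglongrightarrow> x"
        using LIMSEQ_subseq_LIMSEQ[OF pt[OF that] strict_mono_enumerate[OF inf]] by (simp add: o_def)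
      moreover have "g (?r n) = h" for n using enumerate_in_set[OF inf, of n] by simp
      ultimately show ?thesis by (simp add: LIMSEQ_const_iff)
    qed
    obtain z1 :: 'm where "z1 \<noteq> y" using three_points by auto
    obtain z2 where "z2 \<noteq> y" "z2 \<noteq> z1" using three_points by auto
    have "h z1 = h z2" using hx[OF \<open>z1 \<noteq> y\<close>] hx[OF \<open>z2 \<noteq> y\<close>] by simp
    then show False using inv_app(1)[OF \<open>h \<in> \<Gamma>\<close>, of z1] inv_app(1)[OF \<open>h \<in> \<Gamma>\<close>, of z2] \<open>z2 \<noteq> z1\<close> by simp
  qed
  then obtain s where s: "strict_mono (s :: nat \<Rightarrow> nat)" "inj (\<lambda>n. g (s n))" using inj_subseq[of g] by auto
  have "\<forall>n. g (s n) \<in> \<Gamma>" using gG by simp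
  from conv_subseq[OF s(2) this] obtain r a b where r: "strict_mono (r :: nat \<Rightarrow> nat)"
    and A: "cv (\<lambda>n. Inl (g (s (r n)))) (Inr a)" and B: "cv (\<lambda>n. Inl (inv (g (s (r n))))) (Inr b)" by auto
  obtain z where z: "z \<noteq> y" "z \<noteq> b" using three_points by auto
  have "cv (\<lambda>n. act (g (s (r n))) (Inr z)) (Inr a)" using z by (intro cv_contract[OF A B, of _ "Inr z"]) auto
  then have "(\<lambda>n. g (s (r n)) z) \<longlonglongrightarrow> a" by (simp add: cv_Inr)
  moreover have "strict_mono (\<lambda>n. s (r n))" using s(1) r by (auto simp: strict_mono_def)
  then have "(\<lambda>n. g (s (r n)) z) \<longlonglongrightarrow> x" using LIMSEQ_subseq_LIMSEQ[OF pt[OF z(1)], of "\<lambda>n. s (r n)"] by (simp add: o_def)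
  ultimately have "a = x" by (rule LIMSEQ_unique)
  moreover have "inj (\<lambda>n. g (s (r n)))" 
  proof (rule injI)
    fix x y assume "g (s (r x)) = g (s (r y))"
    then have "r x = r y" by (rule injD[OF s(2)])
    then show "x = y" using r by (simp add: strict_mono_eq)
  qed
  ultimately show ?thesis using A B gG by (intro exI[of _ "\<lambda>n. g (s (r n))"] exI[of _ b]) simp
qed

lemma limit_setI:
  assumes "cv (\<lambda>n. Inl (g n)) (Inr x)"
  shows "x \<in> limit_set \<Gamma>"
proof -
  have gG: "\<forall>n. g n \<in> \<Gamma>" using cv_mem(2)[OF assms] by (simp only: X_Inl simp_thms)
  have "finite {n. g n = h}" for h
    using cv_notin[OF assms, of "{h}"] by (auto simp: eventually_sequentially intro: finite_subset[of _ "{..<_}"])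
      (meson finite_nat_set_iff_bounded mem_Collect_eq not_le)
  then obtain s where s: "strict_mono (s :: nat \<Rightarrow> nat)" "inj (\<lambda>n. g (s n))" using inj_subseq[of g] by auto
  have "\<forall>n. g (s n) \<in> \<Gamma>" using gG by simp
  from conv_subseq[OF s(2) this] obtain r a b where r: "strict_mono (r :: nat \<Rightarrow> nat)"
    and A: "cv (\<lambda>n. Inl (g (s (r n)))) (Inr a)" and B: "cv (\<lambda>n. Inl (inv (g (s (r n))))) (Inr b)" by auto
  have "cv (\<lambda>n. Inl (g (s (r n)))) (Inr x)" using cv_subseq[OF cv_subseq[OF assms s(1)] r] .
  then have ax: "a = x" using cv_unique[OF A] by blast
  have "range (\<lambda>n. g (s (r n))) \<subseteq> \<Gamma>" using gG by auto
  then show ?thesis using cv_luc[OF A B] unfolding ax limit_set_def by blast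
qed

text \<open>Limit points are the points of \<open>M\<close> in the closure of \<Gamma>; in this form
  closedness is immediate, and conical points are easily seen to be limit points.\<close>

lemma limit_set_iff: "x \<in> limit_set \<Gamma> \<longleftrightarrow> (\<forall>e>0. \<exists>g\<in>\<Gamma>. d (Inr x) (Inl g) < e)"
proof
  assume "x \<in> limit_set \<Gamma>"
  then obtain g where g: "\<forall>n. g n \<in> \<Gamma>" "cv (\<lambda>n. Inl (g n)) (Inr x)" using limit_set_seq by blast
  show "\<forall>e>0. \<exists>g\<in>\<Gamma>. d (Inr x) (Inl g) < e"
  proof (intro allI impI)
    fix e :: real assume "e > 0"
    from cv_D[OF g(2) this] obtain n where "d (Inl (g n)) (Inr x) < e" by (auto simp: eventually_sequentially)
    then show "\<exists>g\<in>\<Gamma>. d (Inr x) (Inl g) < e" using g(1) by (intro bexI[of _ "g n"]) (auto simp: ms.commute)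
  qed
next
  assume *: "\<forall>e>0. \<exists>g\<in>\<Gamma>. d (Inr x) (Inl g) < e"
  have "\<forall>n::nat. \<exists>g. g \<in> \<Gamma> \<and> d (Inr x) (Inl g) < inverse (Suc n)" 
  proof
    fix n :: nat
    have "(0::real) < inverse (Suc n)" by simp
    from *[rule_format, OF this] show "\<exists>g. g \<in> \<Gamma> \<and> d (Inr x) (Inl g) < inverse (Suc n)" by auto
  qed
  from choice[OF this] obtain g where g: "\<And>n. g n \<in> \<Gamma>" "\<And>n::nat. d (Inr x) (Inl (g n)) < inverse (Suc n)" by auto
  have "cv (\<lambda>n. Inl (g n)) (Inr x)"
    unfolding cv_def
  proof (intro conjI allI)
    show "(\<lambda>n. d (Inl (g n)) (Inr x)) \<longlonglongrightarrow> 0"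
      using g(2) by (intro tendsto_sandwich[OF _ _ tendsto_const LIMSEQ_inverse_real_of_nat])
        (auto simp: ms.commute intro!: always_eventually less_imp_le simp del: of_nat_Suc)
  qed (use g in auto)
  then show "x \<in> limit_set \<Gamma>" by (rule limit_setI)
qed

lemma closed_limit_set: "closed (limit_set \<Gamma>)"
  unfolding closed_sequential_limits
proof (intro allI impI)
  fix x l assume a: "(\<forall>n. x n \<in> limit_set \<Gamma>) \<and> x \<longlonglongrightarrow> l"
  then have c: "cv (\<lambda>n. Inr (x n)) (Inr l)" by (simp add: cv_Inr)
  show "l \<in> limit_set \<Gamma>" unfolding limit_set_iff
  proof (intro allI impI)
    fix e :: real assume "e > 0"
    then have e: "e/2 > 0" by simp
    from cv_D[OF c e] obtain n where n: "d (Inr (x n)) (Inr l) < e/2" by (auto simp: eventually_sequentially)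
    obtain g where g: "g \<in> \<Gamma>" "d (Inr (x n)) (Inl g) < e/2" using a limit_set_iff e by blast
    have "d (Inr l) (Inl g) \<le> d (Inr l) (Inr (x n)) + d (Inr (x n)) (Inl g)" using g by (intro ms.triangle) auto
    then show "\<exists>g\<in>\<Gamma>. d (Inr l) (Inl g) < e" using n g by (intro bexI[of _ g]) (auto simp: ms.commute)
  qed
qed

lemma limit_set_act: "g \<in> \<Gamma> \<Longrightarrow> x \<in> limit_set \<Gamma> \<Longrightarrow> g x \<in> limit_set \<Gamma>"
proof -
  assume g: "g \<in> \<Gamma>" and "x \<in> limit_set \<Gamma>"
  then obtain h where "cv (\<lambda>n. Inl (h n)) (Inr x)" using limit_set_seq by blast
  from cv_act[OF g this] show ?thesis by (auto intro: limit_setI)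
qed

lemma power_in: "g \<in> \<Gamma> \<Longrightarrow> g ^^ n \<in> \<Gamma>"
  by (induction n) (auto simp: id_def[symmetric])

text \<open>An element whose attracting and repelling regions are disjoint plays ping-pong with itself:
  its powers stay in the attracting region, and the limits of subsequences are fixed points.\<close>

lemma lox_uniform:
  "\<exists>e0>0. \<forall>e. 0 < e \<and> e < e0 \<longrightarrow> (\<exists>F. finite F \<and> (\<forall>g\<in>\<Gamma> - F. d (Inl g) (Inl (inv g)) > 4 * e \<longrightarrow>
     (\<exists>p q. loxodromic_with \<Gamma> g p q \<and> d (Inr p) (Inl g) \<le> e \<and> d (Inr q) (Inl (inv g)) \<le> e)))"
proof -
  \<comment> \<open>\<open>e0\<close> isolates the identity. The powers of \<open>g\<close> stay
    within \<open>e < e0\<close> of \<open>g\<close>, so a power equal to the identity would force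
    \<open>g = id\<close>; hence the powers are distinct.\<close>
  obtain e0 where e0: "e0 > 0" "\<forall>p\<in>X. d p (Inl id) < e0 \<longrightarrow> p = Inl id" using isolated[OF id_in] by auto
  show ?thesis
  proof (intro exI[of _ e0] conjI allI impI)
    fix e assume "0 < e \<and> e < e0"
    then have e: "0 < e" "e < e0" by auto
    obtain F where F: "finite F" "\<forall>g\<in>\<Gamma> - F. \<forall>p\<in>X. d p (Inl (inv g)) > e \<longrightarrow> d (act g p) (Inl g) < e"
      using contraction[OF e(1)] by auto
    have pw: "d (Inl (g ^^ Suc k)) (Inl g) \<le> e" if g: "g \<in> \<Gamma> - F" "d (Inl g) (Inl (inv g)) > 4 * e" for g k
    proof (induction k)
      case (Suc k)
      have "d (Inl g) (Inl (inv g)) \<le> d (Inl g) (Inl (g ^^ Suc k)) + d (Inl (g ^^ Suc k)) (Inl (inv g))"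
        using g power_in[of g "Suc k"] by (intro ms.triangle) auto
      then have "d (Inl (g ^^ Suc k)) (Inl (inv g)) > e" using Suc g(2) e by (simp add: ms.commute del: funpow.simps)
      then have "d (act g (Inl (g ^^ Suc k))) (Inl g) < e"
        using bspec[OF bspec[OF F(2) g(1)], of "Inl (g ^^ Suc k)"] power_in[of g "Suc k"] g by simp
      then show ?case by (simp only: map_sum.simps funpow.simps(2) less_imp_le)
    qed (use g e in auto)
    show "\<exists>F. finite F \<and> (\<forall>g\<in>\<Gamma> - F. d (Inl g) (Inl (inv g)) > 4 * e \<longrightarrow>
       (\<exists>p q. loxodromic_with \<Gamma> g p q \<and> d (Inr p) (Inl g) \<le> e \<and> d (Inr q) (Inl (inv g)) \<le> e))"
    proof (intro exI[of _ "F \<union> inv ` F \<union> {id}"] conjI ballI impI)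
      fix g assume g: "g \<in> \<Gamma> - (F \<union> inv ` F \<union> {id})" and sep: "d (Inl g) (Inl (inv g)) > 4 * e"
      then have gG: "g \<in> \<Gamma>" by auto
      have gi: "inv g \<in> \<Gamma> - F"
      proof -
        have "inv g \<notin> F" using g gG by (metis DiffE UnCI image_eqI inv_inv)
        then show ?thesis using gG by simp
      qed
      have p1: "d (Inl (g ^^ Suc k)) (Inl g) \<le> e" for k using pw[of g k] g sep by auto
      have iv: "inv (g ^^ k) = inv g ^^ k" for k using bij[OF gG] by (rule inv_fn)
      have p2: "d (Inl (inv (g ^^ Suc k))) (Inl (inv g)) \<le> e" for k
        unfolding iv using pw[of "inv g" k] gi sep gG by (simp add: ms.commute del: funpow.simps)
      have nid: "g ^^ Suc k \<noteq> id" for k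
      proof
        assume "g ^^ Suc k = id"
        then have "d (Inl g) (Inl id) < e0" using p1[of k] e by (simp add: ms.commute)
        then have "Inl g = (Inl id :: ('m \<Rightarrow> 'm) + 'm)" using bspec[OF e0(2), of "Inl g"] gG by simp
        then show False using g by simp
      qed
      have inj: "inj (\<lambda>k. g ^^ Suc k)"
      proof (rule linorder_injI)
        fix i j :: nat assume "i < j"
        then obtain k where k: "j = i + Suc k" using less_imp_Suc_add by auto
        show "g ^^ Suc i \<noteq> g ^^ Suc j"
        proof
          assume *: "g ^^ Suc i = g ^^ Suc j"
          have "Suc j = Suc i + Suc k" using k by simp
          then have "g ^^ Suc j = g ^^ Suc i \<circ> g ^^ Suc k" by (simp only: funpow_add)
          then have "inv (g ^^ Suc i) \<circ> g ^^ Suc i = inv (g ^^ Suc i) \<circ> (g ^^ Suc i \<circ> g ^^ Suc k)" using * by simp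
          then have "id = g ^^ Suc k" using power_in[OF gG, of "Suc i"] by (simp add: o_assoc del: funpow.simps)
          then show False using nid by metis
        qed
      qed
      have pG: "g ^^ n \<in> \<Gamma>" for n using power_in[OF gG] .
      have sub: "\<exists>r a b. strict_mono (r :: nat \<Rightarrow> nat) \<and> cv (\<lambda>n. Inl (g ^^ Suc (s (r n)))) (Inr a) \<and>
          cv (\<lambda>n. Inl (inv (g ^^ Suc (s (r n))))) (Inr b) \<and> d (Inr a) (Inl g) \<le> e \<and> d (Inr b) (Inl (inv g)) \<le> e"
        if "strict_mono s" for s
      proof -
        have "inj (\<lambda>n. g ^^ Suc (s n))"
          using injD[OF inj] strict_mono_eq[OF that] by (intro injI) blast
        from conv_subseq[OF this] pG obtain r a b where r: "strict_mono (r :: nat \<Rightarrow> nat)"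
          "cv (\<lambda>n. Inl (g ^^ Suc (s (r n)))) (Inr a)" "cv (\<lambda>n. Inl (inv (g ^^ Suc (s (r n))))) (Inr b)" by blast
        show ?thesis
          using r cv_ball[OF r(2) _ p1] cv_ball[OF r(3) _ p2] gG by (intro exI[of _ r] exI[of _ a] exI[of _ b]) auto
      qed
      have ne: "a \<noteq> b" if "d (Inr a) (Inl g) \<le> e" "d (Inr b) (Inl (inv g)) \<le> e" for a b
      proof
        assume "a = b"
        then have "d (Inl g) (Inl (inv g)) \<le> d (Inl g) (Inr a) + d (Inr b) (Inl (inv g))"
          using ms.triangle[of "Inl g" "Inr a" "Inl (inv g)"] gG by simp
        then show False using that sep e by (simp add: ms.commute)
      qed
      have "strict_mono (\<lambda>n::nat. n)" by (simp add: strict_mono_def)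
      from sub[OF this] obtain r a b where r: "strict_mono (r :: nat \<Rightarrow> nat)" and A: "cv (\<lambda>n. Inl (g ^^ Suc (r n))) (Inr a)"
        and B: "cv (\<lambda>n. Inl (inv (g ^^ Suc (r n)))) (Inr b)" and ae: "d (Inr a) (Inl g) \<le> e" and be: "d (Inr b) (Inl (inv g)) \<le> e"
        by auto
      have B': "cv (\<lambda>n. Inl (inv (inv (g ^^ Suc (r n))))) (Inr a)" using A pG by (simp del: funpow.simps)
      have comm: "g \<circ> g ^^ k = g ^^ k \<circ> g" for k by (simp add: funpow_Suc_right[symmetric])
      have ga: "g a = a"
      proof -
        have "cv (\<lambda>n. act (g ^^ Suc (r n)) (Inl g)) (Inr a)" using gG by (intro cv_contract[OF A B, of _ "Inl g"]) auto
        moreover have "cv (\<lambda>n. act g (Inl (g ^^ Suc (r n)))) (act g (Inr a))" by (rule cv_act[OF gG A])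
        ultimately show ?thesis using cv_unique by (fastforce simp: comm simp del: funpow.simps)
      qed
      have gb: "g b = b"
      proof -
        have "cv (\<lambda>n. act (inv (g ^^ Suc (r n))) (Inl (inv g))) (Inr b)" using gG by (intro cv_contract[OF B B', of _ "Inl (inv g)"]) auto
        moreover have "cv (\<lambda>n. act (inv g) (Inl (inv (g ^^ Suc (r n))))) (act (inv g) (Inr b))" by (rule cv_act[OF _ B]) (use gG in simp)
        moreover have "inv g \<circ> inv (g ^^ k) = inv (g ^^ k) \<circ> inv g" for k
          using inv_o[OF pG gG, of k] inv_o[OF gG pG, of k] comm[of k] by simp
        ultimately have "inv g b = b" using cv_unique by (fastforce simp del: funpow.simps)
        then show ?thesis using inv_app(2)[OF gG, of b] by simp
      qed
      have fa: "(g ^^ k) a = a" for k by (induction k) (auto simp: ga)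
      have fb: "inv (g ^^ k) b = b" for k
      proof -
        have "(g ^^ k) b = b" by (induction k) (auto simp: gb)
        then show ?thesis using inv_app(1)[OF pG, of k b] by simp
      qed
      \<comment> \<open>A subsequence has limits \<open>a'\<close> and \<open>b'\<close> of its own,
        but \<open>a\<close> is fixed by all powers and differs from \<open>b'\<close>, so it is
        attracted to \<open>a'\<close> and equals it; likewise \<open>b' = b\<close>. Hence the full
        sequences of powers converge.\<close>
      have both: "\<exists>r. strict_mono (r :: nat \<Rightarrow> nat) \<and> cv (\<lambda>n. Inl (g ^^ Suc (s (r n)))) (Inr a) \<and>
          cv (\<lambda>n. Inl (inv (g ^^ Suc (s (r n))))) (Inr b)" if "strict_mono s" for s
      proof -
        from sub[OF that] obtain r a' b' where r: "strict_mono (r :: nat \<Rightarrow> nat)" and A': "cv (\<lambda>n. Inl (g ^^ Suc (s (r n)))) (Inr a')"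
          and B': "cv (\<lambda>n. Inl (inv (g ^^ Suc (s (r n))))) (Inr b')" and ae': "d (Inr a') (Inl g) \<le> e" and be': "d (Inr b') (Inl (inv g)) \<le> e"
          by auto
        have A'': "cv (\<lambda>n. Inl (inv (inv (g ^^ Suc (s (r n)))))) (Inr a')" using A' pG by (simp del: funpow.simps)
        have "cv (\<lambda>n. act (g ^^ Suc (s (r n))) (Inr a)) (Inr a')"
          using ne[OF ae be'] by (intro cv_contract[OF A' B', of _ "Inr a"]) auto
        then have "cv (\<lambda>n. Inr a) (Inr a')" by (simp add: fa del: funpow.simps)
        then have aa: "a' = a" using cv_unique[OF _ cv_const[OF X_Inr[of a]]] by blast
        have "cv (\<lambda>n. act (inv (g ^^ Suc (s (r n)))) (Inr b)) (Inr b')"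
          using ne[OF ae' be] by (intro cv_contract[OF B' A'', of _ "Inr b"]) auto
        then have "cv (\<lambda>n. Inr b) (Inr b')" by (simp add: fb del: funpow.simps)
        then have bb: "b' = b" using cv_unique[OF _ cv_const[OF X_Inr[of b]]] by blast
        show ?thesis using r A' B' unfolding aa bb by blast
      qed
      have "cv (\<lambda>n. Inl (g ^^ Suc n)) (Inr a)"
      proof (rule cv_subsub)
        fix s :: "nat \<Rightarrow> nat" assume "strict_mono s"
        from both[OF this] show "\<exists>r. strict_mono (r :: nat \<Rightarrow> nat) \<and> cv (\<lambda>n. Inl (g ^^ Suc (s (r n)))) (Inr a)" by blast
      qed (use pG in \<open>auto simp del: funpow.simps\<close>)
      then have C1: "cv (\<lambda>n. Inl (g ^^ n)) (Inr a)"
        using pG filterlim_sequentially_Suc[of "\<lambda>n. d (Inl (g ^^ n)) (Inr a)"] unfolding cv_def by (simp del: funpow.simps)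
      have "cv (\<lambda>n. Inl (inv (g ^^ Suc n))) (Inr b)"
      proof (rule cv_subsub)
        fix s :: "nat \<Rightarrow> nat" assume "strict_mono s"
        from both[OF this] show "\<exists>r. strict_mono (r :: nat \<Rightarrow> nat) \<and> cv (\<lambda>n. Inl (inv (g ^^ Suc (s (r n))))) (Inr b)" by blast
      qed (use pG in \<open>auto simp del: funpow.simps\<close>)
      then have C2: "cv (\<lambda>n. Inl (inv (g ^^ n))) (Inr b)"
        using pG filterlim_sequentially_Suc[of "\<lambda>n. d (Inl (inv (g ^^ n))) (Inr b)"] unfolding cv_def by (simp del: funpow.simps)
      have C1': "cv (\<lambda>n. Inl (inv (inv (g ^^ n)))) (Inr a)" using C1 pG by simp
      have "loxodromic_with \<Gamma> g a b"
        unfolding loxodromic_with_def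
        using gG ne[OF ae be] ga gb limit_setI[OF C1] limit_setI[OF C2] cv_luc[OF C1 C2] cv_luc[OF C2 C1']
        by (simp add: iv)
      then show "\<exists>p q. loxodromic_with \<Gamma> g p q \<and> d (Inr p) (Inl g) \<le> e \<and> d (Inr q) (Inl (inv g)) \<le> e"
        using ae be by blast
    qed (use F in auto)
  qed (rule e0)
qed

lemma cv_lox:
  assumes a: "cv (\<lambda>n. Inl (g n)) (Inr a)" and b: "cv (\<lambda>n. Inl (inv (g n))) (Inr b)" and ab: "a \<noteq> b"
    and e: "e > 0"
  shows "\<forall>\<^sub>F n in sequentially. \<exists>p q. loxodromic_with \<Gamma> (g n) p q \<and> d (Inr p) (Inr a) < e \<and> d (Inr q) (Inr b) < e"
proof -
  have gG: "g n \<in> \<Gamma>" for n using cv_mem(2)[OF a, of n] by (simp only: X_Inl)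
  obtain e0 where e0: "e0 > 0" "\<forall>e. 0 < e \<and> e < e0 \<longrightarrow> (\<exists>F. finite F \<and> (\<forall>g\<in>\<Gamma> - F. d (Inl g) (Inl (inv g)) > 4 * e \<longrightarrow>
     (\<exists>p q. loxodromic_with \<Gamma> g p q \<and> d (Inr p) (Inl g) \<le> e \<and> d (Inr q) (Inl (inv g)) \<le> e)))"
    using lox_uniform by auto
  define r where "r = d (Inr a) (Inr b)"
  have r: "r > 0" unfolding r_def using ab by (subst ms.mdist_pos_eq) auto
  \<comment> \<open>The distance of \<open>g n\<close> and \<open>inv (g n)\<close> tends to
    \<open>r\<close>, so \<open>r/8\<close> makes it exceed \<open>4 * e'\<close> eventually;
    \<open>e/2\<close> is half of the final triangle inequality.\<close>
  define e' where "e' = min (e0/2) (min (e/2) (r/8))"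
  have e': "0 < e'" "e' < e0" "e' \<le> e/2" "4 * e' < r" using e0 e r by (auto simp: e'_def)
  obtain F where F: "finite F" "\<forall>g\<in>\<Gamma> - F. d (Inl g) (Inl (inv g)) > 4 * e' \<longrightarrow>
     (\<exists>p q. loxodromic_with \<Gamma> g p q \<and> d (Inr p) (Inl g) \<le> e' \<and> d (Inr q) (Inl (inv g)) \<le> e')"
    using e0(2) e' by blast
  have e2: "e/2 > 0" using e by simp
  have "\<forall>\<^sub>F n in sequentially. d (Inl (g n)) (Inl (inv (g n))) > 4 * e'"
    using cv_dist[OF a b] e'(4) by (auto simp: r_def[symmetric] intro!: order_tendstoD(1))
  from this cv_D[OF a e2] cv_D[OF b e2] cv_notin[OF a F(1)] show ?thesis
  proof eventually_elim
    case (elim n)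
    then obtain p q where pq: "loxodromic_with \<Gamma> (g n) p q" "d (Inr p) (Inl (g n)) \<le> e'" "d (Inr q) (Inl (inv (g n))) \<le> e'"
      using F(2) gG by blast
    have "d (Inr p) (Inr a) \<le> d (Inr p) (Inl (g n)) + d (Inl (g n)) (Inr a)"
      "d (Inr q) (Inr b) \<le> d (Inr q) (Inl (inv (g n))) + d (Inl (inv (g n))) (Inr b)"
      using gG by (intro ms.triangle; simp)+
    then show ?case using pq elim e' by (intro exI[of _ p] exI[of _ q]) auto
  qed
qed

lemma lox_fixed: "loxodromic_with \<Gamma> g p q \<Longrightarrow> g z = z \<Longrightarrow> z \<noteq> q \<Longrightarrow> z = p"
proof -
  assume l: "loxodromic_with \<Gamma> g p q" and z: "g z = z" "z \<noteq> q"
  have "(g ^^ n) z = z" for n by (induction n) (auto simp: z)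
  moreover have "(\<lambda>n. (g ^^ n) z) \<longlonglongrightarrow> p" using l z by (intro luc_pt[of _ "- {q}"]) (auto simp: loxodromic_with_def)
  ultimately show ?thesis by (simp add: LIMSEQ_const_iff)
qed

end

context conv_group
begin

lemma contraction2:
  assumes "e > 0"
  shows "\<exists>F. finite F \<and> (\<forall>g\<in>\<Gamma> - F.
    (\<forall>p\<in>X. d p (Inl (inv g)) > e \<longrightarrow> d (act g p) (Inl g) < e) \<and>
    (\<forall>p\<in>X. d p (Inl g) > e \<longrightarrow> d (act (inv g) p) (Inl (inv g)) < e))"
proof -
  obtain F where F: "finite F" "\<forall>g\<in>\<Gamma> - F. \<forall>p\<in>X. d p (Inl (inv g)) > e \<longrightarrow> d (act g p) (Inl g) < e"
    using contraction[OF assms] by auto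
  have "(\<forall>p\<in>X. d p (Inl (inv g)) > e \<longrightarrow> d (act g p) (Inl g) < e) \<and>
    (\<forall>p\<in>X. d p (Inl g) > e \<longrightarrow> d (act (inv g) p) (Inl (inv g)) < e)" if g: "g \<in> \<Gamma> - (F \<union> inv ` F)" for g
  proof -
    have "inv g \<notin> F" using g by (metis DiffE UnCI image_eqI inv_inv)
    then have "inv g \<in> \<Gamma> - F" "g \<in> \<Gamma> - F" using g by auto
    from bspec[OF F(2) this(1)] bspec[OF F(2) this(2)] show ?thesis using g by simp
  qed
  then show ?thesis using F(1) by (intro exI[of _ "F \<union> inv ` F"]) blast
qed

text \<open>No point can be close to both of two distinct limit points. So for each group element
  one of the two serves as a test point at which \<sigma> is comparable to the magnitude, with a
  constant independent of the element.\<close>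

lemma separated_point:
  "\<exists>z1 z2 c. z1 \<in> limit_set \<Gamma> \<and> z2 \<in> limit_set \<Gamma> \<and> c > 0 \<and> (\<forall>p\<in>X. d (Inr z1) p > c \<or> d (Inr z2) p > c)"
proof -
  obtain z1 where z1: "z1 \<in> limit_set \<Gamma>" using three_points by auto
  obtain z2 where z2: "z2 \<in> limit_set \<Gamma>" "z2 \<noteq> z1" using three_points by blast
  define c where "c = d (Inr z1) (Inr z2) / 3"
  have c: "c > 0" unfolding c_def using z2 by (simp add: ms.mdist_pos_eq)
  have "d (Inr z1) p > c \<or> d (Inr z2) p > c" if "p \<in> X" for p
  proof -
    have "d (Inr z1) (Inr z2) \<le> d (Inr z1) p + d p (Inr z2)" using that by (intro ms.triangle) auto
    then show ?thesis using c ms.commute[of p "Inr z2"] unfolding c_def by linarith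
  qed
  then show ?thesis using z1 z2 c by blast
qed

end

text \<open>Absorbs the finitely many elements that \<open>contraction\<close> sets aside. Where the
  bound concerns \<open>g\<close> alone, \<open>x\<close> ranges over \<open>unit\<close>.\<close>

lemma finite_uniform_bound:
  fixes f :: "'a \<Rightarrow> 'b \<Rightarrow> real"
  assumes "finite F" "\<And>g. g \<in> F \<Longrightarrow> \<exists>B. \<forall>x. f g x \<le> B"
  shows "\<exists>B. \<forall>g\<in>F. \<forall>x. f g x \<le> B"
  using assms
proof (induction F)
  case (insert g F)
  then obtain B B' where "\<forall>g\<in>F. \<forall>x. f g x \<le> B" "\<forall>x. f g x \<le> B'" by blast
  then show ?case by (intro exI[of _ "max B B'"]) (auto simp: le_max_iff_disj)
qed auto

section \<open>Cocycles, magnitudes and properness\<close>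

locale GPS = conv_group \<Gamma> d
  for \<Gamma> :: "('m::{metric_space, second_countable_topology} \<Rightarrow> 'm) set" and d +
  fixes \<sigma> \<sigma>' :: "('m \<Rightarrow> 'm) \<Rightarrow> 'm \<Rightarrow> real" and G :: "'m \<times> 'm \<Rightarrow> real" and N :: "('m \<Rightarrow> 'm) \<Rightarrow> real"
  assumes gps: "continuous_GPS_system \<Gamma> d \<sigma> \<sigma>' G"
    and magnitude: "is_magnitude \<Gamma> d \<sigma> N"
begin

lemma cocycle: "g \<in> \<Gamma> \<Longrightarrow> h \<in> \<Gamma> \<Longrightarrow> \<sigma> (g \<circ> h) x = \<sigma> g (h x) + \<sigma> h x"
  using gps by (auto simp: continuous_GPS_system_def continuous_cocycle_def)

lemma cont_\<sigma>: "g \<in> \<Gamma> \<Longrightarrow> continuous_on UNIV (\<sigma> g)"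
  and cont_\<sigma>': "g \<in> \<Gamma> \<Longrightarrow> continuous_on UNIV (\<sigma>' g)"
  using gps by (auto simp: continuous_GPS_system_def continuous_cocycle_def)

lemma G_eq: "g \<in> \<Gamma> \<Longrightarrow> x \<noteq> y \<Longrightarrow> \<sigma>' g x + \<sigma> g y = G (g x, g y) - G (x, y)"
  using gps by (auto simp: continuous_GPS_system_def)

lemma cocycle_id [simp]: "\<sigma> id x = 0"
  using cocycle[OF id_in id_in, of x] by simp

lemma cocycle_inv: "g \<in> \<Gamma> \<Longrightarrow> \<sigma> (inv g) (g x) = - \<sigma> g x"
  using cocycle[of "inv g" g x] by simp

lemma cont_bounded:
  assumes "continuous_on UNIV (f :: 'm \<Rightarrow> real)"
  shows "\<exists>B. \<forall>x. \<bar>f x\<bar> \<le> B"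
proof -
  have "bounded (range f)" using compact_continuous_image[OF assms compact_M] by (rule compact_imp_bounded)
  then show ?thesis by (auto simp: bounded_iff)
qed

lemma \<sigma>_bounded: "g \<in> \<Gamma> \<Longrightarrow> \<exists>B. \<forall>x. \<bar>\<sigma> g x\<bar> \<le> B"
  using cont_bounded cont_\<sigma> by blast

lemma G_bounded:
  assumes "c > 0"
  shows "\<exists>B. \<forall>x y. d (Inr x) (Inr y) \<ge> c \<longrightarrow> \<bar>G (x, y)\<bar> \<le> B"
proof -
  let ?S = "{z :: 'm \<times> 'm. d (Inr (fst z)) (Inr (snd z)) \<ge> c}"
  have "closed ?S" by (intro closed_Collect_le continuous_intros cont_D)
  moreover have "compact (UNIV :: ('m \<times> 'm) set)" using compact_Times[OF compact_M compact_M] by simp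
  ultimately have "compact ?S" using compact_Int_closed by fastforce
  moreover have "?S \<subseteq> {(x, y). x \<noteq> y}" using assms by auto
  then have "continuous_on ?S G" using gps continuous_on_subset by (auto simp: continuous_GPS_system_def)
  ultimately have "bounded (G ` ?S)" by (intro compact_imp_bounded compact_continuous_image)
  then obtain B where "\<forall>z\<in>?S. norm (G z) \<le> B" by (auto simp: bounded_iff)
  then show ?thesis by (intro exI[of _ B]) auto
qed

lemma mag:
  assumes "e > 0"
  shows "\<exists>C>0. \<forall>g\<in>\<Gamma>. \<forall>x. d (Inr x) (Inl (inv g)) > e \<longrightarrow> \<bar>\<sigma> g x - N g\<bar> \<le> C"
proof -
  obtain C where C: "C > 0" "\<forall>\<gamma>\<in>\<Gamma>. \<forall>x. d (Inr x) (Inl (inv \<gamma>)) > e \<longrightarrow> N \<gamma> - C \<le> \<sigma> \<gamma> x \<and> \<sigma> \<gamma> x \<le> N \<gamma> + C"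
    using magnitude assms unfolding is_magnitude_def by meson
  show ?thesis
  proof (intro exI conjI ballI allI impI)
    fix g x assume "g \<in> \<Gamma>" "d (Inr x) (Inl (inv g)) > e"
    then have "N g - C \<le> \<sigma> g x \<and> \<sigma> g x \<le> N g + C" using C(2) by blast
    then show "\<bar>\<sigma> g x - N g\<bar> \<le> C" by linarith
  qed (rule C(1))
qed

text \<open>Makes properness applicable to a sequence given by its limits. By \<open>cv_lox\<close>
  the elements are eventually loxodromic, and the radius \<open>r/4\<close> keeps their fixed points
  at least \<open>r/2\<close> apart, which gives the liminf condition.\<close>

lemma proper_lox:
  assumes inj: "inj g" and a: "cv (\<lambda>n. Inl (g n)) (Inr a)" and b: "cv (\<lambda>n. Inl (inv (g n))) (Inr b)"
    and ab: "a \<noteq> b" and e: "e > 0"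
  shows "\<exists>n0 p q. (\<forall>n. loxodromic_with \<Gamma> (g (n + n0)) (p n) (q n) \<and> d (Inr (p n)) (Inr a) < e \<and> d (Inr (q n)) (Inr b) < e)
     \<and> filterlim (\<lambda>n. \<sigma> (g (n + n0)) (p n)) at_top sequentially"
proof -
  define r where "r = d (Inr a) (Inr b)"
  have r: "r > 0" unfolding r_def using ab by (subst ms.mdist_pos_eq) auto
  have "min e (r/4) > 0" using r e by auto
  from cv_lox[OF a b ab this] obtain n0 where n0: "\<forall>n\<ge>n0. \<exists>p q. loxodromic_with \<Gamma> (g n) p q \<and> d (Inr p) (Inr a) < min e (r/4) \<and> d (Inr q) (Inr b) < min e (r/4)"
    unfolding eventually_sequentially by auto
  have "\<forall>n. \<exists>z. loxodromic_with \<Gamma> (g (n + n0)) (fst z) (snd z) \<and> d (Inr (fst z)) (Inr a) < min e (r/4) \<and> d (Inr (snd z)) (Inr b) < min e (r/4)"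
    using n0 by simp
  from choice[OF this] obtain z where z: "\<And>n. loxodromic_with \<Gamma> (g (n + n0)) (fst (z n)) (snd (z n))"
    "\<And>n. d (Inr (fst (z n))) (Inr a) < min e (r/4)" "\<And>n. d (Inr (snd (z n))) (Inr b) < min e (r/4)" by auto
  have "r/2 \<le> d (Inr (snd (z n))) (Inr (fst (z n)))" for n
  proof -
    have "r \<le> d (Inr a) (Inr (fst (z n))) + d (Inr (fst (z n))) (Inr b)" unfolding r_def by (intro ms.triangle) auto
    moreover have "d (Inr (fst (z n))) (Inr b) \<le> d (Inr (fst (z n))) (Inr (snd (z n))) + d (Inr (snd (z n))) (Inr b)" by (intro ms.triangle) auto
    ultimately show ?thesis using z(2)[of n] z(3)[of n] by (simp add: ms.commute)
  qed
  then have li: "ereal (r/2) \<le> liminf (\<lambda>n. ereal (d (Inr (snd (z n))) (Inr (fst (z n)))))"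
    by (intro Liminf_bounded) auto
  have "(0::ereal) < ereal (r/2)" using r by simp
  from less_le_trans[OF this li] have "liminf (\<lambda>n. ereal (d (Inr (snd (z n))) (Inr (fst (z n))))) > 0" .
  moreover have "inj (\<lambda>n. g (n + n0))" using inj_compose[OF inj, of "\<lambda>n. n + n0"] by (simp add: o_def inj_def)
  ultimately have hyp: "inj (\<lambda>n. g (n + n0)) \<and> (\<forall>n. loxodromic_with \<Gamma> (g (n + n0)) (fst (z n)) (snd (z n))) \<and>
      liminf (\<lambda>n. ereal (d (Inr (snd (z n))) (Inr (fst (z n))))) > 0"
    by (intro conjI allI z(1))
  have "proper_cocycle \<Gamma> d \<sigma>" using gps by (simp add: continuous_GPS_system_def)
  from this[unfolded proper_cocycle_def, THEN spec, THEN spec, THEN spec, THEN mp, OF hyp]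
  have "filterlim (\<lambda>n. \<sigma> (g (n + n0)) (fst (z n))) at_top sequentially" .
  then show ?thesis using z by (intro exI[of _ n0] exI[of _ "\<lambda>n. fst (z n)"] exI[of _ "\<lambda>n. snd (z n)"]) simp
qed

text \<open>The repelling fixed points are close to \<open>b\<close>, so the common fixed point
  \<open>q\<close> is not repelling and has to be the attracting one. Properness then speaks of
  \<sigma> at \<open>q\<close> itself.\<close>

lemma fixed_cocycle_unbounded:
  assumes inj: "inj g" and a: "cv (\<lambda>n. Inl (g n)) (Inr q)" and b: "cv (\<lambda>n. Inl (inv (g n))) (Inr b)"
    and ab: "q \<noteq> b" and fxd: "\<And>n. g n q = q"
  shows "\<exists>n. \<sigma> (g n) q > T"
proof -
  have "d (Inr q) (Inr b) > 0" using ab by (subst ms.mdist_pos_eq) auto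
  from proper_lox[OF inj a b ab this] obtain n0 p q' where
    lox: "\<forall>n. loxodromic_with \<Gamma> (g (n + n0)) (p n) (q' n) \<and> d (Inr (p n)) (Inr q) < d (Inr q) (Inr b) \<and> d (Inr (q' n)) (Inr b) < d (Inr q) (Inr b)"
    and lim: "filterlim (\<lambda>n. \<sigma> (g (n + n0)) (p n)) at_top sequentially" by auto
  have "p n = q" for n
  proof -
    have "q \<noteq> q' n" using lox by force
    then show ?thesis using lox_fixed[of "g (n + n0)" "p n" "q' n" q] lox fxd by auto
  qed
  then have "filterlim (\<lambda>n. \<sigma> (g (n + n0)) q) at_top sequentially" using lim by simp
  then have "\<forall>\<^sub>F n in sequentially. T < \<sigma> (g (n + n0)) q" by (simp add: filterlim_at_top_dense)
  then show ?thesis by (auto simp: eventually_sequentially)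
qed

text \<open>If \<open>q\<close> were a global fixed point, then \<open>\<sigma>\<close> at \<open>q\<close> would be a homomorphism \<open>\<Gamma> \<rightarrow> \<real>\<close>. With two
  loxodromic elements \<open>g\<close>, \<open>h\<close> repelling from \<open>q\<close> one builds infinitely many
  \<open>h\<^sup>m g\<^sup>-\<^sup>k\<close> on which this homomorphism is bounded, although properness makes it unbounded.\<close>

lemma no_global_fixed_point: "\<exists>g\<in>\<Gamma>. g q \<noteq> q"
proof (rule ccontr)
  assume "\<not> ?thesis"
  then have fxd: "g q = q" if "g \<in> \<Gamma>" for g using that by auto
  have hom: "\<sigma> (g \<circ> h) q = \<sigma> g q + \<sigma> h q" if "g \<in> \<Gamma>" "h \<in> \<Gamma>" for g h
    using cocycle[OF that, of q] fxd[OF that(2)] by simp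
  have hom_inv: "\<sigma> (inv g) q = - \<sigma> g q" if "g \<in> \<Gamma>" for g
    using cocycle_inv[OF that, of q] fxd[OF that] by simp
  have hom_pow: "\<sigma> (g ^^ k) q = k * \<sigma> g q" if "g \<in> \<Gamma>" for g k
  proof (induction k)
    case (Suc k)
    have "\<sigma> (g ^^ Suc k) q = \<sigma> g q + \<sigma> (g ^^ k) q" using hom[OF that power_in[OF that], of k] by (simp only: funpow.simps)
    then show ?case using Suc by (simp add: algebra_simps del: funpow.simps)
  qed (simp add: id_def[symmetric] del: id_apply)
  \<comment> \<open>Elements tending to \<open>l\<close> fix \<open>q\<close>, so \<open>q\<close>
    is not attracted to \<open>l\<close> and must be their repelling limit. Their inverses tend to
    \<open>q\<close>, where properness makes \<sigma> positive.\<close>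
  have step: "\<exists>g p. loxodromic_with \<Gamma> g p q \<and> d (Inr p) (Inr l) < e \<and> \<sigma> (inv g) q > 0"
    if l: "l \<in> limit_set \<Gamma>" "l \<noteq> q" and e: "e > 0" for l e
  proof -
    obtain g b where g: "inj (g :: nat \<Rightarrow> _)" "\<forall>n. g n \<in> \<Gamma>" and A: "cv (\<lambda>n. Inl (g n)) (Inr l)"
      and B: "cv (\<lambda>n. Inl (inv (g n))) (Inr b)" using limit_set_seq[OF l(1)] by auto
    have bq: "b = q"
    proof (rule ccontr)
      assume "b \<noteq> q"
      then have "cv (\<lambda>n. act (g n) (Inr q)) (Inr l)" by (intro cv_contract[OF A B, of _ "Inr q"]) auto
      moreover have "g n q = q" for n using fxd g(2) by blast
      ultimately have "cv (\<lambda>n. Inr q) (Inr l)" by simp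
      then show False using l(2) cv_unique[OF _ cv_const[OF X_Inr[of q]]] by blast
    qed
    have dl: "d (Inr l) (Inr q) > 0" using l(2) by (subst ms.mdist_pos_eq) auto
    have "min e (d (Inr l) (Inr q)) > 0" using e dl by auto
    from cv_lox[OF A B _ this] obtain k where k: "\<forall>n\<ge>k. \<exists>p q'. loxodromic_with \<Gamma> (g n) p q' \<and> d (Inr p) (Inr l) < min e (d (Inr l) (Inr q))
        \<and> d (Inr q') (Inr b) < min e (d (Inr l) (Inr q))"
      using l(2) bq unfolding eventually_sequentially by auto
    have inj: "inj (\<lambda>n. inv (g (n + k)))" 
    proof (rule injI)
      fix x y assume "inv (g (x + k)) = inv (g (y + k))"
      then have "g (x + k) = g (y + k)" using inj_onD[OF inj_inv] g(2) by blast
      then have "x + k = y + k" by (rule injD[OF g(1)])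
      then show "x = y" by simp
    qed
    have sm: "strict_mono (\<lambda>n::nat. n + k)" by (simp add: strict_mono_def)
    have 1: "cv (\<lambda>n. Inl (inv (g (n + k)))) (Inr q)" using cv_subseq[OF B sm] bq by simp
    have 2: "cv (\<lambda>n. Inl (inv (inv (g (n + k))))) (Inr l)" using cv_subseq[OF A sm] g(2) by simp
    obtain n where n: "\<sigma> (inv (g (n + k))) q > 0"
      using fixed_cocycle_unbounded[OF inj 1 2, of 0] l(2) fxd g(2) by auto
    have "\<exists>p q'. loxodromic_with \<Gamma> (g (n + k)) p q' \<and> d (Inr p) (Inr l) < min e (d (Inr l) (Inr q))
        \<and> d (Inr q') (Inr b) < min e (d (Inr l) (Inr q))"
      using k by simp
    then obtain p q' where pq: "loxodromic_with \<Gamma> (g (n + k)) p q'" "d (Inr p) (Inr l) < min e (d (Inr l) (Inr q))" by auto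
    have "q \<noteq> p" using pq(2) by (auto simp: ms.commute)
    then have "q' = q" using lox_fixed[OF pq(1), of q] fxd g(2) by auto
    then show ?thesis using pq n by auto
  qed
  obtain l1 where l1: "l1 \<in> limit_set \<Gamma>" "l1 \<noteq> q" using three_points by auto
  obtain l2 where l2: "l2 \<in> limit_set \<Gamma>" "l2 \<noteq> q" "l2 \<noteq> l1" using three_points by blast
  define e where "e = d (Inr l1) (Inr l2) / 2"
  have e: "e > 0" unfolding e_def using l2 by (simp add: ms.mdist_pos_eq)
  obtain g p1 where g: "loxodromic_with \<Gamma> g p1 q" "d (Inr p1) (Inr l1) < e" "\<sigma> (inv g) q > 0" using step[OF l1 e] by auto
  obtain h p2 where h: "loxodromic_with \<Gamma> h p2 q" "d (Inr p2) (Inr l2) < e" "\<sigma> (inv h) q > 0" using step[OF l2(1,2) e] by auto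
  have p12: "p1 \<noteq> p2"
  proof
    assume "p1 = p2"
    then have "d (Inr l1) (Inr l2) \<le> d (Inr l1) (Inr p1) + d (Inr p2) (Inr l2)"
      using ms.triangle[of "Inr l1" "Inr p1" "Inr l2"] by simp
    then show False using g(2) h(2) by (simp add: e_def ms.commute)
  qed
  have gG: "g \<in> \<Gamma>" and hG: "h \<in> \<Gamma>" and p1q: "p1 \<noteq> q" and p2q: "p2 \<noteq> q" and gp: "g p1 = p1" and hp: "h p2 = p2"
    using g h by (auto simp: loxodromic_with_def)
  define \<alpha> where "\<alpha> = \<sigma> (inv g) q"
  define \<beta> where "\<beta> = \<sigma> (inv h) q"
  have ab: "\<alpha> > 0" "\<beta> > 0" using g h by (auto simp: \<alpha>_def \<beta>_def)
  have hb: "\<sigma> h q = - \<beta>" using hom_inv[OF hG] by (simp add: \<beta>_def)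
  \<comment> \<open>The homomorphism sends \<open>inv g ^^ k\<close> to \<open>k * \<alpha>\<close>
    and \<open>h\<close> to \<open>- \<beta>\<close>; rounding down leaves a remainder of at most
    \<beta>.\<close>
  define m where "m k = nat \<lfloor>real k * \<alpha> / \<beta>\<rfloor>" for k :: nat
  define f where "f k = h ^^ m k \<circ> inv g ^^ k" for k
  have fG: "f k \<in> \<Gamma>" for k unfolding f_def using power_in[OF hG] power_in[OF inv_in[OF gG]] by simp
  have m1: "real (m k) \<le> real k * \<alpha> / \<beta>" "real k * \<alpha> / \<beta> < real (m k) + 1" for k
  proof -
    have "real k * \<alpha> / \<beta> \<ge> 0" using ab by simp
    then have "real (m k) = of_int \<lfloor>real k * \<alpha> / \<beta>\<rfloor>" unfolding m_def by simp
    then show "real (m k) \<le> real k * \<alpha> / \<beta>" "real k * \<alpha> / \<beta> < real (m k) + 1" by linarith+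
  qed
  have fb: "\<bar>\<sigma> (f k) q\<bar> \<le> \<beta>" for k
  proof -
    have "\<sigma> (f k) q = real k * \<alpha> - real (m k) * \<beta>"
      unfolding f_def using hom[OF power_in[OF hG] power_in[OF inv_in[OF gG]]] hom_pow[OF hG] hom_pow[OF inv_in[OF gG]]
      by (simp add: hb \<alpha>_def)
    moreover have "real (m k) * \<beta> \<le> real k * \<alpha>" "real k * \<alpha> < (real (m k) + 1) * \<beta>"
      using m1[of k] ab by (auto simp: field_simps)
    ultimately show ?thesis by (simp add: algebra_simps)
  qed
  have mtop: "filterlim m at_top sequentially"
    unfolding filterlim_at_top
  proof
    fix Z
    have "Z \<le> m k" if "k \<ge> nat \<lceil>(real Z + 1) * \<beta> / \<alpha>\<rceil>" for k
    proof -
      have "real k \<ge> (real Z + 1) * \<beta> / \<alpha>" using that by linarith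
      then have "real k * \<alpha> / \<beta> \<ge> real Z + 1" using ab by (simp add: field_simps)
      then show ?thesis using m1(2)[of k] by linarith
    qed
    then show "\<forall>\<^sub>F k in sequentially. Z \<le> m k" unfolding eventually_sequentially by blast
  qed
  \<comment> \<open>\<open>p1\<close> is fixed by \<open>inv g\<close> and then carried to
    \<open>p2\<close> by the powers of \<open>h\<close>, since \<open>p1\<close> is not the
    repelling point \<open>q\<close>. As \<open>h ^^ m k\<close> fixes \<open>p2\<close>, no
    \<open>f k\<close> sends \<open>p1\<close> exactly to \<open>p2\<close>, so no element occurs
    infinitely often among the \<open>f k\<close>.\<close>
  have fp1: "(\<lambda>k. f k p1) \<longlonglongrightarrow> p2"
  proof -
    have "(inv g ^^ k) p1 = p1" for k
      by (induction k) (use inv_app(1)[OF gG, of p1] gp in auto)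
    then have "f k p1 = (h ^^ m k) p1" for k by (simp add: f_def)
    moreover have "(\<lambda>n. (h ^^ n) p1) \<longlonglongrightarrow> p2"
      using h(1) p1q by (intro luc_pt[of _ "- {q}"]) (auto simp: loxodromic_with_def)
    then have "(\<lambda>k. (h ^^ m k) p1) \<longlonglongrightarrow> p2" using filterlim_compose[OF _ mtop] by blast
    ultimately show ?thesis by simp
  qed
  have "finite {k. f k = u}" for u
  proof (rule ccontr)
    assume inf: "infinite {k. f k = u}"
    let ?r = "enumerate {k. f k = u}"
    have fu: "f (?r n) = u" for n using enumerate_in_set[OF inf, of n] by simp
    have "(\<lambda>n. f (?r n) p1) \<longlonglongrightarrow> p2"
      using LIMSEQ_subseq_LIMSEQ[OF fp1 strict_mono_enumerate[OF inf]] by (simp add: o_def)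
    then have "u p1 = p2" using fu by (simp add: LIMSEQ_const_iff)
    then have "f (?r 0) p1 = p2" using fu by simp
    moreover have "(h ^^ k) p2 = p2" for k by (induction k) (auto simp: hp)
    moreover have "(inv g ^^ k) p1 = p1" for k
      by (induction k) (use inv_app(1)[OF gG, of p1] gp in auto)
    ultimately have "(h ^^ m (?r 0)) p1 = (h ^^ m (?r 0)) p2" by (simp add: f_def)
    then show False using p12 bij[OF power_in[OF hG, of "m (?r 0)"]] by (auto simp: bij_def inj_def)
  qed
  then obtain s where s: "strict_mono (s :: nat \<Rightarrow> nat)" "inj (\<lambda>n. f (s n))" using inj_subseq[of f] by auto
  have "\<forall>n. f (s n) \<in> \<Gamma>" using fG by simp
  from conv_subseq[OF s(2) this] obtain r a b where r: "strict_mono (r :: nat \<Rightarrow> nat)"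
    and A: "cv (\<lambda>n. Inl (f (s (r n)))) (Inr a)" and B: "cv (\<lambda>n. Inl (inv (f (s (r n))))) (Inr b)" by auto
  have inj: "inj (\<lambda>n. f (s (r n)))"
  proof (rule injI)
    fix x y assume "f (s (r x)) = f (s (r y))"
    then have "r x = r y" by (rule injD[OF s(2)])
    then show "x = y" using r by (simp add: strict_mono_eq)
  qed
  have A': "cv (\<lambda>n. Inl (inv (inv (f (s (r n)))))) (Inr a)" using A fG by simp
  have inj': "inj (\<lambda>n. inv (f (s (r n))))"
  proof (rule injI)
    fix x y assume "inv (f (s (r x))) = inv (f (s (r y)))"
    then have "f (s (r x)) = f (s (r y))" using inj_onD[OF inj_inv] fG by blast
    then show "x = y" by (rule injD[OF inj])
  qed
  \<comment> \<open>Either \<open>q\<close> is the repelling limit, and then it is the attracting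
    limit of the inverses, or it is attracted and hence equals the attracting limit. In both cases
    properness contradicts the bound \<beta>.\<close>
  show False
  proof (cases "b = q")
    case True
    have "cv (\<lambda>n. act (f (s (r n))) (Inr p1)) (Inr a)" using True p1q by (intro cv_contract[OF A B, of _ "Inr p1"]) auto
    then have "(\<lambda>n. f (s (r n)) p1) \<longlonglongrightarrow> a" by (simp add: cv_Inr)
    moreover have "strict_mono (\<lambda>n. s (r n))" using s(1) r by (auto simp: strict_mono_def)
    then have "(\<lambda>n. f (s (r n)) p1) \<longlonglongrightarrow> p2" using LIMSEQ_subseq_LIMSEQ[OF fp1, of "\<lambda>n. s (r n)"] by (simp add: o_def)
    ultimately have "a = p2" by (rule LIMSEQ_unique)
    then have "q \<noteq> a" using p2q by simp
    from fixed_cocycle_unbounded[OF inj' _ A' this, of \<beta>] obtain n where "\<sigma> (inv (f (s (r n)))) q > \<beta>"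
      using B True fxd[OF inv_in[OF fG]] by auto
    then show False using fb[of "s (r n)"] hom_inv[OF fG, of "s (r n)"] by simp
  next
    case False
    then have "cv (\<lambda>n. act (f (s (r n))) (Inr q)) (Inr a)" by (intro cv_contract[OF A B, of _ "Inr q"]) auto
    then have "cv (\<lambda>n. Inr q) (Inr a)" using fxd[OF fG] by simp
    then have "a = q" using cv_unique[OF _ cv_const[OF X_Inr[of q]]] by blast
    then obtain n where "\<sigma> (f (s (r n))) q > \<beta>"
      using fixed_cocycle_unbounded[OF inj _ B, of q \<beta>] A False fxd[OF fG] by auto
    then show False using fb[of "s (r n)"] by simp
  qed
qed

text \<open>A sequence of distinct elements of bounded magnitude could be composed with a fixed
  \<eta> so that its attracting and repelling limits differ. Properness makes the cocycle at the
  attracting fixed points unbounded. Those points stay away from \<open>inv (g n)\<close>, so there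
  the cocycle of \<open>g n\<close> is within a constant of its magnitude, and \<eta> changes it
  only by a bounded amount.\<close>

lemma finite_N: "finite {g \<in> \<Gamma>. N g \<le> T}"
proof (rule ccontr)
  assume "infinite {g \<in> \<Gamma>. N g \<le> T}"
  then obtain g0 where g0: "inj (g0 :: nat \<Rightarrow> _)" "\<forall>n. g0 n \<in> {g \<in> \<Gamma>. N g \<le> T}" using infinite_seq by blast
  have "\<forall>n. g0 n \<in> \<Gamma>" using g0(2) by auto
  from conv_subseq[OF g0(1) this] obtain r a b where r: "strict_mono (r :: nat \<Rightarrow> nat)"
    and A: "cv (\<lambda>n. Inl (g0 (r n))) (Inr a)" and B: "cv (\<lambda>n. Inl (inv (g0 (r n)))) (Inr b)" by auto
  define g where "g n = g0 (r n)" for n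
  have gG: "g n \<in> \<Gamma>" and gN: "N (g n) \<le> T" for n using g0(2) by (auto simp: g_def)
  have inj: "inj g"
  proof (rule injI)
    fix x y assume "g x = g y"
    then have "r x = r y" unfolding g_def by (rule injD[OF g0(1)])
    then show "x = y" using r by (simp add: strict_mono_eq)
  qed
  have A: "cv (\<lambda>n. Inl (g n)) (Inr a)" and B: "cv (\<lambda>n. Inl (inv (g n))) (Inr b)" using A B by (auto simp: g_def)
  \<comment> \<open>The identity serves if the limits already differ.\<close>
  obtain \<eta> where \<eta>: "\<eta> \<in> \<Gamma>" "\<eta> a \<noteq> b"
    using no_global_fixed_point[of a] id_in by (metis id_apply)
  have inj': "inj (\<lambda>n. \<eta> \<circ> g n)"
  proof (rule injI)
    fix x y assume "\<eta> \<circ> g x = \<eta> \<circ> g y"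
    then have "inv \<eta> \<circ> \<eta> \<circ> g x = inv \<eta> \<circ> \<eta> \<circ> g y" by (simp only: o_assoc[symmetric])
    then show "x = y" using \<eta> by (simp add: injD[OF inj])
  qed
  have A1: "cv (\<lambda>n. Inl (\<eta> \<circ> g n)) (Inr (\<eta> a))" using cv_act[OF \<eta>(1) A] by simp
  have A': "cv (\<lambda>n. Inl (inv (inv (g n)))) (Inr a)" using A gG by simp
  have "cv (\<lambda>n. act (inv (g n)) (Inl (inv \<eta>))) (Inr b)" using \<eta> by (intro cv_contract[OF B A', of _ "Inl (inv \<eta>)"]) auto
  then have B1: "cv (\<lambda>n. Inl (inv (\<eta> \<circ> g n))) (Inr b)" using gG \<eta> by (simp add: inv_o)
  define c where "c = d (Inr (\<eta> a)) (Inr b)"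
  have c: "c > 0" unfolding c_def using \<eta> by (subst ms.mdist_pos_eq) auto
  then have c4: "c/4 > 0" by simp
  obtain n0 p q where lox: "\<forall>n. loxodromic_with \<Gamma> (\<eta> \<circ> g (n + n0)) (p n) (q n) \<and> d (Inr (p n)) (Inr (\<eta> a)) < c/4 \<and> d (Inr (q n)) (Inr b) < c/4"
    and lim: "filterlim (\<lambda>n. \<sigma> (\<eta> \<circ> g (n + n0)) (p n)) at_top sequentially"
    using proper_lox[OF inj' A1 B1 \<eta>(2) c4] by auto
  obtain C where C: "\<forall>g\<in>\<Gamma>. \<forall>x. d (Inr x) (Inl (inv g)) > c/4 \<longrightarrow> \<bar>\<sigma> g x - N g\<bar> \<le> C" using mag[OF c4] by auto
  obtain C' where C': "\<forall>x. \<bar>\<sigma> \<eta> x\<bar> \<le> C'" using \<sigma>_bounded[OF \<eta>(1)] by auto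
  have sm: "strict_mono (\<lambda>n::nat. n + n0)" by (simp add: strict_mono_def)
  have "\<forall>\<^sub>F n in sequentially. T + C + C' < \<sigma> (\<eta> \<circ> g (n + n0)) (p n)" using lim by (simp add: filterlim_at_top_dense)
  moreover have "\<forall>\<^sub>F n in sequentially. d (Inl (inv (g (n + n0)))) (Inr b) < c/4" using cv_D[OF cv_subseq[OF B sm] c4] .
  ultimately have "\<forall>\<^sub>F n :: nat in sequentially. False"
  proof eventually_elim
    case (elim n)
    have "d (Inr (\<eta> a)) (Inr b) \<le> d (Inr (\<eta> a)) (Inr (p n)) + d (Inr (p n)) (Inr b)"
      "d (Inr (p n)) (Inr b) \<le> d (Inr (p n)) (Inl (inv (g (n + n0)))) + d (Inl (inv (g (n + n0)))) (Inr b)"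
      using gG by (intro ms.triangle; simp)+
    moreover have "d (Inr (\<eta> a)) (Inr (p n)) < c/4" using lox ms.commute by metis
    ultimately have "d (Inr (p n)) (Inl (inv (g (n + n0)))) > c/4" using elim(2) c unfolding c_def by linarith
    then have "\<bar>\<sigma> (g (n + n0)) (p n) - N (g (n + n0))\<bar> \<le> C" using C gG by blast
    moreover have "\<bar>\<sigma> \<eta> (g (n + n0) (p n))\<bar> \<le> C'" using C' by blast
    ultimately show False using elim(1) cocycle[OF \<eta>(1) gG, of "n + n0" "p n"] gN[of "n + n0"] by linarith
  qed
  then show False by simp
qed

lemma countable: "countable \<Gamma>"
proof -
  have "\<Gamma> = (\<Union>n::nat. {g \<in> \<Gamma>. N g \<le> real n})" by (use real_arch_simple in blast)
  moreover have "countable (\<Union>n::nat. {g \<in> \<Gamma>. N g \<le> real n})" 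
    by (rule countable_UN) (auto intro: countable_finite finite_N)
  ultimately show ?thesis by simp
qed

lemma infinite: "infinite \<Gamma>"
proof -
  obtain z where "z \<in> limit_set \<Gamma>" using three_points by auto
  then obtain g where "inj (g :: nat \<Rightarrow> _)" "\<forall>n. g n \<in> \<Gamma>" using limit_set_seq by blast
  then show ?thesis using finite_subset[of "range g" \<Gamma>] finite_imageD[of g UNIV] by auto
qed

text \<open>For \<open>z\<close> far from \<open>g\<close>, the relation between the cocycles at
  \<open>x\<close> and \<open>inv g z\<close> expresses \<open>\<sigma>' g x\<close> as
  \<open>\<sigma> (inv g) z\<close> plus two values of \<open>G\<close>. Contraction by
  \<open>g\<close> and by \<open>inv g\<close> keeps both pairs in \<open>G\<close> apart, so these
  values are bounded.\<close>

lemma magnitude_swap: "is_magnitude \<Gamma> d \<sigma>' (\<lambda>g. N (inv g))"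
  unfolding is_magnitude_def
proof (intro allI impI)
  fix \<epsilon> :: real assume \<epsilon>: "\<epsilon> > 0"
  obtain z1 z2 c where c: "c > 0" "\<forall>p\<in>X. d (Inr z1) p > c \<or> d (Inr z2) p > c" using separated_point by auto
  define e where "e = min (\<epsilon>/2) (c/2)"
  have e: "e > 0" using \<epsilon> c by (simp add: e_def)
  obtain F where F: "finite F" "\<forall>g\<in>\<Gamma> - F.
    (\<forall>p\<in>X. d p (Inl (inv g)) > e \<longrightarrow> d (act g p) (Inl g) < e) \<and>
    (\<forall>p\<in>X. d p (Inl g) > e \<longrightarrow> d (act (inv g) p) (Inl (inv g)) < e)" using contraction2[OF e] by auto
  obtain C1 where C1: "C1 > 0" "\<forall>g\<in>\<Gamma>. \<forall>x. d (Inr x) (Inl (inv g)) > c \<longrightarrow> \<bar>\<sigma> g x - N g\<bar> \<le> C1" using mag[OF c(1)] by auto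
  obtain B where B: "\<forall>x y. d (Inr x) (Inr y) \<ge> e \<longrightarrow> \<bar>G (x, y)\<bar> \<le> B" using G_bounded[OF e] by auto
  have "\<exists>C2. \<forall>g\<in>F \<inter> \<Gamma>. \<forall>x. \<bar>\<sigma>' g x - N (inv g)\<bar> \<le> C2"
  proof (rule finite_uniform_bound)
    fix g assume "g \<in> F \<inter> \<Gamma>"
    then have "continuous_on UNIV (\<lambda>x. \<sigma>' g x - N (inv g))" by (intro continuous_intros cont_\<sigma>') auto
    then show "\<exists>B. \<forall>x. \<bar>\<sigma>' g x - N (inv g)\<bar> \<le> B" by (rule cont_bounded)
  qed (use F in auto)
  then obtain C2 where C2: "\<forall>g\<in>F \<inter> \<Gamma>. \<forall>x. \<bar>\<sigma>' g x - N (inv g)\<bar> \<le> C2" by auto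
  have main: "\<bar>\<sigma>' g x - N (inv g)\<bar> \<le> C1 + 2 * B" if g: "g \<in> \<Gamma> - F" and x: "d (Inr x) (Inl (inv g)) > \<epsilon>" for g x
  proof -
    have gG: "g \<in> \<Gamma>" using g by simp
    obtain z where z: "d (Inr z) (Inl g) > c" using c(2) gG by (metis X_Inl)
    have "c > e" "\<epsilon> > e" using \<epsilon> c by (auto simp: e_def)
    then have 1: "d (Inr (g x)) (Inl g) < e" "d (Inr (inv g z)) (Inl (inv g)) < e"
      using bspec[OF F(2) g] x z by (auto dest: bspec[of X _ "Inr x"] bspec[of X _ "Inr z"])
    have "d (Inr z) (Inl g) \<le> d (Inr z) (Inr (g x)) + d (Inr (g x)) (Inl g)"
      "d (Inr x) (Inl (inv g)) \<le> d (Inr x) (Inr (inv g z)) + d (Inr (inv g z)) (Inl (inv g))"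
      using gG by (intro ms.triangle; simp)+
    moreover have "c \<ge> 2 * e" "\<epsilon> \<ge> 2 * e" by (auto simp: e_def)
    ultimately have 2: "d (Inr (g x)) (Inr z) \<ge> e" "d (Inr x) (Inr (inv g z)) \<ge> e" using 1 x z ms.commute[of "Inr z" "Inr (g x)"] by linarith+
    then have "\<bar>G (g x, z)\<bar> \<le> B" "\<bar>G (x, inv g z)\<bar> \<le> B" using B by auto
    moreover have "x \<noteq> inv g z" using 2 e by auto
    from G_eq[OF gG this] have "\<sigma>' g x + \<sigma> g (inv g z) = G (g x, z) - G (x, inv g z)" using gG by simp
    moreover have "\<sigma> g (inv g z) = - \<sigma> (inv g) z" using cocycle_inv[OF inv_in[OF gG], of z] gG by simp
    moreover have "\<bar>\<sigma> (inv g) z - N (inv g)\<bar> \<le> C1" using C1(2) z gG by simp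
    ultimately show ?thesis by linarith
  qed
  define C where "C = max (C1 + 2 * \<bar>B\<bar>) C2"
  show "\<exists>C>0. \<forall>\<gamma>\<in>\<Gamma>. \<forall>x. \<epsilon> < d (Inr x) (Inl (inv \<gamma>)) \<longrightarrow> N (inv \<gamma>) - C \<le> \<sigma>' \<gamma> x \<and> \<sigma>' \<gamma> x \<le> N (inv \<gamma>) + C"
  proof (intro exI[of _ C] conjI ballI allI impI)
    show "C > 0" using C1 by (auto simp: C_def)
    fix g x assume g: "g \<in> \<Gamma>" and x: "\<epsilon> < d (Inr x) (Inl (inv g))"
    have "\<bar>\<sigma>' g x - N (inv g)\<bar> \<le> C"
    proof (cases "g \<in> F")
      case True
      then have "\<bar>\<sigma>' g x - N (inv g)\<bar> \<le> C2" using C2 g by blast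
      then show ?thesis by (simp add: C_def)
    next
      case False
      then have "\<bar>\<sigma>' g x - N (inv g)\<bar> \<le> C1 + 2 * B" using main g x by blast
      then show ?thesis by (simp add: C_def)
    qed
    then show "N (inv g) - C \<le> \<sigma>' g x" "\<sigma>' g x \<le> N (inv g) + C" by linarith+
  qed
qed

lemma GPS_swap: "GPS \<Gamma> d \<sigma>' \<sigma> (\<lambda>(x, y). G (y, x)) (\<lambda>g. N (inv g))"
proof (unfold_locales)
  have "continuous_on {(x, y). x \<noteq> y} (G \<circ> (\<lambda>(x, y). (y, x)))"
    using gps unfolding continuous_GPS_system_def
    by (intro continuous_on_compose) (auto simp: case_prod_unfold intro!: continuous_intros elim!: continuous_on_subset)
  then have "continuous_on {(x, y). x \<noteq> y} (\<lambda>(x, y). G (y, x))" by (simp add: o_def case_prod_unfold)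
  moreover have "\<forall>g\<in>\<Gamma>. \<forall>x y. x \<noteq> y \<longrightarrow> \<sigma> g x + \<sigma>' g y = G (g y, g x) - G (y, x)"
    using G_eq by (metis add.commute)
  ultimately show "continuous_GPS_system \<Gamma> d \<sigma>' \<sigma> (\<lambda>(x, y). G (y, x))"
    using gps unfolding continuous_GPS_system_def by auto
qed (rule magnitude_swap)

end

section \<open>Conformal measures and shadows\<close>

text \<open>A second moment argument: by the Paley--Zygmund inequality the counting function exceeds half
  of its mean with probability bounded below.\<close>

lemma (in prob_space) second_moment_not_AE_finite:
  fixes S :: "'i \<Rightarrow> 'a set" and F :: "nat \<Rightarrow> 'i set"
  assumes S: "\<And>i. i \<in> I \<Longrightarrow> S i \<in> events" and F: "\<And>n. finite (F n)" "\<And>n. F n \<subseteq> I"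
    and a: "filterlim (\<lambda>n. \<Sum>i\<in>F n. prob (S i)) at_top sequentially"
    and K: "\<And>n. (\<Sum>i\<in>F n. \<Sum>j\<in>F n. prob (S i \<inter> S j)) \<le> K * (\<Sum>i\<in>F n. prob (S i))\<^sup>2"
  shows "\<not> (AE x in M. finite {i\<in>I. x \<in> S i})"
proof
  assume AE: "AE x in M. finite {i\<in>I. x \<in> S i}"
  define Z where "Z n x = (\<Sum>i\<in>F n. indicator (S i) x :: real)" for n x
  define a where "a n = (\<Sum>i\<in>F n. prob (S i))" for n
  define W where "W n = {x \<in> space M. Z n x \<ge> a n / 2}" for n
  define K' where "K' = max K 1"
  have SF: "S i \<in> events" if "i \<in> F n" for i n using S F that by auto
  have Zm [measurable]: "Z n \<in> borel_measurable M" for n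
    unfolding Z_def using SF by (intro borel_measurable_sum borel_measurable_indicator) auto
  have Wm [measurable]: "W n \<in> events" for n unfolding W_def by measurable
  have EZ: "expectation (Z n) = a n" "integrable M (Z n)" for n
  proof -
    have i: "integrable M (indicator (S i) :: _ \<Rightarrow> real)" if "i \<in> F n" for i
      using SF[OF that] by (simp add: integrable_indicator_iff emeasure_eq_measure)
    show "integrable M (Z n)" unfolding Z_def using i by (rule Bochner_Integration.integrable_sum)
    show "expectation (Z n) = a n" unfolding Z_def a_def
      using i SF by (subst Bochner_Integration.integral_sum) (auto intro!: sum.cong)
  qed
  have Z2: "Z n x ^ 2 = (\<Sum>i\<in>F n. \<Sum>j\<in>F n. indicator (S i \<inter> S j) x)" for n x
    unfolding Z_def power2_eq_square sum_product by (simp add: indicator_inter_arith)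
  have EZ2: "expectation (\<lambda>x. Z n x ^ 2) \<le> K' * (a n)\<^sup>2" "integrable M (\<lambda>x. Z n x ^ 2)" for n
  proof -
    have ij: "integrable M (indicator (S i \<inter> S j) :: _ \<Rightarrow> real)" if "i \<in> F n" "j \<in> F n" for i j
      using SF[OF that(1)] SF[OF that(2)] by (simp add: integrable_indicator_iff emeasure_eq_measure sets.Int)
    have "expectation (\<lambda>x. Z n x ^ 2) = (\<Sum>i\<in>F n. \<Sum>j\<in>F n. prob (S i \<inter> S j))"
    proof -
      have "expectation (\<lambda>x. Z n x ^ 2) = (\<Sum>i\<in>F n. expectation (\<lambda>x. \<Sum>j\<in>F n. indicator (S i \<inter> S j) x))"
        unfolding Z2 using ij by (intro Bochner_Integration.integral_sum Bochner_Integration.integrable_sum)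
      also have "\<dots> = (\<Sum>i\<in>F n. \<Sum>j\<in>F n. expectation (indicator (S i \<inter> S j)))"
        using ij by (intro sum.cong Bochner_Integration.integral_sum) auto
      also have "\<dots> = (\<Sum>i\<in>F n. \<Sum>j\<in>F n. prob (S i \<inter> S j))"
        using SF by (intro sum.cong) auto
      finally show ?thesis .
    qed
    also have "\<dots> \<le> K' * (a n)\<^sup>2"
      using K[of n] mult_right_mono[of K K' "(a n)\<^sup>2"] unfolding a_def K'_def by simp
    finally show "expectation (\<lambda>x. Z n x ^ 2) \<le> K' * (a n)\<^sup>2" .
    show "integrable M (\<lambda>x. Z n x ^ 2)"
      unfolding Z2 using ij by (intro Bochner_Integration.integrable_sum)
  qed
  have PW: "1 / (4 * K') \<le> prob (W n)" if an: "a n > 0" for n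
  proof -
    \<comment> \<open>On \<open>W n\<close>, completing the square bounds \<open>Z n x\<close> by
      \<open>t / 2\<close> times its square plus \<open>1 / (2 * t)\<close>. This \<open>t\<close>
      turns the second moment term into \<open>a n / 4\<close>, half of what is left of the mean
      after \<open>a n / 2\<close> is removed.\<close>
    define t where "t = 1 / (2 * K' * a n)"
    have K'0: "K' > 0" by (simp add: K'_def)
    have t: "t > 0" using an K'0 by (simp add: t_def)
    have "Z n x \<le> a n / 2 + (t / 2 * Z n x ^ 2 + 1 / (2 * t) * indicator (W n) x)" if "x \<in> space M" for x
    proof (cases "x \<in> W n")
      case True
      have "0 \<le> (t * Z n x - 1)\<^sup>2 / (2 * t)" using t by simp
      also have "\<dots> = t / 2 * Z n x ^ 2 + 1 / (2 * t) - Z n x" using t by (simp add: field_simps power2_eq_square)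
      finally show ?thesis using True an by simp
    next
      case False
      then have "Z n x \<le> a n / 2" using that by (simp add: W_def)
      then show ?thesis using t by (simp add: add_increasing2)
    qed
    moreover have int1: "integrable M (\<lambda>x. t / 2 * Z n x ^ 2)" using EZ2(2) by (rule integrable_mult_right)
    moreover have int2: "integrable M (\<lambda>x. 1 / (2 * t) * indicator (W n) x :: real)"
      by (intro integrable_mult_right) (simp add: integrable_indicator_iff emeasure_eq_measure)
    moreover have int: "integrable M (\<lambda>x. a n / 2 + (t / 2 * Z n x ^ 2 + 1 / (2 * t) * indicator (W n) x))"
      using int1 int2 by (intro Bochner_Integration.integrable_add) auto
    ultimately have "expectation (Z n) \<le> expectation (\<lambda>x. a n / 2 + (t / 2 * Z n x ^ 2 + 1 / (2 * t) * indicator (W n) x))"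
      using EZ(2) int by (intro integral_mono)
    also have "\<dots> = a n / 2 + (t / 2 * expectation (\<lambda>x. Z n x ^ 2) + 1 / (2 * t) * prob (W n))"
    proof -
      have "expectation (\<lambda>x. a n / 2 + (t / 2 * Z n x ^ 2 + 1 / (2 * t) * indicator (W n) x)) =
          expectation (\<lambda>_. a n / 2) + expectation (\<lambda>x. t / 2 * Z n x ^ 2 + 1 / (2 * t) * indicator (W n) x)"
        using int1 int2 by (intro Bochner_Integration.integral_add) auto
      also have "expectation (\<lambda>x. t / 2 * Z n x ^ 2 + 1 / (2 * t) * indicator (W n) x) =
          expectation (\<lambda>x. t / 2 * Z n x ^ 2) + expectation (\<lambda>x. 1 / (2 * t) * indicator (W n) x)"
        using int1 int2 by (intro Bochner_Integration.integral_add) auto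
      also have "expectation (\<lambda>x. t / 2 * Z n x ^ 2) = t / 2 * expectation (\<lambda>x. Z n x ^ 2)" by (rule integral_mult_right_zero)
      also have "expectation (\<lambda>x. 1 / (2 * t) * indicator (W n) x) = 1 / (2 * t) * expectation (indicator (W n))" by (rule integral_mult_right_zero)
      also have "expectation (indicator (W n)) = prob (W n)" by simp
      also have "expectation (\<lambda>_. a n / 2) = a n / 2" by (simp add: prob_space)
      finally show ?thesis .
    qed
    also have "\<dots> \<le> a n / 2 + (t / 2 * (K' * (a n)\<^sup>2) + 1 / (2 * t) * prob (W n))"
      using EZ2(1)[of n] t by (intro add_left_mono add_right_mono mult_left_mono) auto
    also have "\<dots> = a n / 2 + (a n / 4 + K' * a n * prob (W n))"
      using an K'0 by (simp add: t_def field_simps power2_eq_square)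
    finally have "a n / 4 \<le> K' * a n * prob (W n)" using EZ(1)[of n] by simp
    then show ?thesis using an K'0 by (simp add: field_simps)
  qed
  have "\<forall>\<^sub>F n in sequentially. a n > 0" using a unfolding a_def[symmetric] filterlim_at_top_dense by blast
  then obtain n0 where n0: "\<And>n. n \<ge> n0 \<Longrightarrow> a n > 0" unfolding eventually_sequentially by auto
  \<comment> \<open>The intersection of the tails \<open>V n\<close> is the event that the count
    exceeds half its mean infinitely often. It keeps the uniform lower bound for the probability,
    but it is disjoint from the points of finite count, because the means tend to infinity.\<close>
  define V where "V n = (\<Union>k. W (n + n0 + k))" for n
  have "decseq V" unfolding V_def decseq_Suc_iff
  proof (intro allI UN_least)
    fix n k show "W (Suc n + n0 + k) \<subseteq> (\<Union>k. W (n + n0 + k))" using UN_upper[of "Suc k" UNIV "\<lambda>k. W (n + n0 + k)"] by simp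
  qed
  moreover have Vm: "range V \<subseteq> events" by (auto simp: V_def)
  ultimately have lim: "(\<lambda>n. prob (V n)) \<longlonglongrightarrow> prob (\<Inter>n. V n)" by (intro finite_Lim_measure_decseq)
  have "1 / (4 * K') \<le> prob (V n)" for n
  proof -
    have "1 / (4 * K') \<le> prob (W (n + n0 + 0))" by (intro PW n0) simp
    also have "\<dots> \<le> prob (V n)" 
      using Vm UN_upper[of 0 UNIV "\<lambda>k. W (n + n0 + k)"] by (intro finite_measure_mono) (auto simp: V_def)
    finally show ?thesis .
  qed
  then have "1 / (4 * K') \<le> prob (\<Inter>n. V n)" by (intro LIMSEQ_le_const[OF lim]) auto
  then have pos: "prob (\<Inter>n. V n) > 0" by (rule less_le_trans[rotated]) (simp add: K'_def)
  have "x \<notin> (\<Inter>n. V n)" if fin: "finite {i\<in>I. x \<in> S i}" for x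
  proof
    assume x: "x \<in> (\<Inter>n. V n)"
    define c where "c = real (card {i\<in>I. x \<in> S i})"
    have Zc: "Z n x \<le> c" for n
    proof -
      have "Z n x = (\<Sum>i\<in>F n \<inter> {i. x \<in> S i}. 1)" unfolding Z_def
        by (subst sum.inter_restrict[OF F(1)]) (auto intro!: sum.cong simp: indicator_def)
      also have "\<dots> \<le> c" unfolding c_def using F(2)[of n] by (auto intro!: card_mono fin)
      finally show ?thesis .
    qed
    have "\<forall>\<^sub>F n in sequentially. a n > 2 * c" using a unfolding a_def[symmetric] filterlim_at_top_dense by blast
    then obtain n1 where n1: "\<And>n. n \<ge> n1 \<Longrightarrow> a n > 2 * c" unfolding eventually_sequentially by auto
    obtain k where "x \<in> W (n1 + n0 + k)" using x by (auto simp: V_def)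
    then have "a (n1 + n0 + k) / 2 \<le> c" using Zc[of "n1 + n0 + k"] by (simp add: W_def)
    then show False using n1[of "n1 + n0 + k"] by simp
  qed
  then have "AE x in M. x \<notin> (\<Inter>n. V n)" using AE by (auto elim: eventually_mono)
  then have "prob (\<Inter>n. V n) = 0" using Vm by (subst prob_eq_0) auto
  then show False using pos by simp
qed

text \<open>\<nu> is an arbitrary conformal measure: the results are applied to the measures of both
  endpoints and to normalized restrictions to invariant sets.\<close>

locale GPS_conformal = GPS \<Gamma> d \<sigma> \<sigma>' G N
  for \<Gamma> :: "('m::{metric_space, second_countable_topology} \<Rightarrow> 'm) set" and d \<sigma> \<sigma>' G N +
  fixes \<delta> :: real and \<nu> :: "'m measure"
  assumes conformal: "conformal_measure \<Gamma> \<sigma> \<delta> \<nu>"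
    and \<delta>_nonneg: "\<delta> \<ge> 0"
    and divergent: "poincare_series \<Gamma> N \<delta> = \<infinity>"
begin

sublocale nu: prob_space \<nu>
  using conformal by (simp add: conformal_measure_def)

lemma sets_\<nu> [measurable_cong, simp]: "sets \<nu> = sets borel"
  using conformal by (simp add: conformal_measure_def)

lemma space_\<nu> [simp]: "space \<nu> = UNIV"
  using sets_eq_imp_space_eq[OF sets_\<nu>] by simp

lemma dist_meas [measurable]: "p \<in> X \<Longrightarrow> (\<lambda>y. d (Inr y) p) \<in> borel_measurable borel"
  by (intro borel_measurable_continuous_onI cont_dist)

lemma image_borel: "g \<in> \<Gamma> \<Longrightarrow> A \<in> sets borel \<Longrightarrow> g ` A \<in> sets borel"
proof -
  assume g: "g \<in> \<Gamma>" and A: "A \<in> sets borel"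
  have "g ` A = inv g -` A" using bij[OF g] by (simp add: bij_vimage_eq_inv_image bij_imp_bij_inv inv_inv g)
  then show ?thesis using measurable_sets_borel[OF meas[OF inv_in[OF g]] A] by simp
qed

lemma emeasure_image:
  assumes g: "g \<in> \<Gamma>" and A: "A \<in> sets borel"
  shows "emeasure \<nu> (g ` A) = (\<integral>\<^sup>+y. ennreal (exp (- \<delta> * \<sigma> g y)) * indicator A y \<partial>\<nu>)"
proof -
  have d: "distr \<nu> borel (inv g) = density \<nu> (\<lambda>x. ennreal (exp (- \<delta> * \<sigma> (inv (inv g)) x)))"
    using conformal inv_in[OF g] by (simp add: conformal_measure_def)
  have "g ` A = inv g -` A" using bij[OF g] by (simp add: bij_vimage_eq_inv_image bij_imp_bij_inv inv_inv g)
  then have "emeasure \<nu> (g ` A) = emeasure (distr \<nu> borel (inv g)) A"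
    using A meas[OF inv_in[OF g]] by (subst emeasure_distr) auto
  also have "\<dots> = (\<integral>\<^sup>+y. ennreal (exp (- \<delta> * \<sigma> g y)) * indicator A y \<partial>\<nu>)"
    unfolding d inv_inv[OF g] using A borel_measurable_continuous_onI[OF cont_\<sigma>[OF g]] by (subst emeasure_density) auto
  finally show ?thesis .
qed

lemma image_bounds:
  assumes g: "g \<in> \<Gamma>" and A: "A \<in> sets borel" and C: "\<And>y. y \<in> A \<Longrightarrow> \<bar>\<sigma> g y - N g\<bar> \<le> C"
  shows "exp (- \<delta> * C) * exp (- \<delta> * N g) * nu.prob A \<le> nu.prob (g ` A)"
    and "nu.prob (g ` A) \<le> exp (\<delta> * C) * exp (- \<delta> * N g) * nu.prob A"
proof -
  have b: "exp (- \<delta> * C) * exp (- \<delta> * N g) \<le> exp (- \<delta> * \<sigma> g y)" "exp (- \<delta> * \<sigma> g y) \<le> exp (\<delta> * C) * exp (- \<delta> * N g)" if "y \<in> A" for y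
  proof -
    have "N g - C \<le> \<sigma> g y" "\<sigma> g y \<le> N g + C" using C[OF that] by linarith+
    then have "\<delta> * (N g - C) \<le> \<delta> * \<sigma> g y" "\<delta> * \<sigma> g y \<le> \<delta> * (N g + C)" using \<delta>_nonneg by (auto intro: mult_left_mono)
    then show "exp (- \<delta> * C) * exp (- \<delta> * N g) \<le> exp (- \<delta> * \<sigma> g y)" "exp (- \<delta> * \<sigma> g y) \<le> exp (\<delta> * C) * exp (- \<delta> * N g)"
      by (auto simp: exp_add[symmetric] algebra_simps)
  qed
  have "(\<integral>\<^sup>+y. ennreal (exp (- \<delta> * C) * exp (- \<delta> * N g)) * indicator A y \<partial>\<nu>) \<le> emeasure \<nu> (g ` A)"
    unfolding emeasure_image[OF g A] using b by (intro nn_integral_mono) (auto simp: indicator_def intro!: ennreal_leI)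
  then have "ennreal (exp (- \<delta> * C) * exp (- \<delta> * N g) * nu.prob A) \<le> ennreal (nu.prob (g ` A))"
    using A by (simp add: nn_integral_cmult_indicator nu.emeasure_eq_measure ennreal_mult'')
  then show "exp (- \<delta> * C) * exp (- \<delta> * N g) * nu.prob A \<le> nu.prob (g ` A)" by simp
  have "emeasure \<nu> (g ` A) \<le> (\<integral>\<^sup>+y. ennreal (exp (\<delta> * C) * exp (- \<delta> * N g)) * indicator A y \<partial>\<nu>)"
    unfolding emeasure_image[OF g A] using b by (intro nn_integral_mono) (auto simp: indicator_def intro!: ennreal_leI)
  then have "ennreal (nu.prob (g ` A)) \<le> ennreal (exp (\<delta> * C) * exp (- \<delta> * N g) * nu.prob A)"
    using A by (simp add: nn_integral_cmult_indicator nu.emeasure_eq_measure ennreal_mult'')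
  then show "nu.prob (g ` A) \<le> exp (\<delta> * C) * exp (- \<delta> * N g) * nu.prob A" by simp
qed

text \<open>If \<open>b\<close> carried all the mass, quasi-invariance would give the same for
  \<open>g b\<close>; for \<open>g b \<noteq> b\<close> the two null complements cover the
  space.\<close>

lemma not_point_mass: "nu.prob (- {b}) > 0"
proof (rule ccontr)
  assume "\<not> ?thesis"
  then have "nu.prob (- {b}) = 0" by (simp add: not_less measure_le_0_iff)
  then have 0: "emeasure \<nu> (- {b}) = 0" by (simp add: nu.emeasure_eq_measure)
  obtain g where g: "g \<in> \<Gamma>" "g b \<noteq> b" using no_global_fixed_point by auto
  have "emeasure \<nu> (g ` (- {b})) = (\<integral>\<^sup>+y. ennreal (exp (- \<delta> * \<sigma> g y)) * indicator (- {b}) y \<partial>\<nu>)"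
    using g by (intro emeasure_image) auto
  also have "\<dots> = 0"
  proof -
    have "- {b} \<in> null_sets \<nu>" using 0 by auto
    then have "AE y in \<nu>. y \<notin> - {b}" by (rule AE_not_in)
    then have "AE y in \<nu>. ennreal (exp (- \<delta> * \<sigma> g y)) * indicator (- {b}) y = 0" by eventually_elim auto
    then show ?thesis using nn_integral_cong_AE by fastforce
  qed
  finally have 1: "emeasure \<nu> (- {g b}) = 0" using bij[OF g(1)] by (simp add: bij_image_Compl_eq)
  have "UNIV = - {b} \<union> - {g b}" using g by auto
  then have "emeasure \<nu> UNIV \<le> emeasure \<nu> (- {b}) + emeasure \<nu> (- {g b})"
    by (metis emeasure_subadditive sets_\<nu> borel_closed borel_comp closed_singleton)
  then show False using 0 1 nu.emeasure_space_1 by simp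
qed

text \<open>Elements tending to \<open>l\<close> map the complement of a ball about their repelling
  limit \<open>b\<close> into the given ball. Some such complement has positive mass by
  \<open>not_point_mass\<close>, and \<sigma> differs from the magnitude by a bounded amount there,
  so its image has positive mass as well.\<close>

lemma ball_pos:
  assumes l: "l \<in> limit_set \<Gamma>" and r: "r > 0"
  shows "nu.prob {y. d (Inr y) (Inr l) < r} > 0"
proof -
  obtain g b where gG: "\<forall>n. g n \<in> \<Gamma>" and A: "cv (\<lambda>n. Inl (g n)) (Inr l)"
    and B: "cv (\<lambda>n. Inl (inv (g n))) (Inr b)" using limit_set_seq[OF l] by auto
  define E where "E k = {y. d (Inr y) (Inr b) > inverse (Suc k)}" for k :: nat
  have Em: "E k \<in> sets borel" for k unfolding E_def by measurable
  have "\<exists>k. nu.prob (E k) > 0"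
  proof (rule ccontr)
    assume "\<not> ?thesis"
    then have "emeasure \<nu> (E k) = 0" for k by (simp add: not_less measure_le_0_iff nu.emeasure_eq_measure)
    then have "E k \<in> null_sets \<nu>" for k using Em by auto
    then have "(\<Union>k. E k) \<in> null_sets \<nu>" by auto
    moreover have "- {b} = (\<Union>k. E k)"
    proof
      show "- {b} \<subseteq> (\<Union>k. E k)"
      proof
        fix y assume "y \<in> - {b}"
        then have "d (Inr y) (Inr b) > 0" by (subst ms.mdist_pos_eq) auto
        from reals_Archimedean[OF this] show "y \<in> (\<Union>k. E k)" by (auto simp: E_def)
      qed
      show "(\<Union>k. E k) \<subseteq> - {b}" by (auto simp: E_def)
    qed
    ultimately have "emeasure \<nu> (- {b}) = 0" by auto
    then show False using not_point_mass[of b] by (simp add: nu.emeasure_eq_measure)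
  qed
  then obtain k where k: "nu.prob (E k) > 0" by auto
  define e where "e = min (inverse (Suc k) / 2) (r / 2)"
  have e: "e > 0" using r by (simp add: e_def)
  obtain F where F: "finite F" "\<forall>g\<in>\<Gamma> - F. \<forall>p\<in>X. d p (Inl (inv g)) > e \<longrightarrow> d (act g p) (Inl g) < e" using contraction[OF e] by auto
  from eventually_conj[OF cv_notin[OF A F(1)] eventually_conj[OF cv_D[OF A e] cv_D[OF B e]]]
  obtain n where n: "g n \<notin> F" "d (Inl (g n)) (Inr l) < e" "d (Inl (inv (g n))) (Inr b) < e" by (auto simp: eventually_sequentially)
  have far: "d (Inr y) (Inl (inv (g n))) > e" if "y \<in> E k" for y
  proof -
    have "d (Inr y) (Inr b) \<le> d (Inr y) (Inl (inv (g n))) + d (Inl (inv (g n))) (Inr b)" using gG by (intro ms.triangle) auto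
    moreover have "2 * e \<le> inverse (Suc k)" by (simp add: e_def)
    ultimately show ?thesis using that n(3) by (simp add: E_def)
  qed
  obtain C where C: "\<forall>g\<in>\<Gamma>. \<forall>x. d (Inr x) (Inl (inv g)) > e \<longrightarrow> \<bar>\<sigma> g x - N g\<bar> \<le> C" using mag[OF e] by auto
  have "exp (- \<delta> * C) * exp (- \<delta> * N (g n)) * nu.prob (E k) \<le> nu.prob (g n ` E k)"
    using far C gG Em by (intro image_bounds(1)) auto
  moreover have "0 < exp (- \<delta> * C) * exp (- \<delta> * N (g n)) * nu.prob (E k)" using k by simp
  ultimately have "nu.prob (g n ` E k) > 0" by linarith
  also have "nu.prob (g n ` E k) \<le> nu.prob {y. d (Inr y) (Inr l) < r}"
  proof (rule nu.finite_measure_mono)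
    show "g n ` E k \<subseteq> {y. d (Inr y) (Inr l) < r}"
    proof clarify
      fix y assume "y \<in> E k"
      then have "d (Inr (g n y)) (Inl (g n)) < e" using bspec[OF bspec[OF F(2), of "g n"], of "Inr y"] far gG n(1) by simp
      moreover have "d (Inr (g n y)) (Inr l) \<le> d (Inr (g n y)) (Inl (g n)) + d (Inl (g n)) (Inr l)" using gG by (intro ms.triangle) auto
      moreover have "2 * e \<le> r" by (simp add: e_def)
      ultimately show "d (Inr (g n y)) (Inr l) < r" using n(2) by linarith
    qed
    show "{y. d (Inr y) (Inr l) < r} \<in> nu.events" by measurable
  qed
  finally show ?thesis .
qed

text \<open>Rules out the degenerate case left at the end of \<open>double_ergodic\<close>.\<close>

lemma compl_pair_pos: "nu.prob (- {p, q}) > 0"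
proof -
  obtain z where z: "z \<noteq> p" "z \<noteq> q" "z \<in> limit_set \<Gamma>" using three_points by auto
  define r where "r = min (d (Inr p) (Inr z)) (d (Inr q) (Inr z))"
  have "r > 0" unfolding r_def using z by (auto simp: ms.mdist_pos_eq)
  then have "0 < nu.prob {y. d (Inr y) (Inr z) < r}" using ball_pos z by blast
  also have "\<dots> \<le> nu.prob (- {p, q})" by (rule nu.finite_measure_mono) (auto simp: r_def)
  finally show ?thesis .
qed

text \<open>A lower bound, uniform in \<open>g\<close>, for the mass of the set that
  \<open>g\<close> maps onto its shadow.\<close>

lemma far_pos: "\<exists>r c. r > 0 \<and> c > 0 \<and> (\<forall>p\<in>X. nu.prob {y. d (Inr y) p > r} \<ge> c)"
proof -
  obtain z1 z2 c where z: "z1 \<in> limit_set \<Gamma>" "z2 \<in> limit_set \<Gamma>" and c: "c > 0" "\<forall>p\<in>X. d (Inr z1) p > c \<or> d (Inr z2) p > c"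
    using separated_point by auto
  define c1 where "c1 = min (nu.prob {y. d (Inr y) (Inr z1) < c/2}) (nu.prob {y. d (Inr y) (Inr z2) < c/2})"
  have "c1 > 0" unfolding c1_def using ball_pos[OF z(1), of "c/2"] ball_pos[OF z(2), of "c/2"] c(1) by simp
  moreover have "nu.prob {y. d (Inr y) p > c/2} \<ge> c1" if p: "p \<in> X" for p
  proof -
    have *: "nu.prob {y. d (Inr y) (Inr z) < c/2} \<le> nu.prob {y. d (Inr y) p > c/2}" if "d (Inr z) p > c" for z
    proof (rule nu.finite_measure_mono)
      show "{y. d (Inr y) (Inr z) < c/2} \<subseteq> {y. d (Inr y) p > c/2}"
      proof clarify
        fix y assume "d (Inr y) (Inr z) < c/2"
        moreover have "d (Inr z) p \<le> d (Inr z) (Inr y) + d (Inr y) p" using p by (intro ms.triangle) auto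
        ultimately show "c/2 < d (Inr y) p" using that ms.commute[of "Inr z" "Inr y"] by linarith
      qed
      show "{y. d (Inr y) p > c/2} \<in> nu.events" using p by measurable
    qed
    from c(2) p have "d (Inr z1) p > c \<or> d (Inr z2) p > c" by blast
    then show ?thesis using * unfolding c1_def by (auto intro: min.coboundedI1 min.coboundedI2)
  qed
  ultimately show ?thesis using c(1) by (intro exI[of _ "c/2"] exI[of _ c1]) auto
qed

end

section \<open>Shadows and their second moment\<close>

context GPS
begin

text \<open>The analogue of the set of endpoints of geodesic rays from a base point that pass near
  the orbit point of \<open>g\<close>. A smaller \<open>r\<close> gives a larger shadow.\<close>

definition shadow :: "real \<Rightarrow> ('m \<Rightarrow> 'm) \<Rightarrow> 'm set" where
  "shadow r g = {y. d (Inr (inv g y)) (Inl (inv g)) > r}"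

lemma shadow_image: "g \<in> \<Gamma> \<Longrightarrow> shadow r g = g ` {z. d (Inr z) (Inl (inv g)) > r}"
  unfolding shadow_def by (force intro: image_eqI[of _ g "inv g _"])

text \<open>For \<open>y\<close> in both shadows put \<open>f = inv g \<circ> h\<close>,
  \<open>z = inv h y\<close> and \<open>w = inv g y = f z\<close>. The cocycle identity gives
  \<open>\<sigma> f z = N h - N g\<close> up to a constant, so it is enough that \<open>z\<close> is
  far from \<open>inv f\<close>. If \<open>w\<close> were far from \<open>f\<close>, the order of
  the magnitudes would bound \<open>N (inv f)\<close> and leave finitely many \<open>f\<close>.
  Otherwise \<open>f\<close> is far from \<open>inv g\<close>, hence \<open>inv f\<close> sends
  \<open>inv g\<close> close to \<open>inv f\<close>; this image is \<open>inv h\<close>, from which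
  \<open>z\<close> is far.\<close>

lemma shadow_additive:
  assumes r: "r > 0"
  shows "\<exists>C. \<forall>g\<in>\<Gamma>. \<forall>h\<in>\<Gamma>. shadow r g \<inter> shadow r h \<noteq> {} \<and> N g \<le> N h \<longrightarrow> \<bar>N h - N g - N (inv g \<circ> h)\<bar> \<le> C"
proof -
  define e where "e = r / 3"
  have e: "e > 0" using r by (simp add: e_def)
  obtain F where F: "finite F" "\<forall>g\<in>\<Gamma> - F.
    (\<forall>p\<in>X. d p (Inl (inv g)) > e \<longrightarrow> d (act g p) (Inl g) < e) \<and>
    (\<forall>p\<in>X. d p (Inl g) > e \<longrightarrow> d (act (inv g) p) (Inl (inv g)) < e)" using contraction2[OF e] by auto
  obtain C1 where C1: "C1 > 0" "\<forall>g\<in>\<Gamma>. \<forall>x. d (Inr x) (Inl (inv g)) > e \<longrightarrow> \<bar>\<sigma> g x - N g\<bar> \<le> C1" using mag[OF e] by auto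
  \<comment> \<open>\<open>3 * C1\<close> collects one magnitude error each for \<open>g\<close>,
    \<open>h\<close> and \<open>inv f\<close>. The other part of \<open>F2\<close> consists of the
    elements to which the contraction does not apply.\<close>
  define F2 where "F2 = (F \<inter> \<Gamma>) \<union> inv ` {f \<in> \<Gamma>. N f \<le> 3 * C1}"
  have F2: "finite F2" "F2 \<subseteq> \<Gamma>" using F(1) finite_N by (auto simp: F2_def)
  have "\<exists>B. \<forall>f\<in>F2. \<forall>x. \<bar>\<sigma> f x - N f\<bar> \<le> B"
  proof (rule finite_uniform_bound[OF F2(1)])
    fix f assume "f \<in> F2"
    then have "continuous_on UNIV (\<lambda>x. \<sigma> f x - N f)" using F2(2) by (intro continuous_intros cont_\<sigma>) auto
    then show "\<exists>B. \<forall>x. \<bar>\<sigma> f x - N f\<bar> \<le> B" by (rule cont_bounded)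
  qed
  then obtain C2 where C2: "\<forall>f\<in>F2. \<forall>x. \<bar>\<sigma> f x - N f\<bar> \<le> C2" by auto
  have main: "\<bar>N h - N g - N (inv g \<circ> h)\<bar> \<le> 3 * C1 + \<bar>C2\<bar>" if g: "g \<in> \<Gamma>" and h: "h \<in> \<Gamma>" and y: "y \<in> shadow r g" "y \<in> shadow r h" and le: "N g \<le> N h" for g h y
  proof -
    define f z w where "f = inv g \<circ> h" and "z = inv h y" and "w = inv g y"
    have fG: "f \<in> \<Gamma>" using g h by (simp add: f_def)
    have fz: "f z = w" using h by (simp add: f_def z_def w_def)
    have dz: "d (Inr z) (Inl (inv h)) > r" and dw: "d (Inr w) (Inl (inv g)) > r" using y by (auto simp: shadow_def z_def w_def)
    have "r > e" using e by (simp add: e_def)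
    then have "\<bar>\<sigma> h z - N h\<bar> \<le> C1" "\<bar>\<sigma> g w - N g\<bar> \<le> C1" using C1(2) g h dz dw by (auto dest!: bspec)
    moreover have hf: "h = g \<circ> f" using g by (simp add: f_def o_assoc)
    then have "\<sigma> h z = \<sigma> g w + \<sigma> f z" using cocycle[OF g fG, of z] fz by simp
    ultimately have sf: "\<bar>\<sigma> f z - (N h - N g)\<bar> \<le> 2 * C1" by linarith
    have "\<bar>\<sigma> f z - N f\<bar> \<le> C1 + \<bar>C2\<bar>"
    proof (cases "f \<in> F2")
      case True
      then have "\<bar>\<sigma> f z - N f\<bar> \<le> C2" using C2 by blast
      then show ?thesis using C1 by linarith
    next
      case False
      then have fF: "f \<in> \<Gamma> - F" using fG by (auto simp: F2_def)
      have "d (Inr w) (Inl f) \<le> e"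
      proof (rule ccontr)
        assume "\<not> ?thesis"
        then have "\<bar>\<sigma> (inv f) w - N (inv f)\<bar> \<le> C1" using C1(2) fG by (auto dest: bspec[of _ _ "inv f"])
        moreover have "\<sigma> (inv f) w = - \<sigma> f z" using cocycle_inv[OF fG, of z] fz by simp
        ultimately have "N (inv f) \<le> 3 * C1" using sf le by linarith
        then have "inv f \<in> {f \<in> \<Gamma>. N f \<le> 3 * C1}" using fG by simp
        then have "inv (inv f) \<in> F2" unfolding F2_def by blast
        then show False using False fG by simp
      qed
      moreover have "d (Inr w) (Inl (inv g)) \<le> d (Inr w) (Inl f) + d (Inl f) (Inl (inv g))" using fG g by (intro ms.triangle) auto
      ultimately have "d (Inl (inv g)) (Inl f) > e" using dw e ms.commute[of "Inl f" "Inl (inv g)"] unfolding e_def by linarith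
      then have "d (act (inv f) (Inl (inv g))) (Inl (inv f)) < e" using bspec[OF F(2) fF] g by (auto dest: bspec[of X _ "Inl (inv g)"])
      moreover have "inv f \<circ> inv g = inv h" using hf inv_o[OF g fG] by simp
      ultimately have "d (Inl (inv h)) (Inl (inv f)) < e" by simp
      moreover have "d (Inr z) (Inl (inv h)) \<le> d (Inr z) (Inl (inv f)) + d (Inl (inv f)) (Inl (inv h))" using fG h by (intro ms.triangle) auto
      ultimately have "d (Inr z) (Inl (inv f)) > e" using dz e ms.commute[of "Inl (inv f)" "Inl (inv h)"] unfolding e_def by linarith
      then have "\<bar>\<sigma> f z - N f\<bar> \<le> C1" using C1(2) fG by blast
      then show ?thesis by linarith
    qed
    then show ?thesis using sf unfolding f_def by linarith
  qed
  show ?thesis by (intro exI[of _ "3 * C1 + \<bar>C2\<bar>"] ballI impI) (use main in blast)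
qed

end

context GPS_conformal
begin

lemma shadow_borel: "g \<in> \<Gamma> \<Longrightarrow> shadow r g \<in> sets borel"
  unfolding shadow_image by (intro image_borel) auto

lemma mult_left_inj: "g \<in> \<Gamma> \<Longrightarrow> inj_on (\<lambda>h. g \<circ> h) \<Gamma>"
proof (rule inj_onI)
  fix x y assume g: "g \<in> \<Gamma>" and "g \<circ> x = g \<circ> y"
  then have "inv g \<circ> g \<circ> x = inv g \<circ> g \<circ> y" by (simp only: o_assoc[symmetric])
  then show "x = y" using g by simp
qed

text \<open>The mass of the shadow of \<open>g\<close> is comparable to
  \<open>exp (- \<delta> * N g)\<close>, so the expected number of shadows with
  \<open>N g \<le> T\<close> is comparable to \<open>A T\<close>, which diverges. In the second
  moment, only \<open>h\<close> with \<open>N g \<le> N h\<close> have to be summed. Substituting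
  \<open>h = g \<circ> f\<close> and using almost additivity bounds the sum over \<open>h\<close> by
  \<open>exp (- \<delta> * N g)\<close> times \<open>A\<close> at a slightly larger argument, up to
  a constant factor.\<close>

lemma not_AE_finite_shadows: "\<exists>r>0. \<not> (AE y in \<nu>. finite {g\<in>\<Gamma>. y \<in> shadow r g})"
proof -
  obtain r c where r: "r > 0" and c: "c > 0" "\<forall>p\<in>X. nu.prob {y. d (Inr y) p > r} \<ge> c" using far_pos by auto
  obtain C0 where C0: "C0 > 0" "\<forall>g\<in>\<Gamma>. \<forall>x. d (Inr x) (Inl (inv g)) > r \<longrightarrow> \<bar>\<sigma> g x - N g\<bar> \<le> C0" using mag[OF r] by auto
  obtain Ca where Ca: "\<forall>g\<in>\<Gamma>. \<forall>h\<in>\<Gamma>. shadow r g \<inter> shadow r h \<noteq> {} \<and> N g \<le> N h \<longrightarrow> \<bar>N h - N g - N (inv g \<circ> h)\<bar> \<le> Ca"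
    using shadow_additive[OF r] by auto
  define C where "C = \<bar>Ca\<bar>"
  have C: "\<bar>N h - N g - N (inv g \<circ> h)\<bar> \<le> C" if "g \<in> \<Gamma>" "h \<in> \<Gamma>" "y \<in> shadow r g" "y \<in> shadow r h" "N g \<le> N h" for g h y
  proof -
    have "shadow r g \<inter> shadow r h \<noteq> {}" using that by auto
    then have "\<bar>N h - N g - N (inv g \<circ> h)\<bar> \<le> Ca" using Ca that by blast
    then show ?thesis by (simp add: C_def)
  qed
  define S where "S = shadow r"
  define U where "U = exp (\<delta> * C0)"
  define L where "L = exp (- \<delta> * C0) * c"
  have L: "L > 0" using c by (simp add: L_def)
  have Sm: "S g \<in> sets borel" if "g \<in> \<Gamma>" for g unfolding S_def by (rule shadow_borel[OF that])
  have up: "nu.prob (S g) \<le> U * exp (- \<delta> * N g)" and lo: "L * exp (- \<delta> * N g) \<le> nu.prob (S g)" if g: "g \<in> \<Gamma>" for g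
  proof -
    let ?A = "{z. d (Inr z) (Inl (inv g)) > r}"
    have [measurable]: "(\<lambda>z. d (Inr z) (Inl (inv g))) \<in> borel_measurable borel" using g by (intro dist_meas) simp
    have A: "?A \<in> sets borel" by measurable
    have b: "exp (- \<delta> * C0) * exp (- \<delta> * N g) * nu.prob ?A \<le> nu.prob (g ` ?A)"
      "nu.prob (g ` ?A) \<le> exp (\<delta> * C0) * exp (- \<delta> * N g) * nu.prob ?A"
      using C0(2) g by (intro image_bounds A; auto)+
    have "exp (\<delta> * C0) * exp (- \<delta> * N g) * nu.prob ?A \<le> exp (\<delta> * C0) * exp (- \<delta> * N g) * 1"
      by (intro mult_left_mono) auto
    then show "nu.prob (S g) \<le> U * exp (- \<delta> * N g)" using order_trans[OF b(2)] by (simp add: S_def shadow_image[OF g] U_def)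
    have "exp (- \<delta> * C0) * exp (- \<delta> * N g) * c \<le> exp (- \<delta> * C0) * exp (- \<delta> * N g) * nu.prob ?A"
      using c(2) g by (intro mult_left_mono) auto
    from order_trans[OF this b(1)] show "L * exp (- \<delta> * N g) \<le> nu.prob (S g)" by (simp add: S_def shadow_image[OF g] L_def mult_ac)
  qed
  define FT where "FT T = {g \<in> \<Gamma>. N g \<le> T}" for T
  have FT: "finite (FT T)" "FT T \<subseteq> \<Gamma>" for T using finite_N by (auto simp: FT_def)
  define A where "A T = (\<Sum>g\<in>FT T. exp (- \<delta> * N g))" for T
  have Amono: "A T \<le> A T'" if "T \<le> T'" for T T'
    unfolding A_def using that by (intro sum_mono2 FT) (auto simp: FT_def)
  have A0: "A T \<ge> 0" for T unfolding A_def by (intro sum_nonneg) simp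
  \<comment> \<open>Among the elements of the band whose shadows contain \<open>y\<close>, take one
    of least magnitude. Composition with its inverse sends all of them injectively into
    \<open>FT (T' + C)\<close>. So the shadows of the band overlap boundedly and their total mass is
    bounded, independently of \<open>T\<close>.\<close>
  have annulus: "A (T + T') \<le> A T + card (FT (T' + C)) / L" for T T'
  proof -
    define H where "H = FT (T + T') - FT T"
    have H: "finite H" "H \<subseteq> \<Gamma>" using FT by (auto simp: H_def)
    have mult: "(\<Sum>g\<in>H. indicator (S g) y) \<le> real (card (FT (T' + C)))" for y
    proof -
      define Hy where "Hy = {g \<in> H. y \<in> S g}"
      have "card Hy \<le> card (FT (T' + C))"
      proof (cases "Hy = {}")
        case False
        have fin: "finite Hy" using H by (simp add: Hy_def)
        then have "Min (N ` Hy) \<in> N ` Hy" using False by (intro Min_in) auto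
        then obtain g0 where g0: "g0 \<in> Hy" "N g0 = Min (N ` Hy)" by auto
        have g0G: "g0 \<in> \<Gamma>" using g0 H by (auto simp: Hy_def)
        have min: "N g0 \<le> N h" if "h \<in> Hy" for h using that fin unfolding g0(2) by (intro Min_le) auto
        show ?thesis
        proof (rule card_inj_on_le)
          show "inj_on (\<lambda>h. inv g0 \<circ> h) Hy"
            by (rule inj_on_subset[OF mult_left_inj[OF inv_in[OF g0G]]]) (use H(2) in \<open>auto simp: Hy_def\<close>)
          show "(\<lambda>h. inv g0 \<circ> h) ` Hy \<subseteq> FT (T' + C)"
          proof clarify
            fix h assume h: "h \<in> Hy"
            then have hG: "h \<in> \<Gamma>" using H by (auto simp: Hy_def)
            have "\<bar>N h - N g0 - N (inv g0 \<circ> h)\<bar> \<le> C"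
              using g0 h by (intro C[of g0 h y] g0G hG min) (auto simp: Hy_def S_def)
            moreover have "N h \<le> T + T'" "N g0 > T" using h g0 g0G by (auto simp: Hy_def H_def FT_def)
            ultimately show "inv g0 \<circ> h \<in> FT (T' + C)" using g0G hG by (auto simp: FT_def)
          qed
        qed (rule FT)
      qed simp
      moreover have "(\<Sum>g\<in>H. indicator (S g) y) = real (card Hy)"
      proof -
        have "(\<Sum>g\<in>H. indicator (S g) y) = (\<Sum>g\<in>Hy. 1 :: real)"
          unfolding Hy_def by (subst sum.inter_filter[OF H(1)]) (auto intro!: sum.cong simp: indicator_def)
        then show ?thesis by simp
      qed
      ultimately show ?thesis by simp
    qed
    have int: "integrable \<nu> (indicator (S g) :: _ \<Rightarrow> real)" if "g \<in> H" for g
      using Sm H that by (auto simp: integrable_indicator_iff nu.emeasure_eq_measure)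
    have "(\<Sum>g\<in>H. nu.prob (S g)) = nu.expectation (\<lambda>y. \<Sum>g\<in>H. indicator (S g) y)"
      using int by (subst Bochner_Integration.integral_sum) auto
    also have "\<dots> \<le> real (card (FT (T' + C)))"
      using int mult by (intro nu.integral_le_const Bochner_Integration.integrable_sum) auto
    finally have "(\<Sum>g\<in>H. nu.prob (S g)) \<le> real (card (FT (T' + C)))" .
    moreover have "L * (\<Sum>g\<in>H. exp (- \<delta> * N g)) \<le> (\<Sum>g\<in>H. nu.prob (S g))"
      unfolding sum_distrib_left using H lo by (intro sum_mono) auto
    ultimately have "(\<Sum>g\<in>H. exp (- \<delta> * N g)) \<le> card (FT (T' + C)) / L"
      using L by (simp add: field_simps)
    moreover have "A (T + T') \<le> A T + (\<Sum>g\<in>H. exp (- \<delta> * N g))"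
    proof -
      have "A (T + T') \<le> (\<Sum>g\<in>FT T \<union> H. exp (- \<delta> * N g))"
        unfolding A_def using FT H by (intro sum_mono2) (auto simp: H_def)
      also have "\<dots> = A T + (\<Sum>g\<in>H. exp (- \<delta> * N g))"
        unfolding A_def using FT H by (intro sum.union_disjoint) (auto simp: H_def)
      finally show ?thesis .
    qed
    ultimately show ?thesis by simp
  qed
  have "\<exists>b. \<forall>g\<in>{g\<in>\<Gamma>. N g \<le> 0}. \<forall>x::unit. - N g \<le> b"
    by (rule finite_uniform_bound[OF finite_N]) auto
  then obtain b0 where b0: "\<forall>g\<in>{g\<in>\<Gamma>. N g \<le> 0}. - N g \<le> b0" by auto
  define b where "b = \<bar>b0\<bar>"
  have b: "N g \<ge> - b" if "g \<in> \<Gamma>" for g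
  proof (cases "N g \<le> 0")
    case True
    then have "- N g \<le> b0" using b0 that by auto
    then show ?thesis by (simp add: b_def)
  qed (simp add: b_def)
  \<comment> \<open>\<open>inv g \<circ> h\<close> has magnitude at most
    \<open>N h - N g + C\<close>, and \<open>N g\<close> may be as low as \<open>- b\<close>, so the
    argument of \<open>A\<close> grows by at most \<open>C + b\<close>.\<close>
  define R where "R = card (FT (C + b + C)) / L"
  have R: "R \<ge> 0" using L by (simp add: R_def)
  have row: "(\<Sum>h\<in>FT T. if N g \<le> N h then nu.prob (S g \<inter> S h) else 0) \<le> U * exp (\<delta> * C) * exp (- \<delta> * N g) * (A T + R)"
    if g: "g \<in> FT T" for g T
  proof -
    have gG: "g \<in> \<Gamma>" using g FT by auto
    define F' where "F' = {h \<in> FT T. N g \<le> N h \<and> S g \<inter> S h \<noteq> {}}"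
    have F': "finite F'" "F' \<subseteq> \<Gamma>" using FT by (auto simp: F'_def)
    have "(\<Sum>h\<in>FT T. if N g \<le> N h then nu.prob (S g \<inter> S h) else 0) = (\<Sum>h\<in>F'. nu.prob (S g \<inter> S h))"
      unfolding F'_def by (subst sum.inter_filter[OF FT(1)]) (auto intro!: sum.cong)
    also have "\<dots> \<le> (\<Sum>h\<in>F'. U * exp (\<delta> * C) * exp (- \<delta> * N g) * exp (- \<delta> * N (inv g \<circ> h)))"
    proof (rule sum_mono)
      fix h assume h: "h \<in> F'"
      then have hG: "h \<in> \<Gamma>" using F' by auto
      obtain y where y: "y \<in> S g" "y \<in> S h" using h by (auto simp: F'_def)
      have "\<bar>N h - N g - N (inv g \<circ> h)\<bar> \<le> C" using y h by (intro C[OF gG hG]) (auto simp: S_def F'_def)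
      then have "N g + N (inv g \<circ> h) - C \<le> N h" by linarith
      then have "\<delta> * (N g + N (inv g \<circ> h) - C) \<le> \<delta> * N h" using \<delta>_nonneg by (rule mult_left_mono)
      then have "exp (- \<delta> * N h) \<le> exp (\<delta> * C) * exp (- \<delta> * N g) * exp (- \<delta> * N (inv g \<circ> h))"
        by (simp add: exp_add[symmetric] algebra_simps)
      then have "U * exp (- \<delta> * N h) \<le> U * (exp (\<delta> * C) * exp (- \<delta> * N g) * exp (- \<delta> * N (inv g \<circ> h)))"
        by (intro mult_left_mono) (auto simp: U_def)
      moreover have "nu.prob (S g \<inter> S h) \<le> nu.prob (S h)" using Sm[OF hG] by (intro nu.finite_measure_mono) auto
      ultimately show "nu.prob (S g \<inter> S h) \<le> U * exp (\<delta> * C) * exp (- \<delta> * N g) * exp (- \<delta> * N (inv g \<circ> h))"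
        using up[OF hG] by (simp add: mult_ac)
    qed
    also have "\<dots> = U * exp (\<delta> * C) * exp (- \<delta> * N g) * (\<Sum>h\<in>F'. exp (- \<delta> * N (inv g \<circ> h)))" by (simp add: sum_distrib_left)
    also have "(\<Sum>h\<in>F'. exp (- \<delta> * N (inv g \<circ> h))) = (\<Sum>f\<in>(\<lambda>h. inv g \<circ> h) ` F'. exp (- \<delta> * N f))"
      using inj_on_subset[OF mult_left_inj[OF inv_in[OF gG]] F'(2)] by (simp add: sum.reindex o_def)
    also have "\<dots> \<le> A (T + (C + b))"
      unfolding A_def
    proof (rule sum_mono2[OF FT(1)])
      show "(\<lambda>h. inv g \<circ> h) ` F' \<subseteq> FT (T + (C + b))"
      proof clarify
        fix h assume h: "h \<in> F'"
        then have hG: "h \<in> \<Gamma>" using F' by auto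
        obtain y where y: "y \<in> S g" "y \<in> S h" using h by (auto simp: F'_def)
        have "\<bar>N h - N g - N (inv g \<circ> h)\<bar> \<le> C" using y h by (intro C[OF gG hG]) (auto simp: S_def F'_def)
        moreover have "N h \<le> T" using h by (auto simp: F'_def FT_def)
        ultimately show "inv g \<circ> h \<in> FT (T + (C + b))" using b[OF gG] gG hG by (auto simp: FT_def)
      qed
    qed auto
    also have "\<dots> \<le> A T + R" unfolding R_def using annulus[of T "C + b"] .
    finally show ?thesis by (simp add: U_def mult_left_mono)
  qed
  have unbounded: "\<exists>n::nat. A n > B" for B
  proof (rule ccontr)
    assume "\<not> ?thesis"
    then have AB: "A (real n) \<le> B" for n by (simp add: not_less)
    have "poincare_series \<Gamma> N \<delta> \<le> ennreal B"
      unfolding poincare_series_def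
    proof (subst nonneg_infsum_complete, simp, rule SUP_least)
      fix F assume "F \<in> {F. finite F \<and> F \<subseteq> \<Gamma>}"
      then have F: "finite F" "F \<subseteq> \<Gamma>" by auto
      obtain n :: nat where n: "\<forall>g\<in>F. N g \<le> real n"
      proof -
        have "\<exists>B. \<forall>g\<in>F. \<forall>x::unit. N g \<le> B" by (rule finite_uniform_bound[OF F(1)]) auto
        then obtain B where "\<forall>g\<in>F. N g \<le> B" by auto
        moreover obtain n :: nat where "B \<le> real n" using real_arch_simple by auto
        ultimately show ?thesis by (intro that[of n]) force
      qed
      have "(\<Sum>g\<in>F. ennreal (exp (- \<delta> * N g))) = ennreal (\<Sum>g\<in>F. exp (- \<delta> * N g))" by (simp add: sum_ennreal)
      also have "\<dots> \<le> ennreal (A n)" unfolding A_def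
        using F n by (intro ennreal_leI sum_mono2 FT) (auto simp: FT_def)
      also have "\<dots> \<le> ennreal B" using AB by (rule ennreal_leI)
      finally show "(\<Sum>g\<in>F. ennreal (exp (- \<delta> * N g))) \<le> ennreal B" .
    qed
    then show False using divergent by (simp add: top_unique)
  qed
  \<comment> \<open>Starting where \<open>A\<close> exceeds 1 lets the additive error
    \<open>R\<close> be absorbed into a factor \<open>1 + R\<close>.\<close>
  obtain n0 :: nat where n0: "A n0 > 1" using unbounded by blast
  define F where "F n = FT (real (n + n0))" for n
  have A1: "A (real (n + n0)) \<ge> 1" for n using n0 Amono[of "real n0" "real (n + n0)"] by simp
  have aA: "L * A (real (n + n0)) \<le> (\<Sum>g\<in>F n. nu.prob (S g))" for n
    unfolding A_def F_def sum_distrib_left using FT lo by (intro sum_mono) auto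
  have "\<not> (AE y in \<nu>. finite {g\<in>\<Gamma>. y \<in> S g})"
  proof (rule nu.second_moment_not_AE_finite[where F = F])
    show "filterlim (\<lambda>n. \<Sum>g\<in>F n. nu.prob (S g)) at_top sequentially"
      unfolding filterlim_at_top
    proof
      fix B
      obtain n1 :: nat where n1: "A n1 > B / L" using unbounded by blast
      have "B \<le> (\<Sum>g\<in>F n. nu.prob (S g))" if "n \<ge> n1" for n
      proof -
        have "B \<le> L * A n1" using n1 L by (simp add: field_simps)
        also have "\<dots> \<le> L * A (real (n + n0))" using that L by (intro mult_left_mono Amono) auto
        finally show ?thesis using aA[of n] by simp
      qed
      then show "\<forall>\<^sub>F n in sequentially. B \<le> (\<Sum>g\<in>F n. nu.prob (S g))" unfolding eventually_sequentially by blast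
    qed
    fix n
    let ?T = "real (n + n0)"
    \<comment> \<open>Each pair is ordered by magnitude; pairs of equal magnitude are counted twice,
      which is harmless for an upper bound.\<close>
    let ?q = "\<lambda>g h. if N g \<le> N h then nu.prob (S g \<inter> S h) else 0"
    have "(\<Sum>g\<in>F n. \<Sum>h\<in>F n. nu.prob (S g \<inter> S h)) \<le> (\<Sum>g\<in>F n. \<Sum>h\<in>F n. ?q g h + ?q h g)"
      by (intro sum_mono) (auto simp: Int_commute)
    also have "\<dots> = (\<Sum>g\<in>F n. \<Sum>h\<in>F n. ?q g h) + (\<Sum>g\<in>F n. \<Sum>h\<in>F n. ?q h g)" by (simp only: sum.distrib)
    also have "(\<Sum>g\<in>F n. \<Sum>h\<in>F n. ?q h g) = (\<Sum>g\<in>F n. \<Sum>h\<in>F n. ?q g h)" by (rule sum.swap)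
    also have "(\<Sum>g\<in>F n. \<Sum>h\<in>F n. ?q g h) + (\<Sum>g\<in>F n. \<Sum>h\<in>F n. ?q g h) = 2 * (\<Sum>g\<in>F n. \<Sum>h\<in>F n. ?q g h)" by simp
    also have "\<dots> \<le> 2 * (\<Sum>g\<in>F n. U * exp (\<delta> * C) * exp (- \<delta> * N g) * (A ?T + R))"
      using row[of _ ?T] by (intro mult_left_mono sum_mono) (auto simp: F_def)
    also have "\<dots> = 2 * U * exp (\<delta> * C) * (A ?T * (A ?T + R))"
      unfolding A_def F_def by (simp add: sum_distrib_left sum_distrib_right mult_ac)
    also have "\<dots> \<le> 2 * U * exp (\<delta> * C) * (A ?T * (A ?T * (1 + R)))"
    proof -
      have "A ?T + R \<le> A ?T * (1 + R)" using A1[of n] R mult_right_mono[of 1 "A ?T" R] by (simp add: algebra_simps)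
      then show ?thesis using A0[of ?T] by (intro mult_left_mono) (auto simp: U_def)
    qed
    also have "\<dots> = 2 * U * exp (\<delta> * C) * (1 + R) / L\<^sup>2 * (L * A ?T)\<^sup>2" using L by (simp add: field_simps power2_eq_square)
    also have "\<dots> \<le> 2 * U * exp (\<delta> * C) * (1 + R) / L\<^sup>2 * (\<Sum>g\<in>F n. nu.prob (S g))\<^sup>2"
      using aA[of n] L A0[of ?T] R by (intro mult_left_mono power_mono) (auto simp: U_def)
    finally show "(\<Sum>g\<in>F n. \<Sum>h\<in>F n. nu.prob (S g \<inter> S h)) \<le> 2 * U * exp (\<delta> * C) * (1 + R) / L\<^sup>2 * (\<Sum>g\<in>F n. nu.prob (S g))\<^sup>2" .
  qed (use Sm FT F_def in auto)
  then show ?thesis using r by (auto simp: S_def)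
qed

end

section \<open>Conical points\<close>

context GPS
begin

text \<open>The sizes are restricted to a sequence to make the set a countable union;
  \<open>conicalI\<close> recovers all positive sizes.\<close>

definition conical :: "'m \<Rightarrow> bool" where
  "conical y \<longleftrightarrow> (\<exists>k::nat. infinite {g\<in>\<Gamma>. y \<in> shadow (inverse (Suc k)) g})"

lemma conicalI:
  assumes "r > 0" "infinite {g\<in>\<Gamma>. y \<in> shadow r g}"
  shows "conical y"
proof -
  obtain k where k: "inverse (Suc k) < r" using reals_Archimedean[OF assms(1)] by auto
  have "{g\<in>\<Gamma>. y \<in> shadow r g} \<subseteq> {g\<in>\<Gamma>. y \<in> shadow (inverse (Suc k)) g}" using k by (auto simp: shadow_def)
  then show ?thesis unfolding conical_def using assms(2) infinite_super by blast
qed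

text \<open>For all but finitely many \<open>g\<close>, the element
  \<open>inv (\<eta> \<circ> g)\<close>, which is the image of \<open>inv \<eta>\<close> under
  \<open>inv g\<close>, is close to \<open>inv g\<close>. Thus shadows of size \<open>r\<close>
  containing \<open>y\<close> become shadows of size \<open>r/2\<close> containing
  \<open>\<eta> y\<close>.\<close>

lemma conical_act:
  assumes \<eta>: "\<eta> \<in> \<Gamma>" and y: "conical y"
  shows "conical (\<eta> y)"
proof -
  obtain k :: nat where k: "infinite {g\<in>\<Gamma>. y \<in> shadow (inverse (Suc k)) g}" using y by (auto simp: conical_def)
  define r where "r = inverse (real (Suc k))"
  have r: "r > 0" by (simp add: r_def)
  obtain \<rho> where \<rho>: "\<rho> > 0" "\<forall>p\<in>X. d p (Inl (inv \<eta>)) < \<rho> \<longrightarrow> p = Inl (inv \<eta>)" using isolated[OF inv_in[OF \<eta>]] by auto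
  define e where "e = min (r/2) (\<rho>/2)"
  have e: "e > 0" using r \<rho> by (simp add: e_def)
  obtain F where F: "finite F" "\<forall>g\<in>\<Gamma> - F.
    (\<forall>p\<in>X. d p (Inl (inv g)) > e \<longrightarrow> d (act g p) (Inl g) < e) \<and>
    (\<forall>p\<in>X. d p (Inl g) > e \<longrightarrow> d (act (inv g) p) (Inl (inv g)) < e)" using contraction2[OF e] by auto
  define A where "A = {g\<in>\<Gamma>. y \<in> shadow r g} - (F \<union> {inv \<eta>})"
  have "infinite A" unfolding A_def using k F(1) by (simp add: r_def)
  moreover have "inj_on (\<lambda>g. \<eta> \<circ> g) A"
  proof (rule inj_onI)
    fix x y assume "\<eta> \<circ> x = \<eta> \<circ> y"
    then have "inv \<eta> \<circ> \<eta> \<circ> x = inv \<eta> \<circ> \<eta> \<circ> y" by (simp only: o_assoc[symmetric])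
    then show "x = y" using \<eta> by simp
  qed
  ultimately have "infinite ((\<lambda>g. \<eta> \<circ> g) ` A)" by (simp add: finite_image_iff)
  moreover have "(\<lambda>g. \<eta> \<circ> g) ` A \<subseteq> {g\<in>\<Gamma>. \<eta> y \<in> shadow (r/2) g}"
  proof clarify
    fix g assume g: "g \<in> A"
    then have gG: "g \<in> \<Gamma>" and gF: "g \<in> \<Gamma> - F" and ne: "g \<noteq> inv \<eta>" and far: "d (Inr (inv g y)) (Inl (inv g)) > r"
      by (auto simp: A_def shadow_def)
    have "d (Inl g) (Inl (inv \<eta>)) \<ge> \<rho>" using bspec[OF \<rho>(2), of "Inl g"] gG ne by force
    then have "d (Inl (inv \<eta>)) (Inl g) > e" using \<rho>(1) by (simp add: e_def ms.commute)
    then have "d (act (inv g) (Inl (inv \<eta>))) (Inl (inv g)) < e"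
      using bspec[OF F(2) gF] \<eta> by (auto dest: bspec[of X _ "Inl (inv \<eta>)"])
    then have near: "d (Inl (inv (\<eta> \<circ> g))) (Inl (inv g)) < e" using inv_o[OF \<eta> gG] by simp
    have "d (Inr (inv g y)) (Inl (inv g)) \<le> d (Inr (inv g y)) (Inl (inv (\<eta> \<circ> g))) + d (Inl (inv (\<eta> \<circ> g))) (Inl (inv g))"
      using \<eta> gG by (intro ms.triangle) auto
    moreover have "e \<le> r / 2" by (simp add: e_def)
    ultimately have "d (Inr (inv g y)) (Inl (inv (\<eta> \<circ> g))) > r / 2" using near far by linarith
    then show "\<eta> \<circ> g \<in> \<Gamma> \<and> \<eta> y \<in> shadow (r/2) (\<eta> \<circ> g)"
      using \<eta> gG by (simp add: shadow_def inv_o)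
  qed
  ultimately have "infinite {g\<in>\<Gamma>. \<eta> y \<in> shadow (r/2) g}" using infinite_super by blast
  then show ?thesis using r by (intro conicalI[of "r/2"]) auto
qed

lemma conical_act_iff: "\<eta> \<in> \<Gamma> \<Longrightarrow> conical (\<eta> y) \<longleftrightarrow> conical y"
  using conical_act[of \<eta> y] conical_act[of "inv \<eta>" "\<eta> y"] by auto

text \<open>To lie in infinitely many shadows is to lie in one outside each finite subset of
  \<Gamma>, and a countable set has only countably many finite subsets.\<close>

lemma conical_borel: 
  assumes "\<And>g r. g \<in> \<Gamma> \<Longrightarrow> shadow r g \<in> sets borel"
  shows "{y. conical y} \<in> sets borel"
proof -
  have "{y. conical y} = (\<Union>k::nat. \<Inter>F\<in>{F. finite F \<and> F \<subseteq> \<Gamma>}. \<Union>g\<in>\<Gamma> - F. shadow (inverse (Suc k)) g)"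
  proof (intro set_eqI iffI)
    fix y assume "y \<in> {y. conical y}"
    then obtain k where k: "infinite {g\<in>\<Gamma>. y \<in> shadow (inverse (real (Suc k))) g}" by (auto simp: conical_def)
    have "y \<in> (\<Union>g\<in>\<Gamma> - F. shadow (inverse (real (Suc k))) g)" if "finite F" for F
    proof -
      have "infinite ({g\<in>\<Gamma>. y \<in> shadow (inverse (real (Suc k))) g} - F)" using k that by simp
      then obtain g where "g \<in> {g\<in>\<Gamma>. y \<in> shadow (inverse (real (Suc k))) g} - F" using infinite_imp_nonempty by blast
      then show ?thesis by auto
    qed
    then show "y \<in> (\<Union>k::nat. \<Inter>F\<in>{F. finite F \<and> F \<subseteq> \<Gamma>}. \<Union>g\<in>\<Gamma> - F. shadow (inverse (Suc k)) g)" by blast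
  next
    fix y assume "y \<in> (\<Union>k::nat. \<Inter>F\<in>{F. finite F \<and> F \<subseteq> \<Gamma>}. \<Union>g\<in>\<Gamma> - F. shadow (inverse (Suc k)) g)"
    then obtain k where k: "y \<in> (\<Inter>F\<in>{F. finite F \<and> F \<subseteq> \<Gamma>}. \<Union>g\<in>\<Gamma> - F. shadow (inverse (real (Suc k))) g)" by (rule UN_E)
    have "infinite {g\<in>\<Gamma>. y \<in> shadow (inverse (real (Suc k))) g}"
    proof
      assume "finite {g\<in>\<Gamma>. y \<in> shadow (inverse (real (Suc k))) g}"
      then have "y \<in> (\<Union>g\<in>\<Gamma> - {g\<in>\<Gamma>. y \<in> shadow (inverse (real (Suc k))) g}. shadow (inverse (real (Suc k))) g)"
        by (intro INT_D[OF k]) simp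
      then show False by (elim UN_E) simp
    qed
    then show "y \<in> {y. conical y}" by (auto simp: conical_def)
  qed
  also have "\<dots> \<in> sets borel"
  proof (rule sets.countable_UN'')
    fix k :: nat
    show "(\<Inter>F\<in>{F. finite F \<and> F \<subseteq> \<Gamma>}. \<Union>g\<in>\<Gamma> - F. shadow (inverse (Suc k)) g) \<in> sets borel"
    proof (rule sets.countable_INT'')
      show "countable {F. finite F \<and> F \<subseteq> \<Gamma>}" using countable by (rule countable_Collect_finite_subset)
      fix F
      show "(\<Union>g\<in>\<Gamma> - F. shadow (inverse (Suc k)) g) \<in> sets borel"
        using assms countable by (intro sets.countable_UN'') auto
    qed auto
  qed auto
  finally show ?thesis .
qed

end

context GPS_conformal
begin

text \<open>If the complement of the conical points had positive mass, the normalized restriction would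
  be another conformal measure, contradicting the second moment estimate for it.\<close>

theorem AE_conical: "AE y in \<nu>. conical y"
proof (rule ccontr)
  assume not: "\<not> ?thesis"
  define B where "B = {y. \<not> conical y}"
  have Cb: "{y. conical y} \<in> sets borel" by (rule conical_borel[OF shadow_borel])
  moreover have "B = - {y. conical y}" by (auto simp: B_def)
  ultimately have Bb: "B \<in> sets borel" using borel_comp by simp
  have B0: "emeasure \<nu> B \<noteq> 0"
  proof
    assume "emeasure \<nu> B = 0"
    then have "B \<in> null_sets \<nu>" using Bb by auto
    then have "AE y in \<nu>. y \<notin> B" by (rule AE_not_in)
    then show False using not by (simp add: B_def)
  qed
  define \<nu>2 where "\<nu>2 = uniform_measure \<nu> B"
  have "conformal_measure \<Gamma> \<sigma> \<delta> \<nu>2"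
    unfolding conformal_measure_def
  proof (intro conjI ballI)
    show "prob_space \<nu>2" unfolding \<nu>2_def using B0 by (intro prob_space_uniform_measure) auto
    show "sets \<nu>2 = sets borel" by (simp add: \<nu>2_def)
    fix g assume g: "g \<in> \<Gamma>"
    show "distr \<nu>2 borel g = density \<nu>2 (\<lambda>x. ennreal (exp (- \<delta> * \<sigma> (inv g) x)))"
    proof (rule measure_eqI)
      show "sets (distr \<nu>2 borel g) = sets (density \<nu>2 (\<lambda>x. ennreal (exp (- \<delta> * \<sigma> (inv g) x))))" by (simp add: \<nu>2_def)
      fix A assume "A \<in> sets (distr \<nu>2 borel g)"
      then have A: "A \<in> sets borel" by simp
      have gm [measurable]: "g \<in> borel_measurable borel" using meas[OF g] .
      have sm [measurable]: "\<sigma> (inv g) \<in> borel_measurable borel" using borel_measurable_continuous_onI[OF cont_\<sigma>[OF inv_in[OF g]]] .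
      have gA: "g -` A \<in> sets borel" using measurable_sets_borel[OF gm A] .
      \<comment> \<open>This equality, a consequence of the invariance of \<open>B\<close>, is what
        lets the restriction inherit the transformation law with the same cocycle.\<close>
      have inv: "B \<inter> g -` A = inv g ` (B \<inter> A)"
      proof (intro set_eqI iffI)
        fix x assume "x \<in> B \<inter> g -` A"
        then show "x \<in> inv g ` (B \<inter> A)" using g by (intro image_eqI[of _ _ "g x"]) (auto simp: B_def conical_act_iff)
      next
        fix x assume "x \<in> inv g ` (B \<inter> A)"
        then show "x \<in> B \<inter> g -` A" using g by (auto simp: B_def conical_act_iff)
      qed
      have "emeasure (distr \<nu>2 borel g) A = emeasure \<nu>2 (g -` A)"
        using A by (subst emeasure_distr) (auto simp: \<nu>2_def measurable_def gA intro: measurable_sets_borel[OF gm])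
      also have "\<dots> = emeasure \<nu> (inv g ` (B \<inter> A)) / emeasure \<nu> B"
        unfolding \<nu>2_def using gA Bb by (subst emeasure_uniform_measure) (auto simp: inv)
      also have "\<dots> = (\<integral>\<^sup>+y. ennreal (exp (- \<delta> * \<sigma> (inv g) y)) * indicator (B \<inter> A) y \<partial>\<nu>) / emeasure \<nu> B"
        using A Bb g by (subst emeasure_image) auto
      also have "\<dots> = (\<integral>\<^sup>+y. ennreal (exp (- \<delta> * \<sigma> (inv g) y)) * indicator (B \<inter> A) y / emeasure \<nu> B \<partial>\<nu>)"
        using A Bb by (subst nn_integral_divide) auto
      also have "\<dots> = (\<integral>\<^sup>+y. ennreal (exp (- \<delta> * \<sigma> (inv g) y)) * indicator A y \<partial>\<nu>2)"
        unfolding \<nu>2_def uniform_measure_def using A Bb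
        by (subst nn_integral_density) (auto intro!: nn_integral_cong simp: indicator_def divide_ennreal_def mult.commute)
      also have "\<dots> = emeasure (density \<nu>2 (\<lambda>x. ennreal (exp (- \<delta> * \<sigma> (inv g) x)))) A"
        using A by (subst emeasure_density) (auto simp: \<nu>2_def)
      finally show "emeasure (distr \<nu>2 borel g) A = emeasure (density \<nu>2 (\<lambda>x. ennreal (exp (- \<delta> * \<sigma> (inv g) x)))) A" .
    qed
  qed
  then interpret c2: GPS_conformal \<Gamma> d \<sigma> \<sigma>' G N \<delta> \<nu>2
    using \<delta>_nonneg divergent by unfold_locales
  obtain r where r: "r > 0" "\<not> (AE y in \<nu>2. finite {g\<in>\<Gamma>. y \<in> shadow r g})" using c2.not_AE_finite_shadows by auto
  have "AE y in \<nu>2. y \<in> B"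
    unfolding \<nu>2_def by (rule AE_uniform_measureI) (use Bb in auto)
  then have "AE y in \<nu>2. finite {g\<in>\<Gamma>. y \<in> shadow r g}"
    by eventually_elim (use conicalI[OF r(1)] in \<open>auto simp: B_def\<close>)
  then show False using r(2) by simp
qed

text \<open>If \<open>y\<close> lies in the shadow of \<open>g\<close>, then \<open>inv g y\<close>
  is far from \<open>inv g\<close>, so its image \<open>y\<close> under \<open>g\<close> is close to
  \<open>g\<close>.\<close>

lemma AE_limit_set: "AE y in \<nu>. y \<in> limit_set \<Gamma>"
  using AE_conical
proof eventually_elim
  case (elim y)
  then obtain k where k: "infinite {g\<in>\<Gamma>. y \<in> shadow (inverse (real (Suc k))) g}" by (auto simp: conical_def)
  define r where "r = inverse (real (Suc k))"
  show ?case unfolding limit_set_iff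
  proof (intro allI impI)
    fix e :: real assume "e > 0"
    define e' where "e' = min e r"
    have e': "e' > 0" "e' \<le> e" "e' \<le> r" using \<open>e > 0\<close> by (auto simp: e'_def r_def)
    obtain F where F: "finite F" "\<forall>g\<in>\<Gamma> - F. \<forall>p\<in>X. d p (Inl (inv g)) > e' \<longrightarrow> d (act g p) (Inl g) < e'"
      using contraction[OF e'(1)] by auto
    have "infinite ({g\<in>\<Gamma>. y \<in> shadow r g} - F)" using k F(1) by (simp add: r_def)
    then obtain g where g: "g \<in> \<Gamma> - F" "y \<in> shadow r g" using infinite_imp_nonempty by blast
    then have "d (act g (Inr (inv g y))) (Inl g) < e'"
      using bspec[OF bspec[OF F(2) g(1)], of "Inr (inv g y)"] e' by (simp add: shadow_def)
    then show "\<exists>g\<in>\<Gamma>. d (Inr y) (Inl g) < e" using g(1) e' by (intro bexI[of _ g]) auto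
  qed
qed

end

section \<open>Orbit sums and the invariant measure\<close>

text \<open>Read the indices from left to right: skip an index that is not bad, and at a bad one
  jump over a block of length at most \<open>L\<close> on which the sum of \<open>q\<close> is below
  that of \<open>p\<close>. The last block may run past \<open>n\<close>, which accounts for the
  \<open>L\<close> extra terms. No subtraction occurs, so infinite values are allowed.\<close>

lemma block_covering:
  fixes p q :: "nat \<Rightarrow> ennreal" and L n k :: nat
  defines "bad \<equiv> \<lambda>i. \<exists>m\<le>L. (\<Sum>j<m. q (i + j)) < (\<Sum>j<m. p (i + j))"
  shows "(\<Sum>i<n. if bad (k + i) then q (k + i) else 0) \<le> (\<Sum>i<n + L. p (k + i))"
proof (induction n arbitrary: k rule: less_induct)
  case (less n)
  show ?case
  proof (cases "n = 0")
    case True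
    then show ?thesis by simp
  next
    case n: False
    show ?thesis
    proof (cases "bad k")
      case False
      obtain n' where n': "n = Suc n'" using n by (cases n) auto
      have "(\<Sum>i<n. if bad (k + i) then q (k + i) else 0) = (\<Sum>i<n'. if bad (Suc k + i) then q (Suc k + i) else 0)"
        unfolding n' by (subst sum.lessThan_Suc_shift) (auto simp: False intro!: sum.cong)
      also have "\<dots> \<le> (\<Sum>i<n' + L. p (Suc k + i))" by (rule less) (simp add: n')
      also have "\<dots> \<le> (\<Sum>i<n + L. p (k + i))"
        unfolding n' add_Suc by (subst sum.lessThan_Suc_shift) simp
      finally show ?thesis .
    next
      case True
      then obtain m where m: "m \<le> L" "(\<Sum>j<m. q (k + j)) < (\<Sum>j<m. p (k + j))" unfolding bad_def by blast
      then have m0: "m > 0" by (cases m) auto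
      let ?b = "\<lambda>i. if bad (k + i) then q (k + i) else 0"
      have b: "(\<Sum>i<l. ?b i) \<le> (\<Sum>i<l. q (k + i))" for l by (intro sum_mono) auto
      have split: "(\<Sum>i<l + r. f i) = (\<Sum>i<l. f i) + (\<Sum>i<r. f (l + i))" for l r and f :: "nat \<Rightarrow> ennreal"
        by (induction r) (simp_all add: add.assoc)
      show ?thesis
      proof (cases "m \<le> n")
        case True
        then obtain r where r: "n = m + r" using le_Suc_ex by blast
        have "(\<Sum>i<n. ?b i) = (\<Sum>i<m. ?b i) + (\<Sum>i<r. ?b (m + i))" unfolding r by (rule split)
        also have "(\<Sum>i<r. ?b (m + i)) = (\<Sum>i<r. if bad (k + m + i) then q (k + m + i) else 0)" by (intro sum.cong) (auto simp: add.assoc)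
        also have "\<dots> \<le> (\<Sum>i<r + L. p (k + m + i))" by (rule less) (use r m0 in simp)
        also have "(\<Sum>i<m. ?b i) \<le> (\<Sum>i<m. p (k + i))" using b[of m] m(2) by simp
        finally have "(\<Sum>i<n. ?b i) \<le> (\<Sum>i<m. p (k + i)) + (\<Sum>i<r + L. p (k + m + i))"
          by (simp add: add_mono)
        also have "\<dots> = (\<Sum>i<n + L. p (k + i))" unfolding r add.assoc by (subst split) (simp add: add.assoc)
        finally show ?thesis .
      next
        case False
        then have "(\<Sum>i<n. ?b i) \<le> (\<Sum>i<m. ?b i)" by (intro sum_mono2) auto
        also have "\<dots> \<le> (\<Sum>i<m. p (k + i))" using b[of m] m(2) by simp
        also have "\<dots> \<le> (\<Sum>i<n + L. p (k + i))" using m(1) by (intro sum_mono2) auto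
        finally show ?thesis .
      qed
    qed
  qed
qed

text \<open>Division by \<open>n\<close> makes the boundary term negligible in the limit; the case
  \<open>n = 1\<close> first shows that \<open>a\<close> is finite if \<open>b\<close> is.\<close>

lemma ennreal_le_of_mult_le:
  fixes a b :: ennreal
  assumes "\<And>n::nat. of_nat n * a \<le> of_nat (n + L) * b"
  shows "a \<le> b"
proof (cases b)
  case (real b')
  have "a \<le> of_nat (1 + L) * b" using assms[of 1] by simp
  also have "\<dots> < \<infinity>" using real by (simp add: ennreal_mult_less_top of_nat_less_top)
  finally obtain a' where a': "a = ennreal a'" "a' \<ge> 0" by (cases a) auto
  have *: "real n * a' \<le> real (n + L) * b'" for n
    using assms[of n] a' real by (simp add: ennreal_of_nat_eq_real_of_nat ennreal_mult[symmetric] del: of_nat_add)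
  have "a' \<le> b'"
  proof (rule ccontr)
    assume "\<not> ?thesis"
    then have ab: "a' - b' > 0" by simp
    obtain n :: nat where "real L * b' / (a' - b') < real n" using reals_Archimedean2 by blast
    then have "real L * b' < real n * (a' - b')" using ab by (simp add: field_simps)
    then show False using *[of n] by (simp add: algebra_simps)
  qed
  then show ?thesis using a' real by (simp add: ennreal_leI)
qed auto

lemma cover_flow_add: "cover_flow s (cover_flow t v) = cover_flow (t + s) v"
  by (simp add: cover_flow_def split: prod.splits)

lemma cover_flow_0 [simp]: "cover_flow 0 v = v"
  by (simp add: cover_flow_def split: prod.splits)

lemma cover_flow_mem [simp]: "cover_flow t v \<in> cover_space \<Gamma> \<longleftrightarrow> v \<in> cover_space \<Gamma>"
  by (simp add: cover_flow_def cover_space_def split: prod.splits)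

lemma cover_act_flow: "cover_act \<sigma> g (cover_flow t v) = cover_flow t (cover_act \<sigma> g v)"
  by (simp add: cover_flow_def cover_act_def split: prod.splits)

lemma cover_flow_borel [measurable]:
  "cover_flow t \<in> borel_measurable (borel :: ('m::{metric_space, second_countable_topology} \<times> 'm \<times> real) measure)"
  unfolding cover_flow_def case_prod_unfold
  by (intro borel_measurable_continuous_onI continuous_intros)

context GPS
begin

lemma cover_act_comp: "g \<in> \<Gamma> \<Longrightarrow> h \<in> \<Gamma> \<Longrightarrow> cover_act \<sigma> g (cover_act \<sigma> h v) = cover_act \<sigma> (g \<circ> h) v"
  by (simp add: cover_act_def cocycle split: prod.splits)

lemma cover_act_id [simp]: "cover_act \<sigma> id v = v"
  by (simp add: cover_act_def split: prod.splits)

lemma act_eq_iff: "g \<in> \<Gamma> \<Longrightarrow> g x = g y \<longleftrightarrow> x = y"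
  by (metis inv_app(1))

lemma cover_act_mem: "g \<in> \<Gamma> \<Longrightarrow> v \<in> cover_space \<Gamma> \<Longrightarrow> cover_act \<sigma> g v \<in> cover_space \<Gamma>"
  using limit_set_act[of g "fst v"] limit_set_act[of g "fst (snd v)"] act_eq_iff[of g "fst v" "fst (snd v)"]
  by (simp add: cover_act_def cover_space_def case_prod_unfold)

lemma cover_act_borel [measurable]: "g \<in> \<Gamma> \<Longrightarrow> cover_act \<sigma> g \<in> borel_measurable borel"
proof -
  assume g: "g \<in> \<Gamma>"
  have 1: "continuous_on UNIV (\<lambda>v :: 'm \<times> 'm \<times> real. fst v)" "continuous_on UNIV (\<lambda>v :: 'm \<times> 'm \<times> real. fst (snd v))"
    "continuous_on UNIV (\<lambda>v :: 'm \<times> 'm \<times> real. snd (snd v))" by (intro continuous_intros)+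
  have "continuous_on UNIV (\<lambda>v. (g (fst v), g (fst (snd v)), snd (snd v) + \<sigma> g (fst (snd v))))"
    by (intro continuous_on_Pair continuous_on_add 1 continuous_on_compose2[OF cont[OF g] 1(1) subset_UNIV]
        continuous_on_compose2[OF cont[OF g] 1(2) subset_UNIV] continuous_on_compose2[OF cont_\<sigma>[OF g] 1(2) subset_UNIV])
  then show ?thesis unfolding cover_act_def case_prod_unfold by (rule borel_measurable_continuous_onI)
qed

lemma cover_borel [measurable]: "cover_space \<Gamma> \<in> sets borel"
proof -
  have L: "limit_set \<Gamma> \<in> sets borel" using closed_limit_set by (rule borel_closed)
  have "cover_space \<Gamma> = (\<lambda>v. fst v) -` limit_set \<Gamma> \<inter> (\<lambda>v. fst (snd v)) -` limit_set \<Gamma> \<inter> {v. fst v \<noteq> fst (snd v)}"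
    by (auto simp: cover_space_def)
  also have "\<dots> \<in> sets borel"
    by (intro sets.Int measurable_sets_borel[OF _ L] borel_measurable_continuous_onI borel_open open_Collect_neq continuous_intros)
  finally show ?thesis .
qed

text \<open>An integral against counting measure, so that additivity and exchange with series hold
  for all functions; \<open>osum_infsum\<close> identifies it with the sum in the definition of
  descent.\<close>

definition osum :: "('m \<times> 'm \<times> real \<Rightarrow> ennreal) \<Rightarrow> 'm \<times> 'm \<times> real \<Rightarrow> ennreal" where
  "osum f v = (\<integral>\<^sup>+\<gamma>. f (cover_act \<sigma> \<gamma> v) \<partial>count_space \<Gamma>)"

text \<open>The flow is sampled at integer times; \<open>bump\<close> is wide enough in time for
  such samples to meet every return.\<close>

definition tsum :: "nat \<Rightarrow> ('m \<times> 'm \<times> real \<Rightarrow> ennreal) \<Rightarrow> 'm \<times> 'm \<times> real \<Rightarrow> ennreal" where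
  "tsum n f v = (\<Sum>i<n. osum f (cover_flow (real i) v))"

definition inv_set :: "('m \<times> 'm \<times> real) set \<Rightarrow> bool" where
  "inv_set P \<longleftrightarrow> (\<forall>g\<in>\<Gamma>. \<forall>v\<in>cover_space \<Gamma>. cover_act \<sigma> g v \<in> P \<longleftrightarrow> v \<in> P)"

lemma osum_nat: "\<exists>e. (\<forall>n::nat. e n \<in> \<Gamma>) \<and> (\<forall>f v. osum f v = (\<Sum>n. f (cover_act \<sigma> (e n) v)))"
proof -
  let ?e = "from_nat_into \<Gamma>"
  have b: "bij_betw ?e UNIV \<Gamma>" using countable infinite by (rule bij_betw_from_nat_into)
  have "osum f v = (\<Sum>n. f (cover_act \<sigma> (?e n) v))" for f v
    unfolding osum_def using nn_integral_bij_count_space[OF b, of "\<lambda>\<gamma>. f (cover_act \<sigma> \<gamma> v)"]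
    by (simp add: nn_integral_count_space_nat)
  moreover have "?e n \<in> \<Gamma>" for n using b by (auto simp: bij_betw_def)
  ultimately show ?thesis by blast
qed

lemma osum_borel [measurable]:
  assumes [measurable]: "f \<in> borel_measurable borel"
  shows "osum f \<in> borel_measurable borel"
proof -
  obtain e where e: "\<forall>n::nat. e n \<in> \<Gamma>" "\<forall>f v. osum f v = (\<Sum>n. f (cover_act \<sigma> (e n) v))" using osum_nat by blast
  have "osum f = (\<lambda>v. \<Sum>n. f (cover_act \<sigma> (e n) v))" by (rule ext) (rule e(2)[rule_format])
  then show ?thesis
    by (simp only:) (intro borel_measurable_suminf_order measurable_compose[OF cover_act_borel[OF e(1)[rule_format]] assms])
qed

lemma tsum_borel [measurable]:
  assumes [measurable]: "f \<in> borel_measurable borel"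
  shows "tsum n f \<in> borel_measurable borel"
  unfolding tsum_def by measurable

lemma osum_act: "g \<in> \<Gamma> \<Longrightarrow> osum f (cover_act \<sigma> g v) = osum f v"
proof -
  assume g: "g \<in> \<Gamma>"
  have b: "bij_betw (\<lambda>h. h \<circ> g) \<Gamma> \<Gamma>"
    by (rule bij_betw_byWitness[of _ "\<lambda>h. h \<circ> inv g"]) (auto simp: o_assoc[symmetric] g image_subset_iff)
  have "osum f v = (\<integral>\<^sup>+h. f (cover_act \<sigma> (h \<circ> g) v) \<partial>count_space \<Gamma>)"
    unfolding osum_def using nn_integral_bij_count_space[OF b, of "\<lambda>\<gamma>. f (cover_act \<sigma> \<gamma> v)"] by simp
  also have "\<dots> = osum f (cover_act \<sigma> g v)"
    unfolding osum_def using g by (intro nn_integral_cong) (simp add: cover_act_comp)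
  finally show ?thesis by simp
qed

lemma tsum_act: "g \<in> \<Gamma> \<Longrightarrow> tsum n f (cover_act \<sigma> g v) = tsum n f v"
  unfolding tsum_def cover_act_flow[symmetric] by (simp add: osum_act)

lemma osum_flow: "osum (\<lambda>v. f (cover_flow t v)) v = osum f (cover_flow t v)"
  by (simp add: osum_def cover_act_flow)

lemma osum_mono: "(\<And>\<gamma>. \<gamma> \<in> \<Gamma> \<Longrightarrow> f (cover_act \<sigma> \<gamma> v) \<le> g (cover_act \<sigma> \<gamma> w)) \<Longrightarrow> osum f v \<le> osum g w"
  unfolding osum_def by (intro nn_integral_mono) auto

lemma osum_sum: "osum (\<lambda>v. \<Sum>i\<in>I. f i v) v = (\<Sum>i\<in>I. osum (f i) v)"
  unfolding osum_def by (rule nn_integral_sum) auto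

lemma osum_add: "osum (\<lambda>v. f v + g v) v = osum f v + osum g v"
  unfolding osum_def by (rule nn_integral_add) auto

lemma osum_suminf: "osum (\<lambda>v. \<Sum>i. f i v) v = (\<Sum>i. osum (f i) v)"
  unfolding osum_def by (rule nn_integral_suminf) auto

lemma osum_cmult: "osum (\<lambda>v. c * f v) v = c * osum f v"
  unfolding osum_def by (rule nn_integral_cmult) auto

lemma tsum_cmult: "tsum n (\<lambda>v. c * f v) v = c * tsum n f v"
  unfolding tsum_def osum_cmult by (simp add: sum_distrib_left)

lemma tsum_add: "tsum n (\<lambda>v. f v + g v) v = tsum n f v + tsum n g v"
  unfolding tsum_def osum_add by (simp add: sum.distrib)

lemma osum_indicator:
  assumes "inv_set P" "v \<in> cover_space \<Gamma>"
  shows "osum (\<lambda>v. f v * indicator P v) v = osum f v * indicator P v"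
proof -
  have "osum (\<lambda>v. f v * indicator P v) v = (\<integral>\<^sup>+\<gamma>. f (cover_act \<sigma> \<gamma> v) * indicator P v \<partial>count_space \<Gamma>)"
    unfolding osum_def using assms by (intro nn_integral_cong) (auto simp: inv_set_def indicator_def)
  then show ?thesis unfolding osum_def by (simp add: nn_integral_multc)
qed

lemma osum_const: "osum (\<lambda>_. c) v = (if c = 0 then 0 else \<infinity>)"
  unfolding osum_def using infinite by (auto simp: emeasure_count_space ennreal_mult_top)

end

section \<open>The invariant measure on the cover\<close>

locale GPS_pair = GPS_conformal \<Gamma> d \<sigma> \<sigma>' G N \<delta> \<mu>
  for \<Gamma> :: "('m::{metric_space, second_countable_topology} \<Rightarrow> 'm) set" and d \<sigma> \<sigma>' G N \<delta> \<mu> +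
  fixes \<mu>' :: "'m measure"
  assumes conformal': "conformal_measure \<Gamma> \<sigma>' \<delta> \<mu>'"
begin

lemma sets_\<mu>' [measurable_cong, simp]: "sets \<mu>' = sets borel"
  using conformal' by (simp add: conformal_measure_def)

lemma space_\<mu>' [simp]: "space \<mu>' = UNIV"
  using sets_eq_imp_space_eq[OF sets_\<mu>'] by simp

sublocale nu': prob_space \<mu>'
  using conformal' by (simp add: conformal_measure_def)

definition prod3 :: "('m \<times> 'm \<times> real) measure" where
  "prod3 = \<mu>' \<Otimes>\<^sub>M (\<mu> \<Otimes>\<^sub>M lborel)"

lemma sets_prod3 [measurable_cong, simp]: "sets prod3 = sets borel"
proof -
  have "sets (\<mu> \<Otimes>\<^sub>M lborel) = sets (borel :: ('m \<times> real) measure)"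
    by (subst borel_prod[symmetric]) (intro sets_pair_measure_cong; simp)
  then show ?thesis unfolding prod3_def by (subst borel_prod[symmetric]) (intro sets_pair_measure_cong; simp)
qed

lemma space_prod3 [simp]: "space prod3 = UNIV"
  using sets_eq_imp_space_eq[OF sets_prod3] by simp

text \<open>The density is 0 outside the cover, so that \<open>Q\<close> lives on the full product
  with its Borel sets. \<open>nn_integral_BMS\<close> matches its integrals with those of the
  measure on the cover.\<close>

definition weight :: "'m \<times> 'm \<times> real \<Rightarrow> ennreal" where
  "weight v = ennreal (indicator (cover_space \<Gamma>) v *\<^sub>R exp (\<delta> * G (fst v, fst (snd v))))"

lemma weight_borel [measurable]: "weight \<in> borel_measurable borel"
proof -
  have g0: "continuous_on {(x, y). x \<noteq> y} G" using gps by (simp add: continuous_GPS_system_def)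
  have c: "continuous_on (cover_space \<Gamma>) (\<lambda>v. (fst v, fst (snd v)))" by (intro continuous_intros)
  have "continuous_on (cover_space \<Gamma>) (\<lambda>v. G (fst v, fst (snd v)))"
    by (rule continuous_on_compose2[OF g0 c]) (auto simp: cover_space_def)
  then have "continuous_on (cover_space \<Gamma>) (\<lambda>v. exp (\<delta> * G (fst v, fst (snd v))))"
    by (rule continuous_on_exp[OF continuous_on_mult[OF continuous_on_const]])
  from borel_measurable_continuous_on_indicator[OF cover_borel this] show ?thesis
    unfolding weight_def[abs_def] by (rule measurable_compose[OF _ measurable_ennreal])
qed

definition Q :: "('m \<times> 'm \<times> real) measure" where
  "Q = density prod3 weight"

lemma sets_Q [measurable_cong, simp]: "sets Q = sets borel"
  by (simp add: Q_def)

lemma space_Q [simp]: "space Q = UNIV"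
  by (simp add: Q_def)

lemma nn_integral_Q: "f \<in> borel_measurable borel \<Longrightarrow> (\<integral>\<^sup>+v. f v \<partial>Q) = (\<integral>\<^sup>+v. weight v * f v \<partial>prod3)"
  unfolding Q_def by (subst nn_integral_density) auto

lemma AE_Q: "(AE v in Q. R v) \<longleftrightarrow> (AE v in prod3. v \<in> cover_space \<Gamma> \<longrightarrow> R v)"
  unfolding Q_def by (subst AE_density) (auto simp: weight_def indicator_def)

lemma AE_Q_cover: "AE v in Q. v \<in> cover_space \<Gamma>"
  by (simp add: AE_Q)

sublocale s2: sigma_finite_measure "\<mu> \<Otimes>\<^sub>M (lborel :: real measure)"
  by (rule sigma_finite_pair_measure) unfold_locales

lemma nn_integral_prod3:
  assumes [measurable]: "f \<in> borel_measurable borel"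
  shows "(\<integral>\<^sup>+v. f v \<partial>prod3) = (\<integral>\<^sup>+x. \<integral>\<^sup>+y. \<integral>\<^sup>+t. f (x, y, t) \<partial>lborel \<partial>\<mu> \<partial>\<mu>')"
proof -
  have f: "f \<in> borel_measurable (\<mu>' \<Otimes>\<^sub>M (\<mu> \<Otimes>\<^sub>M lborel))" using assms unfolding measurable_cong_sets[OF sets_prod3[unfolded prod3_def] refl] .
  have "(\<integral>\<^sup>+v. f v \<partial>prod3) = (\<integral>\<^sup>+x. \<integral>\<^sup>+z. f (x, z) \<partial>(\<mu> \<Otimes>\<^sub>M lborel) \<partial>\<mu>')"
    unfolding prod3_def using s2.nn_integral_fst[OF f] by simp
  also have "\<dots> = (\<integral>\<^sup>+x. \<integral>\<^sup>+y. \<integral>\<^sup>+t. f (x, y, t) \<partial>lborel \<partial>\<mu> \<partial>\<mu>')"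
  proof (intro nn_integral_cong)
    fix x assume x: "x \<in> space \<mu>'"
    have "(\<lambda>z. f (x, z)) \<in> borel_measurable (\<mu> \<Otimes>\<^sub>M lborel)" using measurable_Pair2[OF f x] .
    from sigma_finite_measure.nn_integral_fst[OF sigma_finite_lborel this]
    show "(\<integral>\<^sup>+z. f (x, z) \<partial>(\<mu> \<Otimes>\<^sub>M lborel)) = (\<integral>\<^sup>+y. \<integral>\<^sup>+t. f (x, y, t) \<partial>lborel \<partial>\<mu>)" by simp
  qed
  finally show ?thesis .
qed

lemma nn_integral_flow:
  assumes f: "f \<in> borel_measurable borel"
  shows "(\<integral>\<^sup>+v. f (cover_flow s v) \<partial>Q) = (\<integral>\<^sup>+v. f v \<partial>Q)"
proof -
  define h where "h v = weight v * f v" for v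
  have hm [measurable]: "h \<in> borel_measurable borel" unfolding h_def using f by measurable
  have w: "weight (cover_flow s v) = weight v" for v
    by (simp add: weight_def indicator_def) (simp add: cover_flow_def split: prod.splits)
  have "(\<integral>\<^sup>+v. f (cover_flow s v) \<partial>Q) = (\<integral>\<^sup>+v. h (cover_flow s v) \<partial>prod3)"
    unfolding h_def w by (intro nn_integral_Q measurable_compose[OF cover_flow_borel f])
  also have "\<dots> = (\<integral>\<^sup>+x. \<integral>\<^sup>+y. \<integral>\<^sup>+t. h (x, y, t + s) \<partial>lborel \<partial>\<mu> \<partial>\<mu>')"
    by (subst nn_integral_prod3[OF measurable_compose[OF cover_flow_borel hm]]) (simp add: cover_flow_def)
  also have "\<dots> = (\<integral>\<^sup>+x. \<integral>\<^sup>+y. \<integral>\<^sup>+t. h (x, y, t) \<partial>lborel \<partial>\<mu> \<partial>\<mu>')"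
  proof (rule nn_integral_cong, rule nn_integral_cong)
    fix x y
    have [measurable]: "(\<lambda>t. h (x, y, t)) \<in> borel_measurable borel"
      by (rule measurable_compose[OF _ hm]) (intro borel_measurable_continuous_onI continuous_intros)
    show "(\<integral>\<^sup>+t. h (x, y, t + s) \<partial>lborel) = (\<integral>\<^sup>+t. h (x, y, t) \<partial>lborel)"
      using nn_integral_real_affine[of "\<lambda>t. h (x, y, t)" 1 s] by (simp add: add.commute)
  qed
  also have "\<dots> = (\<integral>\<^sup>+v. f v \<partial>Q)" using f hm unfolding h_def by (simp add: nn_integral_Q nn_integral_prod3)
  finally show ?thesis .
qed

end

text \<open>\<open>comparison\<close> is the trace that the quotient measure leaves on the cover. In
  contrast to that measure, it passes to the system with exchanged endpoints by a change of
  variables.\<close>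

locale GPS_flow = GPS_pair \<Gamma> d \<sigma> \<sigma>' G N \<delta> \<mu> \<mu>'
  for \<Gamma> :: "('m::{metric_space, second_countable_topology} \<Rightarrow> 'm) set" and d \<sigma> \<sigma>' G N \<delta> \<mu> \<mu>' +
  assumes comparison: "\<And>f g. f \<in> borel_measurable borel \<Longrightarrow> g \<in> borel_measurable borel \<Longrightarrow>
    (\<And>v. v \<in> cover_space \<Gamma> \<Longrightarrow> osum f v \<le> osum g v) \<Longrightarrow> (\<integral>\<^sup>+v. f v \<partial>Q) \<le> (\<integral>\<^sup>+v. g v \<partial>Q)"
begin

text \<open>The function equal to \<infinity> on \<open>P\<close> and 0 elsewhere has an orbit sum
  that vanishes off \<open>P\<close>; so it is dominated by that of \<open>f\<close>, and its
  integral is finite.\<close>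

lemma null_of_infinite:
  assumes P: "P \<in> sets borel" "inv_set P" and f: "f \<in> borel_measurable borel" "(\<integral>\<^sup>+v. f v \<partial>Q) < \<infinity>"
    and inf: "\<And>v. v \<in> cover_space \<Gamma> \<Longrightarrow> v \<in> P \<Longrightarrow> osum f v = \<infinity>"
  shows "emeasure Q P = 0"
proof -
  have "(\<integral>\<^sup>+v. \<infinity> * indicator P v \<partial>Q) \<le> (\<integral>\<^sup>+v. f v \<partial>Q)"
  proof (rule comparison)
    fix v assume v: "v \<in> cover_space \<Gamma>"
    show "osum (\<lambda>v. \<infinity> * indicator P v) v \<le> osum f v"
      unfolding osum_indicator[OF P(2) v] using inf[OF v] by (auto simp: indicator_def)
  qed (use P f in measurable)
  also have "\<dots> < \<infinity>" by (rule f)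
  finally show ?thesis using P by (simp add: nn_integral_cmult_indicator ennreal_mult_less_top)
qed

text \<open>The sets \<open>E L\<close> are defined by orbit sums, hence invariant, so their
  indicators can be taken out of orbit sums. By invariance under the flow, \<open>n\<close> times
  the integral over \<open>E L\<close> is the integral of a sum along the flow;
  \<open>block_covering\<close> bounds the orbit sum of that by the one for \<open>p\<close> with
  \<open>n + L\<close> terms. Now \<open>n\<close> and then \<open>L\<close> tend to
  infinity.\<close>

lemma maximal_inequality:
  assumes [measurable]: "p \<in> borel_measurable borel" "q \<in> borel_measurable borel"
  shows "(\<integral>\<^sup>+v. q v * indicator {v. \<exists>n. tsum n q v < tsum n p v} v \<partial>Q) \<le> (\<integral>\<^sup>+v. p v \<partial>Q)"
proof -
  define E where "E L = {v. \<exists>m\<le>L. tsum m q v < tsum m p v}" for L :: nat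
  have Em [measurable]: "E L \<in> sets borel" for L
  proof -
    have "E L = (\<Union>m\<in>{..L}. {v. tsum m q v < tsum m p v})" by (auto simp: E_def)
    moreover have "{v. tsum m q v < tsum m p v} \<in> sets borel" for m by measurable
    ultimately show ?thesis by (simp add: sets.finite_UN)
  qed
  have Ei: "inv_set (E L)" for L by (auto simp: inv_set_def E_def tsum_act)
  have bound: "(\<integral>\<^sup>+v. q v * indicator (E L) v \<partial>Q) \<le> (\<integral>\<^sup>+v. p v \<partial>Q)" for L
  proof (rule ennreal_le_of_mult_le[where L = L])
    fix n
    have "of_nat n * (\<integral>\<^sup>+v. q v * indicator (E L) v \<partial>Q) = (\<Sum>i<n. \<integral>\<^sup>+v. q (cover_flow (real i) v) * indicator (E L) (cover_flow (real i) v) \<partial>Q)"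
      by (subst nn_integral_flow[of "\<lambda>v. q v * indicator (E L) v"]) auto
    also have "\<dots> = (\<integral>\<^sup>+v. (\<Sum>i<n. q (cover_flow (real i) v) * indicator (E L) (cover_flow (real i) v)) \<partial>Q)"
      by (subst nn_integral_sum) auto
    also have "\<dots> \<le> (\<integral>\<^sup>+v. (\<Sum>i<n + L. p (cover_flow (real i) v)) \<partial>Q)"
    proof (rule comparison)
      fix v assume v: "v \<in> cover_space \<Gamma>"
      have bad: "cover_flow (real i) v \<in> E L \<longleftrightarrow>
          (\<exists>m\<le>L. (\<Sum>j<m. osum q (cover_flow (real (i + j)) v)) < (\<Sum>j<m. osum p (cover_flow (real (i + j)) v)))" for i
        by (simp add: E_def tsum_def cover_flow_add)
      have "osum (\<lambda>v. \<Sum>i<n. q (cover_flow (real i) v) * indicator (E L) (cover_flow (real i) v)) v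
          = (\<Sum>i<n. osum q (cover_flow (real i) v) * indicator (E L) (cover_flow (real i) v))"
        unfolding osum_sum osum_flow[of "\<lambda>v. q v * indicator (E L) v"] using v by (simp add: osum_indicator[OF Ei])
      also have "\<dots> = (\<Sum>i<n. if cover_flow (real (0 + i)) v \<in> E L then osum q (cover_flow (real (0 + i)) v) else 0)"
        by (intro sum.cong) (auto simp: indicator_def)
      also have "\<dots> \<le> (\<Sum>i<n + L. osum p (cover_flow (real (0 + i)) v))"
        unfolding bad by (rule block_covering[where p = "\<lambda>i. osum p (cover_flow (real i) v)" and q = "\<lambda>i. osum q (cover_flow (real i) v)"])
      also have "\<dots> = osum (\<lambda>v. \<Sum>i<n + L. p (cover_flow (real i) v)) v" unfolding osum_sum osum_flow by simp
      finally show "osum (\<lambda>v. \<Sum>i<n. q (cover_flow (real i) v) * indicator (E L) (cover_flow (real i) v)) v \<le> osum (\<lambda>v. \<Sum>i<n + L. p (cover_flow (real i) v)) v" .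
    qed measurable
    also have "\<dots> = (\<Sum>i<n + L. \<integral>\<^sup>+v. p (cover_flow (real i) v) \<partial>Q)" by (subst nn_integral_sum) auto
    also have "\<dots> = of_nat (n + L) * (\<integral>\<^sup>+v. p v \<partial>Q)" by (subst nn_integral_flow) auto
    finally show "of_nat n * (\<integral>\<^sup>+v. q v * indicator (E L) v \<partial>Q) \<le> of_nat (n + L) * (\<integral>\<^sup>+v. p v \<partial>Q)" .
  qed
  have "{v. \<exists>n. tsum n q v < tsum n p v} = (\<Union>L. E L)" by (auto simp: E_def)
  moreover have "(\<integral>\<^sup>+v. q v * indicator (\<Union>L. E L) v \<partial>Q) = (SUP L. \<integral>\<^sup>+v. q v * indicator (E L) v \<partial>Q)"
  proof (subst nn_integral_monotone_convergence_SUP[symmetric])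
    show "incseq (\<lambda>L v. q v * indicator (E L) v)"
      by (auto simp: incseq_def le_fun_def indicator_def E_def intro: order_trans)
    show "(\<integral>\<^sup>+v. q v * indicator (\<Union>L. E L) v \<partial>Q) = (\<integral>\<^sup>+v. (SUP L. q v * indicator (E L) v) \<partial>Q)"
    proof (rule nn_integral_cong)
      fix v
      show "q v * indicator (\<Union>L. E L) v = (SUP L. q v * indicator (E L) v)"
      proof (cases "v \<in> (\<Union>L. E L)")
        case True
        then obtain L where "v \<in> E L" by auto
        then have "q v \<le> (SUP L. q v * indicator (E L) v)" by (intro SUP_upper2[of L]) auto
        moreover have "(SUP L. q v * indicator (E L) v) \<le> q v" by (intro SUP_least) (auto simp: indicator_def)
        ultimately show ?thesis using True by auto
      next
        case False
        then have "(SUP L. q v * indicator (E L) v) = (SUP L::nat. 0)" by (intro SUP_cong) auto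
        then show ?thesis using False by simp
      qed
    qed
  qed auto
  ultimately show ?thesis using bound by (auto intro: SUP_least)
qed

end

section \<open>Recurrence and conservativity\<close>

lemma sum_indicator_gap:
  assumes "\<And>i j. i \<in> I \<Longrightarrow> j \<in> I \<Longrightarrow> i < j \<Longrightarrow> j < i + n" and n: "n > 0"
  shows "(\<Sum>i. indicator I i :: ennreal) \<le> of_nat n"
proof (cases "I = {}")
  case False
  define i0 where "i0 = (LEAST i. i \<in> I)"
  have i0: "i0 \<in> I" unfolding i0_def using False by (metis LeastI ex_in_conv)
  have sub: "I \<subseteq> {i0..<i0 + n} \<union> {i0}"
  proof
    fix i assume i: "i \<in> I"
    then have "i0 \<le> i" unfolding i0_def by (rule Least_le)
    then show "i \<in> {i0..<i0 + n} \<union> {i0}" using assms(1)[OF i0 i] by (cases "i = i0") auto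
  qed
  then have fin: "finite I" and "card I \<le> n"
    using n card_mono[of "{i0..<i0 + n}" I] finite_subset[of I "{i0..<i0 + n}"] by (auto simp: insert_absorb)
  have "(\<Sum>i. indicator I i :: ennreal) = (\<Sum>i\<in>I. indicator I i)"
    by (rule suminf_finite[OF fin]) auto
  also have "\<dots> = of_nat (card I)" by simp
  also have "\<dots> \<le> of_nat n" using \<open>card I \<le> n\<close> by (rule of_nat_mono)
  finally show ?thesis .
qed auto

section \<open>A recurrent integrable test function\<close>

context GPS_conformal
begin

text \<open>The exponential factor makes \<open>rho\<close> integrable against \<open>e\<^sup>\<delta>\<^sup>G\<close>, although \<open>G\<close> may blow up
  at the diagonal; the distance makes it continuous there.\<close>

definition rho :: "'m \<times> 'm \<Rightarrow> real" where
  "rho z = (if fst z = snd z then 0 else d (Inr (fst z)) (Inr (snd z)) * exp (- \<delta> * \<bar>G z\<bar>))"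

lemma rho_nonneg: "rho z \<ge> 0" and rho_le: "rho z \<le> d (Inr (fst z)) (Inr (snd z))"
proof -
  have "exp (- \<delta> * \<bar>G z\<bar>) \<le> 1" using \<delta>_nonneg by simp
  then have "d (Inr (fst z)) (Inr (snd z)) * exp (- \<delta> * \<bar>G z\<bar>) \<le> d (Inr (fst z)) (Inr (snd z)) * 1"
    by (intro mult_left_mono) auto
  then show "rho z \<ge> 0" "rho z \<le> d (Inr (fst z)) (Inr (snd z))" by (auto simp: rho_def)
qed

lemma rho_pos: "x \<noteq> y \<Longrightarrow> rho (x, y) > 0"
  by (auto simp: rho_def ms.mdist_pos_eq)

lemma rho_cont: "continuous_on UNIV rho"
proof (subst continuous_on_eq_continuous_at[OF open_UNIV], rule ballI)
  fix z :: "'m \<times> 'm"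
  show "isCont rho z"
  proof (cases "fst z = snd z")
    case True
    have "(\<lambda>z. d (Inr (fst z)) (Inr (snd z))) \<midarrow>z\<rightarrow> d (Inr (fst z)) (Inr (snd z))"
      using cont_D unfolding continuous_on_eq_continuous_at[OF open_UNIV] isCont_def by blast
    then have "(\<lambda>z. d (Inr (fst z)) (Inr (snd z))) \<midarrow>z\<rightarrow> 0" using True by simp
    from tendsto_sandwich[OF _ _ tendsto_const this, of rho] have "rho \<midarrow>z\<rightarrow> 0"
      by (simp add: rho_nonneg rho_le)
    then show ?thesis using True by (simp add: isCont_def rho_def)
  next
    case False
    have o: "open {z :: 'm \<times> 'm. fst z \<noteq> snd z}" by (intro open_Collect_neq continuous_intros)
    have g0: "continuous_on {z. fst z \<noteq> snd z} G" using gps by (simp add: continuous_GPS_system_def case_prod_unfold)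
    have "continuous_on {z. fst z \<noteq> snd z} (\<lambda>z. d (Inr (fst z)) (Inr (snd z)) * exp (- \<delta> * \<bar>G z\<bar>))"
      by (intro continuous_intros g0 continuous_on_subset[OF cont_D]) auto
    then have "continuous_on {z. fst z \<noteq> snd z} rho" by (rule continuous_on_eq) (auto simp: rho_def)
    then show ?thesis using False continuous_on_eq_continuous_at[OF o] by (cases z) auto
  qed
qed

text \<open>The time factor is at least 1 for times between -1 and 1. Some integer time of each
  return falls into this range.\<close>

definition bump :: "'m \<times> 'm \<times> real \<Rightarrow> real" where
  "bump v = rho (fst v, fst (snd v)) * max 0 (2 - \<bar>snd (snd v)\<bar>)"

lemma bump_cont: "continuous_on UNIV bump"
  unfolding bump_def[abs_def] by (intro continuous_intros continuous_on_compose2[OF rho_cont]) auto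

lemma bump_borel [measurable]: "bump \<in> borel_measurable borel"
  using bump_cont by (rule borel_measurable_continuous_onI)

lemma bump_nonneg: "bump v \<ge> 0"
  by (simp add: bump_def rho_nonneg)

lemma D_bounded: "\<exists>B>0. \<forall>x y. d (Inr x) (Inr y) \<le> B"
proof -
  have "compact (UNIV :: ('m \<times> 'm) set)" using compact_Times[OF compact_M compact_M] by simp
  then have "bounded (range (\<lambda>z :: 'm \<times> 'm. d (Inr (fst z)) (Inr (snd z))))"
    by (intro compact_imp_bounded compact_continuous_image cont_D)
  then obtain B where "\<forall>z :: 'm \<times> 'm. norm (d (Inr (fst z)) (Inr (snd z))) \<le> B" by (auto simp: bounded_iff)
  then have "\<forall>x y. d (Inr x) (Inr y) \<le> max B 1" by (auto simp: le_max_iff_disj)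
  then show ?thesis by (intro exI[of _ "max B 1"]) auto
qed

lemma bump_bounded: "\<exists>K. \<forall>v. bump v \<le> K"
proof -
  obtain B where B: "B > 0" "\<forall>x y. d (Inr x) (Inr y) \<le> B" using D_bounded by auto
  have "bump v \<le> B * 2" for v
    unfolding bump_def
  proof (rule mult_mono)
    show "rho (fst v, fst (snd v)) \<le> B" using rho_le[of "(fst v, fst (snd v))"] B(2) order_trans by fastforce
  qed (use B in auto)
  then show ?thesis by blast
qed

text \<open>Let \<open>y\<close> be in the shadow of \<open>g\<close>. Then \<open>y\<close> is
  close to \<open>g\<close>, so \<open>x\<close> is not, and \<open>inv g\<close> moves
  \<open>x\<close> close to \<open>inv g\<close> while \<open>inv g y\<close> stays \<open>r\<close>
  away from it. Hence the endpoints of the translate by \<open>inv g\<close> are \<open>r/2\<close>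
  apart and \<open>rho\<close> is bounded below there. Each of the infinitely many \<open>g\<close>
  thus contributes at least \<open>c\<close> at some time.\<close>

lemma bump_recurrent:
  assumes v: "v \<in> cover_space \<Gamma>" and y: "conical (fst (snd v))"
  shows "(\<Sum>i. osum (\<lambda>v. ennreal (bump v)) (cover_flow (real i) v)) = \<infinity>"
proof -
  obtain x y t where vx: "v = (x, y, t)" by (metis prod.collapse)
  have xy: "x \<noteq> y" using v by (auto simp: vx cover_space_def)
  obtain k :: nat where k: "infinite {g\<in>\<Gamma>. y \<in> shadow (inverse (Suc k)) g}" using y by (auto simp: conical_def vx)
  define r where "r = inverse (real (Suc k))"
  have r: "r > 0" by (simp add: r_def)
  define r1 where "r1 = d (Inr x) (Inr y)"
  have r1: "r1 > 0" using xy by (simp add: r1_def ms.mdist_pos_eq)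
  define e where "e = min (r/2) (r1/3)"
  have e: "e > 0" "e \<le> r/2" "3 * e \<le> r1" using r r1 by (auto simp: e_def)
  obtain F where F: "finite F" "\<forall>g\<in>\<Gamma> - F.
    (\<forall>p\<in>X. d p (Inl (inv g)) > e \<longrightarrow> d (act g p) (Inl g) < e) \<and>
    (\<forall>p\<in>X. d p (Inl g) > e \<longrightarrow> d (act (inv g) p) (Inl (inv g)) < e)" using contraction2[OF e(1)] by auto
  obtain C where C: "\<forall>g\<in>\<Gamma>. \<forall>x. d (Inr x) (Inl (inv g)) > r \<longrightarrow> \<bar>\<sigma> g x - N g\<bar> \<le> C" using mag[OF r] by auto
  have r2: "r/2 > 0" using r by simp
  obtain B where B: "\<forall>x y. d (Inr x) (Inr y) \<ge> r/2 \<longrightarrow> \<bar>G (x, y)\<bar> \<le> B" using G_bounded[OF r2] by auto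
  define c where "c = r/2 * exp (- \<delta> * B)"
  have c: "c > 0" using r by (simp add: c_def)
  \<comment> \<open>The elements of magnitude at most \<open>C + t\<close> are discarded because
    their return times may be negative.\<close>
  define A where "A = {g\<in>\<Gamma>. y \<in> shadow r g} - (F \<union> {g\<in>\<Gamma>. N g \<le> C + t})"
  have "infinite A" unfolding A_def using k F(1) finite_N[of "C + t"] by (simp add: r_def)
  moreover have "inj_on inv A" using inj_inv by (rule inj_on_subset) (auto simp: A_def)
  ultimately have infA: "infinite (inv ` A)" by (simp add: finite_image_iff)
  have AG: "inv ` A \<subseteq> \<Gamma>" by (auto simp: A_def)
  have big: "\<exists>i. bump (cover_act \<sigma> (inv g) (cover_flow (real i) v)) \<ge> c" if g: "g \<in> A" for g
  proof -
    have gG: "g \<in> \<Gamma>" and gF: "g \<in> \<Gamma> - F" and far: "d (Inr (inv g y)) (Inl (inv g)) > r" and Ng: "N g > C + t"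
      using g by (auto simp: A_def shadow_def)
    have "d (act g (Inr (inv g y))) (Inl g) < e"
      using conjunct1[OF bspec[OF F(2) gF], THEN bspec, of "Inr (inv g y)"] far e r by simp
    then have "d (Inr y) (Inl g) < e" using gG by simp
    moreover have "d (Inr x) (Inr y) \<le> d (Inr x) (Inl g) + d (Inl g) (Inr y)" using gG by (intro ms.triangle) auto
    ultimately have "d (Inr x) (Inl g) > e" using e r1 ms.commute[of "Inl g" "Inr y"] unfolding r1_def by linarith
    then have "d (act (inv g) (Inr x)) (Inl (inv g)) < e"
      using conjunct2[OF bspec[OF F(2) gF], THEN bspec, of "Inr x"] by simp
    then have "d (Inr (inv g x)) (Inl (inv g)) < e" by simp
    moreover have "d (Inr (inv g y)) (Inl (inv g)) \<le> d (Inr (inv g y)) (Inr (inv g x)) + d (Inr (inv g x)) (Inl (inv g))"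
      using gG by (intro ms.triangle) auto
    ultimately have D: "d (Inr (inv g x)) (Inr (inv g y)) \<ge> r/2"
      using far e ms.commute[of "Inr (inv g y)" "Inr (inv g x)"] by linarith
    have "\<bar>G (inv g x, inv g y)\<bar> \<le> B" using B D by blast
    then have "exp (- \<delta> * B) \<le> exp (- \<delta> * \<bar>G (inv g x, inv g y)\<bar>)" using \<delta>_nonneg by (simp add: mult_left_mono)
    then have "c \<le> d (Inr (inv g x)) (Inr (inv g y)) * exp (- \<delta> * \<bar>G (inv g x, inv g y)\<bar>)"
      unfolding c_def using D r by (intro mult_mono) auto
    moreover have "inv g x \<noteq> inv g y" using D r by auto
    ultimately have rc: "c \<le> rho (inv g x, inv g y)" by (simp add: rho_def)
    define s where "s = \<sigma> (inv g) y"
    have "\<sigma> g (inv g y) = - s" using cocycle_inv[OF inv_in[OF gG], of y] gG by (simp add: s_def)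
    moreover have "\<bar>\<sigma> g (inv g y) - N g\<bar> \<le> C" using C gG far by blast
    ultimately have "- s - t \<ge> 0" using Ng by linarith
    \<comment> \<open>Rounding the return time down puts the time coordinate between -1 and
      0.\<close>
    define i where "i = nat \<lfloor>- s - t\<rfloor>"
    have "real i = of_int \<lfloor>- s - t\<rfloor>" unfolding i_def using \<open>- s - t \<ge> 0\<close> by simp
    then have "- 1 \<le> t + real i + s" "t + real i + s \<le> 0" by linarith+
    then have "max 0 (2 - \<bar>t + real i + s\<bar>) \<ge> 1" by auto
    then have "c * 1 \<le> rho (inv g x, inv g y) * max 0 (2 - \<bar>t + real i + s\<bar>)" using rc c by (intro mult_mono) auto
    then show ?thesis by (intro exI[of _ i]) (simp add: bump_def vx cover_act_def cover_flow_def s_def)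
  qed
  have "(\<integral>\<^sup>+\<gamma>. ennreal c * indicator (inv ` A) \<gamma> \<partial>count_space \<Gamma>) \<le>
      (\<integral>\<^sup>+\<gamma>. (\<Sum>i. ennreal (bump (cover_act \<sigma> \<gamma> (cover_flow (real i) v)))) \<partial>count_space \<Gamma>)"
  proof (rule nn_integral_mono)
    fix \<gamma> assume "\<gamma> \<in> space (count_space \<Gamma>)"
    show "ennreal c * indicator (inv ` A) \<gamma> \<le> (\<Sum>i. ennreal (bump (cover_act \<sigma> \<gamma> (cover_flow (real i) v))))"
    proof (cases "\<gamma> \<in> inv ` A")
      case True
      then obtain i where i: "c \<le> bump (cover_act \<sigma> \<gamma> (cover_flow (real i) v))" using big by auto
      have "ennreal c \<le> (\<Sum>i\<in>{i}. ennreal (bump (cover_act \<sigma> \<gamma> (cover_flow (real i) v))))" using i by (simp add: ennreal_leI)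
      also have "\<dots> \<le> (\<Sum>i. ennreal (bump (cover_act \<sigma> \<gamma> (cover_flow (real i) v))))" by (rule sum_le_suminf) auto
      finally show ?thesis using True by simp
    qed simp
  qed
  also have "\<dots> = (\<Sum>i. osum (\<lambda>v. ennreal (bump v)) (cover_flow (real i) v))"
    unfolding osum_def by (rule nn_integral_suminf) auto
  finally have "ennreal c * emeasure (count_space \<Gamma>) (inv ` A) \<le> (\<Sum>i. osum (\<lambda>v. ennreal (bump v)) (cover_flow (real i) v))"
    using AG by (simp add: nn_integral_cmult_indicator)
  moreover have "emeasure (count_space \<Gamma>) (inv ` A) = \<infinity>" using AG infA by (simp add: emeasure_count_space)
  ultimately show ?thesis using c by (simp add: ennreal_mult_top top_unique)
qed

end

context GPS_pair
begin

lemma AE_Q_snd: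
  assumes "AE y in \<mu>. R y"
  shows "AE v in Q. R (fst (snd v))"
proof -
  obtain K where K: "{y \<in> space \<mu>. \<not> R y} \<subseteq> K" "emeasure \<mu> K = 0" "K \<in> sets \<mu>" using AE_E[OF assms] by auto
  have m: "UNIV \<times> (K \<times> UNIV) \<in> sets prod3"
    unfolding prod3_def using K(3) by (intro pair_measureI) auto
  have "emeasure (\<mu> \<Otimes>\<^sub>M lborel) (K \<times> UNIV) = 0"
    using K by (subst sigma_finite_measure.emeasure_pair_measure_Times[OF sigma_finite_lborel]) auto
  then have "emeasure prod3 (UNIV \<times> (K \<times> UNIV)) = 0"
    unfolding prod3_def using K by (subst s2.emeasure_pair_measure_Times) auto
  then have "AE v in prod3. R (fst (snd v))"
    using m K(1) by (intro AE_I[of _ _ "UNIV \<times> (K \<times> UNIV)"]) (auto simp: subset_iff)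
  then show ?thesis unfolding AE_Q by eventually_elim simp
qed

lemma bump_integral_finite: "(\<integral>\<^sup>+v. ennreal (bump v) \<partial>Q) < \<infinity>"
proof -
  obtain B where B: "B > 0" "\<forall>x y. d (Inr x) (Inr y) \<le> B" using D_bounded by auto
  define S where "S = (UNIV \<times> (UNIV \<times> {-2..2}) :: ('m \<times> 'm \<times> real) set)"
  have Sm: "S \<in> sets prod3" unfolding prod3_def S_def by (intro pair_measureI) auto
  have "emeasure (\<mu> \<Otimes>\<^sub>M lborel) (UNIV \<times> {-2..2::real}) = 4"
    by (subst sigma_finite_measure.emeasure_pair_measure_Times[OF sigma_finite_lborel])
      (auto simp: nu.emeasure_space_1[simplified])
  then have S4: "emeasure prod3 S = 4"
    unfolding prod3_def S_def by (subst s2.emeasure_pair_measure_Times) (auto simp: nu'.emeasure_space_1[simplified])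
  have "weight v * ennreal (bump v) \<le> ennreal (B * 2) * indicator S v" for v
  proof (cases "v \<in> S \<and> v \<in> cover_space \<Gamma>")
    case True
    let ?z = "(fst v, fst (snd v))"
    have ne: "fst v \<noteq> fst (snd v)" using True by (auto simp: cover_space_def)
    have "\<delta> * G ?z - \<delta> * \<bar>G ?z\<bar> \<le> 0" using \<delta>_nonneg by (simp add: mult_left_mono)
    then have "exp (\<delta> * G ?z) * exp (- \<delta> * \<bar>G ?z\<bar>) \<le> 1" by (simp add: exp_add[symmetric])
    then have "d (Inr (fst v)) (Inr (fst (snd v))) * (exp (\<delta> * G ?z) * exp (- \<delta> * \<bar>G ?z\<bar>)) \<le> B * 1"
      using B by (intro mult_mono) auto
    then have "exp (\<delta> * G ?z) * rho ?z \<le> B" using ne by (simp add: rho_def mult_ac)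
    then have "exp (\<delta> * G ?z) * rho ?z * max 0 (2 - \<bar>snd (snd v)\<bar>) \<le> B * 2" using B by (intro mult_mono) auto
    then show ?thesis using True by (simp add: weight_def bump_def mult.assoc ennreal_mult[symmetric] bump_nonneg rho_nonneg ennreal_leI)
  next
    case False
    then consider "v \<notin> cover_space \<Gamma>" | "v \<notin> S" by auto
    then show ?thesis
    proof cases
      case 2
      then have "bump v = 0" by (cases v) (auto simp: S_def bump_def)
      then show ?thesis by simp
    qed (simp add: weight_def)
  qed
  then have "(\<integral>\<^sup>+v. weight v * ennreal (bump v) \<partial>prod3) \<le> (\<integral>\<^sup>+v. ennreal (B * 2) * indicator S v \<partial>prod3)"
    by (intro nn_integral_mono)
  also have "\<dots> = ennreal (B * 2) * 4" using Sm S4 by (simp add: nn_integral_cmult_indicator)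
  also have "\<dots> < \<infinity>" by (simp add: ennreal_mult_less_top)
  finally show ?thesis by (subst nn_integral_Q) auto
qed

end

section \<open>Conservativity on the cover\<close>

context GPS_flow
begin

lemma conical_measurable [measurable]: "{y. conical y} \<in> sets borel"
  by (rule conical_borel[OF shadow_borel])

text \<open>\<open>W n\<close> consists of the points of \<open>P\<close> with conical second
  endpoint that are outside \<open>P\<close> at all integer times from \<open>n\<close> on. Two
  integer times at which an orbit is in \<open>W n\<close> differ by less than \<open>n\<close>, so
  shifting each term of the series by the flow shows that the sum of \<open>bump\<close> along
  forward orbits, restricted to \<open>W n\<close>, has integral at most \<open>n + 1\<close> times
  that of \<open>bump\<close>. By recurrence its orbit sum is infinite on \<open>W n\<close>, which
  is therefore null.\<close>

theorem conservative_cover: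
  assumes P: "P \<in> sets borel" "inv_set P"
    and wander: "AE v in Q. v \<in> P \<longrightarrow> (\<exists>n::nat. \<forall>k\<ge>n. cover_flow (real k) v \<notin> P)"
  shows "emeasure Q P = 0"
proof -
  define W where "W n = {v \<in> P. conical (fst (snd v)) \<and> (\<forall>k\<ge>n. cover_flow (real k) v \<notin> P)}" for n
  have Wm [measurable]: "W n \<in> sets borel" for n
  proof -
    have "W n = P \<inter> (\<lambda>v. fst (snd v)) -` {y. conical y} \<inter> (\<Inter>k\<in>{n..}. - (cover_flow (real k) -` P))" by (auto simp: W_def)
    also have "\<dots> \<in> sets borel"
      by (intro sets.Int P(1) measurable_sets_borel[OF _ conical_measurable] borel_measurable_continuous_onI continuous_intros
          sets.countable_INT'' borel_comp measurable_sets_borel[OF cover_flow_borel P(1)]) auto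
    finally show ?thesis .
  qed
  have Wi: "inv_set (W n)" for n
    unfolding inv_set_def
  proof (intro ballI)
    fix g v assume g: "g \<in> \<Gamma>" and v: "v \<in> cover_space \<Gamma>"
    have 1: "cover_act \<sigma> g v \<in> P \<longleftrightarrow> v \<in> P" using P(2) g v by (auto simp: inv_set_def)
    have 2: "cover_flow (real k) (cover_act \<sigma> g v) \<in> P \<longleftrightarrow> cover_flow (real k) v \<in> P" for k
      unfolding cover_act_flow[symmetric] using P(2) g v by (auto simp: inv_set_def)
    have 3: "conical (fst (snd (cover_act \<sigma> g v))) \<longleftrightarrow> conical (fst (snd v))"
      using conical_act_iff[OF g] by (simp add: cover_act_def split: prod.splits)
    show "cover_act \<sigma> g v \<in> W n \<longleftrightarrow> v \<in> W n" unfolding W_def by (simp add: 1 2 3)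
  qed
  have W0: "emeasure Q (W n) = 0" for n
  proof (rule null_of_infinite[OF Wm Wi])
    let ?b = "\<lambda>v. ennreal (bump v)"
    let ?f = "\<lambda>v. (\<Sum>i. ?b (cover_flow (real i) v)) * indicator (W n) v"
    show "?f \<in> borel_measurable borel" by measurable
    have cnt: "(\<Sum>i. indicator (W n) (cover_flow (- real i) v) :: ennreal) \<le> of_nat (Suc n)" for v
    proof -
      have "(\<Sum>i. indicator {i. cover_flow (- real i) v \<in> W n} i :: ennreal) \<le> of_nat (Suc n)"
      proof (rule sum_indicator_gap)
        fix i j assume i: "i \<in> {i. cover_flow (- real i) v \<in> W n}" and j: "j \<in> {i. cover_flow (- real i) v \<in> W n}" and "i < j"
        have "cover_flow (real (j - i)) (cover_flow (- real j) v) = cover_flow (- real i) v"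
          using \<open>i < j\<close> by (simp add: cover_flow_add of_nat_diff)
        then have "cover_flow (real (j - i)) (cover_flow (- real j) v) \<in> P" using i by (simp add: W_def)
        then have "\<not> n \<le> j - i" using j by (auto simp: W_def)
        then show "j < i + Suc n" by simp
      qed simp
      then show ?thesis by (simp add: indicator_def)
    qed
    have "(\<integral>\<^sup>+v. ?f v \<partial>Q) = (\<integral>\<^sup>+v. (\<Sum>i. ?b (cover_flow (real i) v) * indicator (W n) v) \<partial>Q)"
      by (simp add: ennreal_suminf_multc)
    also have "\<dots> = (\<Sum>i. \<integral>\<^sup>+v. ?b (cover_flow (real i) v) * indicator (W n) v \<partial>Q)"
      by (rule nn_integral_suminf) measurable
    also have "\<dots> = (\<Sum>i. \<integral>\<^sup>+v. ?b v * indicator (W n) (cover_flow (- real i) v) \<partial>Q)"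
    proof (rule suminf_cong)
      fix i
      have "(\<integral>\<^sup>+v. ?b (cover_flow (real i) v) * indicator (W n) (cover_flow (- real i) (cover_flow (real i) v)) \<partial>Q)
          = (\<integral>\<^sup>+v. ?b v * indicator (W n) (cover_flow (- real i) v) \<partial>Q)"
        by (rule nn_integral_flow) measurable
      then show "(\<integral>\<^sup>+v. ?b (cover_flow (real i) v) * indicator (W n) v \<partial>Q) = (\<integral>\<^sup>+v. ?b v * indicator (W n) (cover_flow (- real i) v) \<partial>Q)"
        by (simp add: cover_flow_add)
    qed
    also have "\<dots> = (\<integral>\<^sup>+v. (\<Sum>i. ?b v * indicator (W n) (cover_flow (- real i) v)) \<partial>Q)"
      by (rule nn_integral_suminf[symmetric]) measurable
    also have "\<dots> \<le> (\<integral>\<^sup>+v. of_nat (Suc n) * ?b v \<partial>Q)"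
    proof (rule nn_integral_mono)
      fix v
      have "?b v * (\<Sum>i. indicator (W n) (cover_flow (- real i) v)) \<le> ?b v * of_nat (Suc n)"
        by (rule mult_left_mono[OF cnt]) simp
      then show "(\<Sum>i. ?b v * indicator (W n) (cover_flow (- real i) v)) \<le> of_nat (Suc n) * ?b v"
        by (simp add: ennreal_suminf_cmult mult.commute del: of_nat_Suc)
    qed
    also have "\<dots> = of_nat (Suc n) * (\<integral>\<^sup>+v. ?b v \<partial>Q)" by (rule nn_integral_cmult) measurable
    also have "\<dots> < \<infinity>" using bump_integral_finite by (simp add: ennreal_mult_less_top of_nat_less_top del: of_nat_Suc)
    finally show "(\<integral>\<^sup>+v. ?f v \<partial>Q) < \<infinity>" .
    fix v assume v: "v \<in> cover_space \<Gamma>" "v \<in> W n"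
    have "osum ?f v = osum (\<lambda>v. \<Sum>i. ?b (cover_flow (real i) v)) v * indicator (W n) v" by (rule osum_indicator[OF Wi v(1)])
    also have "osum (\<lambda>v. \<Sum>i. ?b (cover_flow (real i) v)) v = (\<Sum>i. osum ?b (cover_flow (real i) v))"
      unfolding osum_suminf osum_flow[of ?b] ..
    also have "\<dots> = \<infinity>" using v by (intro bump_recurrent) (auto simp: W_def)
    finally show "osum ?f v = \<infinity>" using v by simp
  qed
  have "AE v in Q. v \<notin> (\<Union>n. W n)"
  proof (rule AE_not_in)
    have "W n \<in> null_sets Q" for n using W0 Wm by auto
    then show "(\<Union>n. W n) \<in> null_sets Q" by auto
  qed
  with wander AE_Q_snd[OF AE_conical] have "AE v in Q. v \<notin> P"
    by eventually_elim (auto simp: W_def)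
  then show ?thesis using P(1) by (subst (asm) AE_iff_measurable[of P]) auto
qed

end

section \<open>The Hopf argument\<close>

text \<open>The approximable sets contain the closed sets and are stable under complements and
  countable disjoint unions, so they include the Borel sets. The error is a nonnegative integral,
  which avoids integrability conditions.\<close>

lemma continuous_approx_indicator:
  fixes M :: "'a::metric_space measure"
  assumes sM [measurable_cong, simp]: "sets M = sets borel" and fin: "emeasure M UNIV < \<infinity>" and A: "A \<in> sets borel" and e: "e > 0"
  shows "\<exists>c. continuous_on UNIV c \<and> (\<forall>z. 0 \<le> c z \<and> c z \<le> 1) \<and> (\<integral>\<^sup>+z. ennreal \<bar>c z - indicator A z\<bar> \<partial>M) < ennreal e"
proof -
  have UM: "space M = UNIV" using sets_eq_imp_space_eq[OF sM] by simp
  have fin': "emeasure M B \<noteq> \<infinity>" for B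
    using emeasure_space[of M B] fin UM by (auto simp: top_unique)
  define P where "P A \<longleftrightarrow> (\<forall>e>0. \<exists>c. continuous_on UNIV c \<and> (\<forall>z. 0 \<le> c z \<and> c z \<le> (1::real)) \<and>
      (\<integral>\<^sup>+z. ennreal \<bar>c z - indicator A z\<bar> \<partial>M) < ennreal e)" for A
  have small: "\<exists>n. emeasure M (B n) < ennreal e" if B: "\<And>n. B n \<in> sets borel" "decseq B" "(\<Inter>n. B n) = {}" "e > 0" for B :: "nat \<Rightarrow> 'a set" and e :: real
  proof -
    have "(\<lambda>n. emeasure M (B n)) \<longlonglongrightarrow> emeasure M (\<Inter>n. B n)"
      using B fin' by (intro Lim_emeasure_decseq) auto
    then have "(\<lambda>n. emeasure M (B n)) \<longlonglongrightarrow> 0" by (simp add: B(3))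
    then have "\<forall>\<^sub>F n in sequentially. emeasure M (B n) < ennreal e" using B(4) by (intro order_tendstoD(2)) auto
    then show ?thesis by (auto simp: eventually_sequentially)
  qed
  have "Int_stable (Collect closed :: 'a set set)" "Collect closed \<subseteq> Pow (UNIV :: 'a set)" by (auto simp: Int_stable_def)
  moreover have "A \<in> sigma_sets UNIV (Collect closed)" using A unfolding borel_eq_closed by simp
  ultimately have "P A"
  proof (induction rule: sigma_sets_induct_disjoint)
    case (basic F)
    then have F: "closed F" by simp
    show ?case unfolding P_def
    proof (intro allI impI)
      fix e :: real assume e: "e > 0"
      show "\<exists>c. continuous_on UNIV c \<and> (\<forall>z. 0 \<le> c z \<and> c z \<le> (1::real)) \<and> (\<integral>\<^sup>+z. ennreal \<bar>c z - indicator F z\<bar> \<partial>M) < ennreal e"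
      proof (cases "F = {}")
        case True
        then show ?thesis using e by (intro exI[of _ "\<lambda>_. 0"]) simp
      next
        case False
        define B where "B n = {z. infdist z F < inverse (Suc n)} - F" for n
        have "open {z. infdist z F < inverse (Suc n)}" for n by (intro open_Collect_less continuous_intros)
        then have Bm: "B n \<in> sets borel" for n unfolding B_def using F by (intro sets.Diff) auto
        have "decseq B"
          unfolding decseq_Suc_iff B_def
        proof (intro allI Diff_mono subsetI order_refl)
          fix n z assume "z \<in> {z. infdist z F < inverse (real (Suc (Suc n)))}"
          moreover have "inverse (real (Suc (Suc n))) \<le> inverse (real (Suc n))" by (intro le_imp_inverse_le) auto
          ultimately show "z \<in> {z. infdist z F < inverse (real (Suc n))}" unfolding mem_Collect_eq by (rule less_le_trans)
        qed
        moreover have "(\<Inter>n. B n) = {}"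
        proof (rule ccontr)
          assume "(\<Inter>n. B n) \<noteq> {}"
          then obtain z where z: "\<And>n. z \<in> B n" by blast
          then have "infdist z F > 0" using infdist_pos_not_in_closed[OF F False] by (auto simp: B_def)
          from reals_Archimedean[OF this] obtain n where "inverse (real (Suc n)) < infdist z F" by auto
          then show False using z[of n] by (simp add: B_def)
        qed
        ultimately obtain n where n: "emeasure M (B n) < ennreal e" using small[of B, OF Bm _ _ e] by auto
        \<comment> \<open>Equal to 1 on \<open>F\<close> and to 0 outside
          \<open>F \<union> B n\<close>, so that it differs from the indicator only on
          \<open>B n\<close>.\<close>
        define c where "c z = max 0 (1 - real (Suc n) * infdist z F)" for z
        have "\<bar>c z - indicator F z\<bar> \<le> indicator (B n) z" for z
        proof (cases "z \<in> F")
          case True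
          then show ?thesis by (simp add: c_def)
        next
          case False
          then show ?thesis
          proof (cases "z \<in> B n")
            case True
            then show ?thesis using False by (auto simp: c_def infdist_nonneg)
          next
            case nB: False
            then have "infdist z F \<ge> inverse (real (Suc n))" using False by (auto simp: B_def)
            then have "real (Suc n) * infdist z F \<ge> real (Suc n) * inverse (real (Suc n))" by (intro mult_left_mono) auto
            then have "c z = 0" unfolding c_def by (simp del: of_nat_Suc)
            then show ?thesis using False by simp
          qed
        qed
        then have "(\<integral>\<^sup>+z. ennreal \<bar>c z - indicator F z\<bar> \<partial>M) \<le> (\<integral>\<^sup>+z. indicator (B n) z \<partial>M)"
          by (intro nn_integral_mono) (auto simp: ennreal_indicator[symmetric] intro!: ennreal_leI)
        also have "\<dots> < ennreal e" using n Bm by simp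
        finally have "(\<integral>\<^sup>+z. ennreal \<bar>c z - indicator F z\<bar> \<partial>M) < ennreal e" .
        moreover have "continuous_on UNIV c" unfolding c_def by (intro continuous_intros)
        moreover have "0 \<le> c z \<and> c z \<le> 1" for z by (auto simp: c_def infdist_nonneg)
        ultimately show ?thesis by blast
      qed
    qed
  next
    case empty
    show ?case unfolding P_def
    proof (intro allI impI)
      fix e :: real assume "e > 0"
      then show "\<exists>c. continuous_on UNIV c \<and> (\<forall>z. 0 \<le> c z \<and> c z \<le> (1::real)) \<and> (\<integral>\<^sup>+z. ennreal \<bar>c z - indicator {} z\<bar> \<partial>M) < ennreal e"
        by (intro exI[of _ "\<lambda>_. 0"]) simp
    qed
  next
    case (compl A)
    show ?case unfolding P_def
    proof (intro allI impI)
      fix e :: real assume "e > 0"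
      then obtain c where c: "continuous_on UNIV c" "\<forall>z. 0 \<le> c z \<and> c z \<le> (1::real)" "(\<integral>\<^sup>+z. ennreal \<bar>c z - indicator A z\<bar> \<partial>M) < ennreal e"
        using compl(2) unfolding P_def by blast
      have "\<bar>(1 - c z) - indicator (UNIV - A) z\<bar> = \<bar>c z - indicator A z\<bar>" for z by (auto simp: indicator_def)
      then show "\<exists>c. continuous_on UNIV c \<and> (\<forall>z. 0 \<le> c z \<and> c z \<le> (1::real)) \<and> (\<integral>\<^sup>+z. ennreal \<bar>c z - indicator (UNIV - A) z\<bar> \<partial>M) < ennreal e"
        using c by (intro exI[of _ "\<lambda>z. 1 - c z"] conjI) (auto intro!: continuous_intros)
    qed
  next
    case (union A)
    have Am: "A i \<in> sets borel" for i using union(2) unfolding borel_eq_closed by auto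
    show ?case unfolding P_def
    proof (intro allI impI)
      fix e :: real assume e: "e > 0"
      define B where "B n = (\<Union>i\<in>{n..}. A i)" for n
      have Bm: "B n \<in> sets borel" for n unfolding B_def using Am by (intro sets.countable_UN'') auto
      have "decseq B" unfolding decseq_def B_def by (intro allI impI UN_mono) auto
      moreover have "(\<Inter>n. B n) = {}"
      proof (rule ccontr)
        assume "(\<Inter>n. B n) \<noteq> {}"
        then obtain z where z: "\<And>n. z \<in> B n" by blast
        obtain i where i: "z \<in> A i" using z[of 0] by (auto simp: B_def)
        obtain j where "j \<ge> Suc i" "z \<in> A j" using z[of "Suc i"] by (auto simp: B_def)
        then show False using i disjoint_family_onD[OF union(1), of i j] by auto
      qed
      moreover have "e/2 > 0" using e by simp
      ultimately obtain n where n: "emeasure M (B n) < ennreal (e/2)" using small[of B "e/2", OF Bm] by blast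
      \<comment> \<open>The \<open>n\<close> approximations together use at most \<open>e/2\<close>;
        \<open>Suc\<close> guards against \<open>n = 0\<close>.\<close>
      define e' where "e' = e / (2 * real (Suc n))"
      have e': "e' > 0" using e by (simp add: e'_def)
      have "\<forall>i. \<exists>c. continuous_on UNIV c \<and> (\<forall>z. 0 \<le> c z \<and> c z \<le> (1::real)) \<and> (\<integral>\<^sup>+z. ennreal \<bar>c z - indicator (A i) z\<bar> \<partial>M) < ennreal e'"
        using union(3) e' unfolding P_def by blast
      from choice[OF this] obtain c where c: "\<And>i. continuous_on UNIV (c i)" "\<And>i z. 0 \<le> c i z" "\<And>i z. c i z \<le> (1::real)"
        "\<And>i. (\<integral>\<^sup>+z. ennreal \<bar>c i z - indicator (A i) z\<bar> \<partial>M) < ennreal e'" by auto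
      have [measurable]: "c i \<in> borel_measurable borel" for i using c(1) by (rule borel_measurable_continuous_onI)
      note Am [measurable] Bm [measurable]
      define C where "C z = min 1 (\<Sum>i<n. c i z)" for z
      have bd: "\<bar>C z - indicator (\<Union>i. A i) z\<bar> \<le> (\<Sum>i<n. \<bar>c i z - indicator (A i) z\<bar>) + indicator (B n) z" for z
      proof (cases "z \<in> B n")
        case True
        have "0 \<le> C z" "C z \<le> 1" unfolding C_def using c(2) by (auto intro: sum_nonneg)
        then have "\<bar>C z - indicator (\<Union>i. A i) z\<bar> \<le> 1" by (auto simp: indicator_def)
        then show ?thesis using True by (simp add: add_increasing sum_nonneg)
      next
        case False
        have eq: "indicator (\<Union>i. A i) z = (\<Sum>i<n. indicator (A i) z :: real)"
        proof (cases "z \<in> (\<Union>i. A i)")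
          case True
          then obtain i where i: "z \<in> A i" by auto
          then have "i < n" using False by (auto simp: B_def not_le[symmetric])
          have "(\<Sum>j<n. indicator (A j) z :: real) = (\<Sum>j<n. if j = i then 1 else 0)"
            using i disjoint_family_onD[OF union(1), of _ i] by (intro sum.cong) (auto simp: indicator_def)
          then show ?thesis using True \<open>i < n\<close> by simp
        qed (auto simp: indicator_def)
        have "\<bar>min 1 S - I\<bar> \<le> \<bar>S - I\<bar>" if "I \<le> 1" for S I :: real using that by auto
        from this[of "indicator (\<Union>i. A i) z" "\<Sum>i<n. c i z"]
        have "\<bar>C z - indicator (\<Union>i. A i) z\<bar> \<le> \<bar>(\<Sum>i<n. c i z) - (\<Sum>i<n. indicator (A i) z)\<bar>"
          unfolding C_def eq[symmetric] by (simp add: indicator_le_1)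
        also have "\<dots> \<le> (\<Sum>i<n. \<bar>c i z - indicator (A i) z\<bar>)" unfolding sum_subtractf[symmetric] by (rule sum_abs)
        finally show ?thesis using False by simp
      qed
      have "(\<integral>\<^sup>+z. ennreal \<bar>C z - indicator (\<Union>i. A i) z\<bar> \<partial>M) \<le> (\<integral>\<^sup>+z. (\<Sum>i<n. ennreal \<bar>c i z - indicator (A i) z\<bar>) + indicator (B n) z \<partial>M)"
      proof (rule nn_integral_mono)
        fix z
        have "ennreal \<bar>C z - indicator (\<Union>i. A i) z\<bar> \<le> ennreal ((\<Sum>i<n. \<bar>c i z - indicator (A i) z\<bar>) + indicator (B n) z)"
          using bd by (rule ennreal_leI)
        also have "\<dots> = (\<Sum>i<n. ennreal \<bar>c i z - indicator (A i) z\<bar>) + indicator (B n) z"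
          by (subst ennreal_plus) (auto simp: sum_nonneg sum_ennreal ennreal_indicator)
        finally show "ennreal \<bar>C z - indicator (\<Union>i. A i) z\<bar> \<le> (\<Sum>i<n. ennreal \<bar>c i z - indicator (A i) z\<bar>) + indicator (B n) z" .
      qed
      also have "\<dots> = (\<integral>\<^sup>+z. (\<Sum>i<n. ennreal \<bar>c i z - indicator (A i) z\<bar>) \<partial>M) + (\<integral>\<^sup>+z. indicator (B n) z \<partial>M)"
        by (rule nn_integral_add) measurable
      also have "(\<integral>\<^sup>+z. (\<Sum>i<n. ennreal \<bar>c i z - indicator (A i) z\<bar>) \<partial>M) = (\<Sum>i<n. \<integral>\<^sup>+z. ennreal \<bar>c i z - indicator (A i) z\<bar> \<partial>M)"
        by (rule nn_integral_sum) measurable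
      also have "\<dots> \<le> (\<Sum>i<n. ennreal e')" using c(4) by (intro sum_mono less_imp_le)
      also have "\<dots> = ennreal (real n * e')" using e' by (simp add: ennreal_of_nat_eq_real_of_nat ennreal_mult)
      also have "\<dots> \<le> ennreal (e/2)" using e by (intro ennreal_leI) (simp add: e'_def field_simps)
      also have "(\<integral>\<^sup>+z. indicator (B n) z \<partial>M) = emeasure M (B n)" by simp
      finally have "(\<integral>\<^sup>+z. ennreal \<bar>C z - indicator (\<Union>i. A i) z\<bar> \<partial>M) \<le> ennreal (e/2) + emeasure M (B n)"
        by (simp add: add_mono)
      also have "\<dots> < ennreal e"
      proof -
        obtain b where b: "emeasure M (B n) = ennreal b" "b \<ge> 0" using n by (cases "emeasure M (B n)") auto
        then have "b < e/2" using n by (simp add: ennreal_less_iff)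
        then have lt: "ennreal (e/2 + b) < ennreal e" using b e by (intro ennreal_lessI) auto
        have eq: "ennreal (e/2) + ennreal b = ennreal (e/2 + b)" using b e by simp
        show ?thesis unfolding b(1) eq by (rule lt)
      qed
      finally have "(\<integral>\<^sup>+z. ennreal \<bar>C z - indicator (\<Union>i. A i) z\<bar> \<partial>M) < ennreal e" .
      moreover have "continuous_on UNIV C" unfolding C_def by (intro continuous_intros c(1))
      moreover have "0 \<le> C z \<and> C z \<le> 1" for z unfolding C_def using c(2) by (auto intro: sum_nonneg)
      ultimately show "\<exists>c. continuous_on UNIV c \<and> (\<forall>z. 0 \<le> c z \<and> c z \<le> (1::real)) \<and> (\<integral>\<^sup>+z. ennreal \<bar>c z - indicator (\<Union>i. A i) z\<bar> \<partial>M) < ennreal e" by blast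
    qed
  qed
  then show ?thesis using e unfolding P_def by blast
qed

section \<open>Comparison of forward orbits with a common endpoint\<close>

context GPS_conformal
begin

text \<open>Subtracting \<eta> makes this vanish unless \<open>bump\<close> exceeds \<eta>. An
  additive error \<open>\<epsilon> * \<eta>\<close> can then be charged to
  \<open>\<epsilon> * bump\<close>, and the sum of all such errors stays a small multiple of the sum
  of \<open>bump\<close>.\<close>

definition cut :: "('m \<times> 'm \<Rightarrow> real) \<Rightarrow> real \<Rightarrow> 'm \<times> 'm \<times> real \<Rightarrow> real" where
  "cut c \<eta> v = c (fst v, fst (snd v)) * max 0 (bump v - \<eta>)"

text \<open>Dominates what \<open>bump\<close> exceeds \<open>cut\<close> by over \<open>A\<close>,
  and \<open>cut\<close> itself outside \<open>A\<close>.\<close>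

definition err :: "('m \<times> 'm \<Rightarrow> real) \<Rightarrow> ('m \<times> 'm) set \<Rightarrow> real \<Rightarrow> 'm \<times> 'm \<times> real \<Rightarrow> real" where
  "err c A \<eta> v = \<bar>c (fst v, fst (snd v)) - indicator A (fst v, fst (snd v))\<bar> * bump v + min (bump v) \<eta>"

lemma cut_modulus:
  assumes c: "continuous_on UNIV c" "\<And>z. 0 \<le> c z" "\<And>z. c z \<le> 1" and e: "e > 0" and \<eta>: "\<eta> > 0"
  shows "\<exists>s>0. \<forall>x x' y t. d (Inr x) (Inr x') < s \<longrightarrow> \<bar>cut c \<eta> (x, y, t) - cut c \<eta> (x', y, t)\<bar> \<le> e"
proof -
  obtain K where K: "\<forall>v. bump v \<le> K" using bump_bounded by auto
  define R where "R = \<bar>K\<bar>"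
  have R: "bump v \<le> R" "R \<ge> 0" for v using K[rule_format, of v] by (auto simp: R_def)
  \<comment> \<open>In the product, the change of \<open>c\<close> is weighted by at most
    \<open>R\<close>, and that of \<open>rho\<close> by at most 2, the maximum of the time
    factor.\<close>
  define e1 where "e1 = e / (R + 2)"
  have e1: "e1 > 0" using e R(2) by (simp add: e1_def)
  have cM: "compact (UNIV :: ('m \<times> 'm) set)" using compact_Times[OF compact_M compact_M] by simp
  obtain s1 where s1: "s1 > 0" "\<And>z z'. dist z' z < s1 \<Longrightarrow> dist (c z') (c z) < e1"
    using compact_uniformly_continuous[OF c(1) cM] e1 unfolding uniformly_continuous_on_def by (metis UNIV_I)
  obtain s2 where s2: "s2 > 0" "\<And>z z'. dist z' z < s2 \<Longrightarrow> dist (rho z') (rho z) < e1"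
    using compact_uniformly_continuous[OF rho_cont cM] e1 unfolding uniformly_continuous_on_def by (metis UNIV_I)
  have "min s1 s2 > 0" using s1 s2 by simp
  then obtain s where s: "s > 0" "\<forall>x y. d (Inr x) (Inr y) < s \<longrightarrow> dist x y < min s1 s2" using D_uniform by blast
  have key: "\<bar>cut c \<eta> (x, y, t) - cut c \<eta> (x', y, t)\<bar> \<le> e" if "d (Inr x) (Inr x') < s" for x x' y t
  proof -
    have "dist x x' < min s1 s2" using s(2) that by blast
    then have "dist (x, y) (x', y) < s1" "dist (x, y) (x', y) < s2" by (auto simp: dist_Pair_Pair)
    then have ce: "\<bar>c (x, y) - c (x', y)\<bar> \<le> e1" and re: "\<bar>rho (x, y) - rho (x', y)\<bar> \<le> e1"
      using s1(2)[of "(x, y)" "(x', y)"] s2(2)[of "(x, y)" "(x', y)"] by (auto simp: dist_real_def)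
    define \<tau> where "\<tau> = max 0 (2 - \<bar>t\<bar>)"
    have \<tau>: "0 \<le> \<tau>" "\<tau> \<le> 2" by (auto simp: \<tau>_def)
    define m m' where "m = max 0 (rho (x, y) * \<tau> - \<eta>)" and "m' = max 0 (rho (x', y) * \<tau> - \<eta>)"
    have "rho (x, y) * \<tau> \<le> R" using R(1)[of "(x, y, t)"] by (simp add: bump_def \<tau>_def)
    then have m: "0 \<le> m" "m \<le> R" using R(2) \<eta> by (auto simp: m_def)
    have "\<bar>m - m'\<bar> \<le> \<bar>rho (x, y) * \<tau> - rho (x', y) * \<tau>\<bar>" by (auto simp: m_def m'_def)
    also have "\<dots> = \<bar>rho (x, y) - rho (x', y)\<bar> * \<tau>" using \<tau> by (simp add: left_diff_distrib[symmetric] abs_mult)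
    also have "\<dots> \<le> e1 * 2" using re \<tau> e1 by (intro mult_mono) auto
    finally have mm: "\<bar>m - m'\<bar> \<le> e1 * 2" .
    have "\<bar>c (x, y) * m - c (x', y) * m'\<bar> = \<bar>(c (x, y) - c (x', y)) * m + c (x', y) * (m - m')\<bar>" by (simp add: algebra_simps)
    also have "\<dots> \<le> \<bar>c (x, y) - c (x', y)\<bar> * m + c (x', y) * \<bar>m - m'\<bar>"
      using m c(2) by (metis abs_mult abs_of_nonneg abs_triangle_ineq)
    also have "\<dots> \<le> e1 * R + 1 * (e1 * 2)"
      using ce m mm e1 c by (intro add_mono mult_mono) auto
    also have "\<dots> = e1 * (R + 2)" by (simp add: algebra_simps)
    also have "\<dots> = e" using R(2) by (simp add: e1_def)
    finally have "\<bar>c (x, y) * m - c (x', y) * m'\<bar> \<le> e" .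
    moreover have "cut c \<eta> (x, y, t) = c (x, y) * m" "cut c \<eta> (x', y, t) = c (x', y) * m'"
      unfolding cut_def bump_def fst_conv snd_conv m_def m'_def \<tau>_def by (rule refl)+
    ultimately show ?thesis by (simp only:)
  qed
  show ?thesis by (intro exI[of _ s] conjI allI impI s(1) key)
qed

text \<open>Forward orbits of two points with the same \<open>y\<close> and \<open>t\<close> become asymptotic, because \<open>\<gamma>\<close>
  contracts the first coordinates together outside finitely many \<open>\<gamma>\<close>.\<close>

lemma hopf_compare:
  assumes c: "continuous_on UNIV c" "\<And>z. 0 \<le> c z" "\<And>z. c z \<le> 1" and \<epsilon>: "\<epsilon> > 0" and \<eta>: "\<eta> > 0"
    and xy: "x \<noteq> y" "x' \<noteq> y"
  shows "\<exists>B\<ge>0. \<forall>n. tsum n (\<lambda>v. ennreal (cut c \<eta> v)) (x, y, t) \<le> tsum n (\<lambda>v. ennreal (cut c \<eta> v)) (x', y, t) +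
      ennreal \<epsilon> * tsum n (\<lambda>v. ennreal (bump v)) (x, y, t) + ennreal B"
proof -
  let ?\<phi> = "cut c \<eta>" and ?v = "(x, y, t)" and ?v' = "(x', y, t)"
  obtain K where K: "\<forall>v. bump v \<le> K" using bump_bounded by auto
  have K0: "K \<ge> 0" using K[rule_format, of ?v] bump_nonneg[of ?v] by linarith
  have \<phi>K: "?\<phi> v \<le> K" and \<phi>0: "?\<phi> v \<ge> 0" for v
  proof -
    have "?\<phi> v \<le> 1 * max 0 (bump v - \<eta>)" unfolding cut_def by (intro mult_right_mono c) auto
    then show "?\<phi> v \<le> K" using K[rule_format, of v] K0 \<eta> by auto
    show "?\<phi> v \<ge> 0" unfolding cut_def using c by simp
  qed
  have "\<epsilon> * \<eta> > 0" using \<epsilon> \<eta> by simp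
  from cut_modulus[OF c this \<eta>] obtain s where s: "s > 0"
    "\<forall>x x' y t. d (Inr x) (Inr x') < s \<longrightarrow> \<bar>?\<phi> (x, y, t) - ?\<phi> (x', y, t)\<bar> \<le> \<epsilon> * \<eta>" by auto
  define e where "e = min (s/2) (min (d (Inr x) (Inr y) / 3) (d (Inr x') (Inr y) / 3))"
  have pos: "d (Inr x) (Inr y) > 0" "d (Inr x') (Inr y) > 0" using xy by (auto simp: ms.mdist_pos_eq)
  then have e: "e > 0" "2 * e \<le> s" "3 * e \<le> d (Inr x) (Inr y)" "3 * e \<le> d (Inr x') (Inr y)" using s(1) by (auto simp: e_def)
  obtain F where F: "finite F" "\<forall>g\<in>\<Gamma> - F. \<forall>p\<in>X. d p (Inl (inv g)) > e \<longrightarrow> d (act g p) (Inl g) < e"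
    using contraction[OF e(1)] by auto
  obtain C where C: "\<forall>g\<in>\<Gamma>. \<forall>x. d (Inr x) (Inl (inv g)) > e \<longrightarrow> \<bar>\<sigma> g x - N g\<bar> \<le> C" using mag[OF e(1)] by auto
  \<comment> \<open>If \<gamma> is outside \<open>F0\<close> and its term is nonzero, the time
    coordinate is below 2, so \<sigma> at \<open>y\<close> falls short of the magnitude by more than
    \<open>C\<close>. Thus \<open>y\<close> is within \<open>e\<close> of \<open>inv g\<close>, and
    \<open>x\<close> and \<open>x'\<close>, at least \<open>3 * e\<close> from \<open>y\<close>, are
    where \<open>g\<close> contracts.\<close>
  define F0 where "F0 = (F \<inter> \<Gamma>) \<union> {g\<in>\<Gamma>. N g \<le> 2 - t + C}"
  have F0: "finite F0" "F0 \<subseteq> \<Gamma>" using F(1) finite_N by (auto simp: F0_def)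
  have late: "?\<phi> (cover_act \<sigma> g (cover_flow (real i) ?v)) = 0" if "t + real i + \<sigma> g y \<ge> 2" for g i
    using that \<eta> by (simp add: cut_def bump_def cover_act_def cover_flow_def)
  have main: "?\<phi> (cover_act \<sigma> g (cover_flow (real i) ?v)) \<le> ?\<phi> (cover_act \<sigma> g (cover_flow (real i) ?v')) + \<epsilon> * bump (cover_act \<sigma> g (cover_flow (real i) ?v))"
    if g: "g \<in> \<Gamma> - F0" for g i
  proof -
    let ?u = "cover_act \<sigma> g (cover_flow (real i) ?v)" and ?u' = "cover_act \<sigma> g (cover_flow (real i) ?v')"
    have gG: "g \<in> \<Gamma>" and gF: "g \<in> \<Gamma> - F" and Ng: "N g > 2 - t + C" using g by (auto simp: F0_def)
    show ?thesis
    proof (cases "?\<phi> ?u = 0")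
      case True
      then show ?thesis using \<phi>0[of ?u'] bump_nonneg[of ?u] \<epsilon> by simp
    next
      case False
      then have tm: "t + real i + \<sigma> g y < 2" using late[of i g] by linarith
      have near: "d (Inr y) (Inl (inv g)) \<le> e"
      proof (rule ccontr)
        assume "\<not> ?thesis"
        then have "\<bar>\<sigma> g y - N g\<bar> \<le> C" using C gG by auto
        then show False using tm Ng by linarith
      qed
      have tri: "d (Inr z) (Inr y) \<le> d (Inr z) (Inl (inv g)) + d (Inl (inv g)) (Inr y)" for z
        using gG by (intro ms.triangle) auto
      have "d (Inr x) (Inl (inv g)) > e" "d (Inr x') (Inl (inv g)) > e"
        using near e tri[of x] tri[of x'] ms.commute[of "Inl (inv g)" "Inr y"] by linarith+
      then have "d (act g (Inr x)) (Inl g) < e" "d (act g (Inr x')) (Inl g) < e"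
        using bspec[OF bspec[OF F(2) gF], of "Inr x"] bspec[OF bspec[OF F(2) gF], of "Inr x'"] by auto
      moreover have "d (Inr (g x)) (Inr (g x')) \<le> d (Inr (g x)) (Inl g) + d (Inl g) (Inr (g x'))"
        using gG by (intro ms.triangle) auto
      ultimately have "d (Inr (g x)) (Inr (g x')) < s" using e(2) ms.commute[of "Inl g" "Inr (g x')"] by simp
      then have "\<bar>?\<phi> ?u - ?\<phi> ?u'\<bar> \<le> \<epsilon> * \<eta>" using s(2) by (simp add: cover_act_def cover_flow_def)
      moreover have "\<eta> \<le> bump ?u" using False unfolding cut_def by (auto simp: max_def split: if_splits)
      then have "\<epsilon> * \<eta> \<le> \<epsilon> * bump ?u" using \<epsilon> by simp
      ultimately show ?thesis by linarith
    qed
  qed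
  \<comment> \<open>An exceptional element contributes only until its time coordinate reaches 2. The
    finitely many of them have a common last step \<open>i0\<close>, so their total contribution is
    bounded independently of \<open>n\<close>.\<close>
  have "\<exists>b. \<forall>g\<in>F0. \<forall>z::unit. 2 - t - \<sigma> g y \<le> b" by (rule finite_uniform_bound[OF F0(1)]) auto
  then obtain b where b: "\<forall>g\<in>F0. 2 - t - \<sigma> g y \<le> b" by auto
  obtain i0 :: nat where i0: "b \<le> real i0" using real_arch_simple by auto
  define B where "B = real i0 * (K * real (card F0))"
  have ineq: "ennreal (?\<phi> (cover_act \<sigma> g (cover_flow (real i) ?v))) \<le>
      (ennreal (?\<phi> (cover_act \<sigma> g (cover_flow (real i) ?v'))) + ennreal \<epsilon> * ennreal (bump (cover_act \<sigma> g (cover_flow (real i) ?v)))) +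
      (if i < i0 then ennreal K * indicator F0 g else 0)" if "g \<in> \<Gamma>" for g i
  proof (cases "g \<in> F0")
    case False
    then have "ennreal (?\<phi> (cover_act \<sigma> g (cover_flow (real i) ?v))) \<le> ennreal (?\<phi> (cover_act \<sigma> g (cover_flow (real i) ?v')) + \<epsilon> * bump (cover_act \<sigma> g (cover_flow (real i) ?v)))"
      using main that by (intro ennreal_leI) auto
    then show ?thesis using \<phi>0 bump_nonneg \<epsilon> False by (simp add: ennreal_plus ennreal_mult)
  next
    case True
    show ?thesis
    proof (cases "i < i0")
      case True
      then show ?thesis using \<open>g \<in> F0\<close> \<phi>K by (simp add: add_increasing ennreal_leI)
    next
      case False
      have "2 - t - \<sigma> g y \<le> b" using b \<open>g \<in> F0\<close> by blast
      then have "t + real i + \<sigma> g y \<ge> 2" using False i0 by linarith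
      then show ?thesis using late by simp
    qed
  qed
  have "tsum n (\<lambda>v. ennreal (?\<phi> v)) ?v \<le> tsum n (\<lambda>v. ennreal (?\<phi> v)) ?v' + ennreal \<epsilon> * tsum n (\<lambda>v. ennreal (bump v)) ?v + ennreal B" for n
  proof -
    have "tsum n (\<lambda>v. ennreal (?\<phi> v)) ?v \<le> (\<Sum>i<n. (osum (\<lambda>v. ennreal (?\<phi> v)) (cover_flow (real i) ?v') + ennreal \<epsilon> * osum (\<lambda>v. ennreal (bump v)) (cover_flow (real i) ?v)) +
        (if i < i0 then ennreal K * of_nat (card F0) else 0))"
      unfolding tsum_def
    proof (rule sum_mono)
      fix i
      have "osum (\<lambda>v. ennreal (?\<phi> v)) (cover_flow (real i) ?v) \<le> (\<integral>\<^sup>+g. (ennreal (?\<phi> (cover_act \<sigma> g (cover_flow (real i) ?v'))) + ennreal \<epsilon> * ennreal (bump (cover_act \<sigma> g (cover_flow (real i) ?v)))) +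
          (if i < i0 then ennreal K * indicator F0 g else 0) \<partial>count_space \<Gamma>)"
        unfolding osum_def using ineq by (intro nn_integral_mono) auto
      also have "\<dots> = (osum (\<lambda>v. ennreal (?\<phi> v)) (cover_flow (real i) ?v') + ennreal \<epsilon> * osum (\<lambda>v. ennreal (bump v)) (cover_flow (real i) ?v)) +
        (\<integral>\<^sup>+g. (if i < i0 then ennreal K * indicator F0 g else 0) \<partial>count_space \<Gamma>)"
        unfolding osum_def by (simp add: nn_integral_add nn_integral_cmult)
      also have "(\<integral>\<^sup>+g. (if i < i0 then ennreal K * indicator F0 g else 0) \<partial>count_space \<Gamma>) = (if i < i0 then ennreal K * of_nat (card F0) else 0)"
        using F0 by (simp add: nn_integral_cmult_indicator emeasure_count_space)
      finally show "osum (\<lambda>v. ennreal (?\<phi> v)) (cover_flow (real i) ?v) \<le> (osum (\<lambda>v. ennreal (?\<phi> v)) (cover_flow (real i) ?v') + ennreal \<epsilon> * osum (\<lambda>v. ennreal (bump v)) (cover_flow (real i) ?v)) +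
        (if i < i0 then ennreal K * of_nat (card F0) else 0)" .
    qed
    also have "\<dots> = tsum n (\<lambda>v. ennreal (?\<phi> v)) ?v' + ennreal \<epsilon> * tsum n (\<lambda>v. ennreal (bump v)) ?v + (\<Sum>i<n. if i < i0 then ennreal K * of_nat (card F0) else 0)"
      unfolding tsum_def by (simp add: sum.distrib sum_distrib_left)
    also have "(\<Sum>i<n. if i < i0 then ennreal K * of_nat (card F0) else 0) \<le> ennreal B"
    proof -
      have "(\<Sum>i<n. if i < i0 then ennreal K * of_nat (card F0) else 0) = (\<Sum>i\<in>{..<n} \<inter> {i. i < i0}. ennreal K * of_nat (card F0))"
        by (subst sum.inter_restrict) auto
      also have "\<dots> \<le> (\<Sum>i\<in>{..<i0}. ennreal K * of_nat (card F0))" by (intro sum_mono2) auto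
      also have "\<dots> = ennreal B" using K0 by (simp add: B_def ennreal_mult ennreal_of_nat_eq_real_of_nat)
      finally show ?thesis .
    qed
    finally show ?thesis by (simp add: add_left_mono)
  qed
  moreover have "B \<ge> 0" using K0 by (simp add: B_def)
  ultimately show ?thesis by blast
qed

text \<open>Translates of the first point have endpoints in \<open>A\<close>, so the sum of
  \<open>bump\<close> is at most that of \<open>cut\<close> plus that of \<open>err\<close>.
  \<open>hopf_compare\<close> passes to the second point, whose translates have endpoints outside
  \<open>A\<close>, and there \<open>cut\<close> is bounded by \<open>err\<close>.\<close>

lemma hopf_half:
  assumes c: "continuous_on UNIV c" "\<And>z. 0 \<le> c z" "\<And>z. c z \<le> 1" and \<epsilon>: "\<epsilon> > 0" and \<eta>: "\<eta> > 0"
    and xy: "x \<noteq> y" "x' \<noteq> y"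
    and A: "\<And>g. g \<in> \<Gamma> \<Longrightarrow> (g x, g y) \<in> A" "\<And>g. g \<in> \<Gamma> \<Longrightarrow> (g x', g y) \<notin> A"
  shows "\<exists>B\<ge>0. \<forall>n. tsum n (\<lambda>v. ennreal (bump v)) (x, y, t) \<le> tsum n (\<lambda>v. ennreal (err c A \<eta> v)) (x', y, t) +
      ennreal \<epsilon> * tsum n (\<lambda>v. ennreal (bump v)) (x, y, t) + ennreal B + tsum n (\<lambda>v. ennreal (err c A \<eta> v)) (x, y, t)"
proof -
  let ?v = "(x, y, t)" and ?v' = "(x', y, t)"
  obtain B where B: "B \<ge> 0" "\<And>n. tsum n (\<lambda>v. ennreal (cut c \<eta> v)) ?v \<le> tsum n (\<lambda>v. ennreal (cut c \<eta> v)) ?v' +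
      ennreal \<epsilon> * tsum n (\<lambda>v. ennreal (bump v)) ?v + ennreal B" using hopf_compare[OF c \<epsilon> \<eta> xy, of t] by auto
  have "tsum n (\<lambda>v. ennreal (bump v)) ?v \<le> tsum n (\<lambda>v. ennreal (err c A \<eta> v)) ?v' +
      ennreal \<epsilon> * tsum n (\<lambda>v. ennreal (bump v)) ?v + ennreal B + tsum n (\<lambda>v. ennreal (err c A \<eta> v)) ?v" for n
  proof -
    have "tsum n (\<lambda>v. ennreal (bump v)) ?v \<le> tsum n (\<lambda>v. ennreal (cut c \<eta> v) + ennreal (err c A \<eta> v)) ?v"
      unfolding tsum_def
    proof (intro sum_mono osum_mono)
      fix g i assume g: "g \<in> \<Gamma>"
      let ?u = "cover_act \<sigma> g (cover_flow (real i) ?v)"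
      define z where "z = (fst ?u, fst (snd ?u))"
      have zA: "z \<in> A" using A(1)[OF g] by (simp add: z_def cover_act_def cover_flow_def)
      have "bump ?u \<le> cut c \<eta> ?u + err c A \<eta> ?u"
      proof (cases "bump ?u \<ge> \<eta>")
        case True
        have "c z * \<eta> \<le> 1 * \<eta>" using c \<eta> by (intro mult_right_mono) auto
        then show ?thesis using True zA c(3)[of z] by (simp add: cut_def err_def z_def[symmetric] algebra_simps)
      next
        case False
        then show ?thesis using c(2) bump_nonneg by (simp add: cut_def err_def)
      qed
      moreover have "cut c \<eta> ?u \<ge> 0" unfolding cut_def using c by simp
      moreover have "err c A \<eta> ?u \<ge> 0" unfolding err_def using bump_nonneg \<eta> by simp
      ultimately show "ennreal (bump ?u) \<le> ennreal (cut c \<eta> ?u) + ennreal (err c A \<eta> ?u)"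
        by (simp add: ennreal_plus[symmetric] ennreal_leI del: ennreal_plus)
    qed
    also have "\<dots> = tsum n (\<lambda>v. ennreal (cut c \<eta> v)) ?v + tsum n (\<lambda>v. ennreal (err c A \<eta> v)) ?v" by (rule tsum_add)
    also have "tsum n (\<lambda>v. ennreal (cut c \<eta> v)) ?v \<le> tsum n (\<lambda>v. ennreal (cut c \<eta> v)) ?v' + ennreal \<epsilon> * tsum n (\<lambda>v. ennreal (bump v)) ?v + ennreal B"
      by (rule B)
    also have "tsum n (\<lambda>v. ennreal (cut c \<eta> v)) ?v' \<le> tsum n (\<lambda>v. ennreal (err c A \<eta> v)) ?v'"
      unfolding tsum_def
    proof (intro sum_mono osum_mono ennreal_leI)
      fix g i assume g: "g \<in> \<Gamma>"
      let ?u = "cover_act \<sigma> g (cover_flow (real i) ?v')"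
      have zA: "(fst ?u, fst (snd ?u)) \<notin> A" using A(2)[OF g] by (simp add: cover_act_def cover_flow_def)
      have "cut c \<eta> ?u \<le> c (fst ?u, fst (snd ?u)) * bump ?u"
        unfolding cut_def using c(2) bump_nonneg[of ?u] \<eta> by (intro mult_left_mono) auto
      then show "cut c \<eta> ?u \<le> err c A \<eta> ?u" using zA c(2) bump_nonneg[of ?u] \<eta> by (simp add: err_def)
    qed
    finally show ?thesis by (simp add: add_mono)
  qed
  then show ?thesis using B(1) by blast
qed

end

section \<open>Invariant sets along the second endpoint\<close>

context GPS_flow
begin

abbreviation eb :: "'m \<times> 'm \<times> real \<Rightarrow> ennreal" where "eb \<equiv> \<lambda>v. ennreal (bump v)"

text \<open>\<open>hopf_half\<close> in both directions bounds each of the two sums of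
  \<open>bump\<close> by fractions of both sums and a constant. The fractions are small enough to
  solve for the sums, which are finite for each \<open>n\<close>, so they stay bounded and
  recurrence is violated.\<close>

lemma hopf_contradiction:
  assumes c: "continuous_on UNIV c" "\<And>z. 0 \<le> c z" "\<And>z. c z \<le> 1" and \<eta>: "\<eta> > 0"
    and v: "(x, y, t) \<in> cover_space \<Gamma>" "(x', y, t) \<in> cover_space \<Gamma>" and y: "conical y"
    and A: "\<And>g. g \<in> \<Gamma> \<Longrightarrow> (g x, g y) \<in> A" "\<And>g. g \<in> \<Gamma> \<Longrightarrow> (g x', g y) \<notin> A"
    and fin: "\<And>i::nat. osum eb (cover_flow (real i) (x, y, t)) \<noteq> \<infinity>" "\<And>i::nat. osum eb (cover_flow (real i) (x', y, t)) \<noteq> \<infinity>"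
    and E: "\<And>n. tsum n (\<lambda>v. ennreal (err c A \<eta> v)) (x, y, t) \<le> ennreal (1/6) * tsum n eb (x, y, t)"
      "\<And>n. tsum n (\<lambda>v. ennreal (err c A \<eta> v)) (x', y, t) \<le> ennreal (1/6) * tsum n eb (x', y, t)"
  shows False
proof -
  let ?w = "\<lambda>v. ennreal (err c A \<eta> v)"
  have xy: "x \<noteq> y" "x' \<noteq> y" using v by (auto simp: cover_space_def)
  have e6: "(1/6::real) > 0" by simp
  obtain B1 where B1: "B1 \<ge> 0" "\<And>n. tsum n eb (x, y, t) \<le> tsum n ?w (x', y, t) + ennreal (1/6) * tsum n eb (x, y, t) + ennreal B1 + tsum n ?w (x, y, t)"
    using hopf_half[OF c e6 \<eta> xy A, of t] by auto
  \<comment> \<open>The error does not change under complements, so the same hypotheses serve for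
    the points in exchanged roles.\<close>
  have "err (\<lambda>z. 1 - c z) (- A) \<eta> = err c A \<eta>"
    by (intro ext) (auto simp: err_def indicator_def)
  moreover have "continuous_on UNIV (\<lambda>z. 1 - c z)" by (intro continuous_intros c)
  ultimately obtain B2 where B2: "B2 \<ge> 0" "\<And>n. tsum n eb (x', y, t) \<le> tsum n ?w (x, y, t) + ennreal (1/6) * tsum n eb (x', y, t) + ennreal B2 + tsum n ?w (x', y, t)"
    using hopf_half[of "\<lambda>z. 1 - c z" "1/6" \<eta> x' y x "- A" t] c(2,3) \<eta> xy A by auto
  have plus4: "ennreal p + ennreal q + ennreal r + ennreal s = ennreal (p + q + r + s)"
    if "0 \<le> p" "0 \<le> q" "0 \<le> r" "0 \<le> s" for p q r s using that by simp
  have bound: "tsum n eb (x, y, t) \<le> ennreal (2 * (B1 + B2))" for n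
  proof -
    have "tsum n eb (x, y, t) < \<infinity>" "tsum n eb (x', y, t) < \<infinity>"
      unfolding tsum_def using fin by (auto simp: less_top)
    then obtain a a' where a: "tsum n eb (x, y, t) = ennreal a" "a \<ge> 0" and a': "tsum n eb (x', y, t) = ennreal a'" "a' \<ge> 0"
      by (metis ennreal_cases infinity_ennreal_def less_irrefl)
    have W: "tsum n ?w (x, y, t) \<le> ennreal (a/6)" "tsum n ?w (x', y, t) \<le> ennreal (a'/6)"
      using E[of n] a a' by (simp_all add: ennreal_mult[symmetric])
    have "ennreal a \<le> ennreal (a'/6) + ennreal (a/6) + ennreal B1 + ennreal (a/6)"
    proof -
      have "ennreal a \<le> tsum n ?w (x', y, t) + ennreal (1/6) * ennreal a + ennreal B1 + tsum n ?w (x, y, t)" using B1(2)[of n] a by simp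
      also have "ennreal (1/6) * ennreal a = ennreal (a/6)" using a by (simp add: ennreal_mult[symmetric])
      also have "tsum n ?w (x', y, t) + ennreal (a/6) + ennreal B1 + tsum n ?w (x, y, t) \<le> ennreal (a'/6) + ennreal (a/6) + ennreal B1 + ennreal (a/6)"
        using W by (intro add_mono order_refl)
      finally show ?thesis .
    qed
    also have "\<dots> = ennreal (a'/6 + a/6 + B1 + a/6)" by (rule plus4) (use a a' B1 in auto)
    finally have 1: "a \<le> a'/6 + a/6 + B1 + a/6" using a a' B1 by (subst (asm) ennreal_le_iff) auto
    have "ennreal a' \<le> ennreal (a/6) + ennreal (a'/6) + ennreal B2 + ennreal (a'/6)"
    proof -
      have "ennreal a' \<le> tsum n ?w (x, y, t) + ennreal (1/6) * ennreal a' + ennreal B2 + tsum n ?w (x', y, t)" using B2(2)[of n] a' by simp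
      also have "ennreal (1/6) * ennreal a' = ennreal (a'/6)" using a' by (simp add: ennreal_mult[symmetric])
      also have "tsum n ?w (x, y, t) + ennreal (a'/6) + ennreal B2 + tsum n ?w (x', y, t) \<le> ennreal (a/6) + ennreal (a'/6) + ennreal B2 + ennreal (a'/6)"
        using W by (intro add_mono order_refl)
      finally show ?thesis .
    qed
    also have "\<dots> = ennreal (a/6 + a'/6 + B2 + a'/6)" by (rule plus4) (use a a' B2 in auto)
    finally have 2: "a' \<le> a/6 + a'/6 + B2 + a'/6" using a a' B2 by (subst (asm) ennreal_le_iff) auto
    \<comment> \<open>Inserting the second inequality into four times the first leaves
      \<open>15 * a \<le> 24 * B1 + 6 * B2\<close>.\<close>
    have "4 * a \<le> a' + 6 * B1" "4 * a' \<le> a + 6 * B2" using 1 2 by (simp_all add: field_simps)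
    then have "a \<le> 2 * (B1 + B2)" using a'(2) B1(1) B2(1) by simp
    then show ?thesis unfolding a(1) by (rule ennreal_leI)
  qed
  have "(\<Sum>i. osum eb (cover_flow (real i) (x, y, t))) \<le> ennreal (2 * (B1 + B2))"
    unfolding suminf_eq_SUP using bound by (intro SUP_least) (simp add: tsum_def)
  moreover have "(\<Sum>i. osum eb (cover_flow (real i) (x, y, t))) = \<infinity>"
    using bump_recurrent[OF v(1)] y by simp
  ultimately show False by (simp add: top_unique)
qed

text \<open>The first term is an approximation of the indicator in the finite measure \<theta> that
  \<open>bump\<close> induces on pairs of endpoints. The second tends to 0 with \<eta> by dominated
  convergence.\<close>

lemma err_small:
  assumes A: "A \<in> sets borel" and e: "e > 0"
  shows "\<exists>c \<eta>. continuous_on UNIV c \<and> (\<forall>z. 0 \<le> c z \<and> c z \<le> 1) \<and> \<eta> > 0 \<and> (\<integral>\<^sup>+v. ennreal (err c A \<eta> v) \<partial>Q) < ennreal e"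
proof -
  have e2: "e/2 > 0" using e by simp
  define pr where "pr v = (fst v, fst (snd v))" for v :: "'m \<times> 'm \<times> real"
  have [measurable]: "pr \<in> borel_measurable borel"
    unfolding pr_def[abs_def] by (intro borel_measurable_continuous_onI continuous_intros)
  define \<theta> where "\<theta> = distr (density Q eb) borel pr"
  have "emeasure \<theta> UNIV = (\<integral>\<^sup>+v. eb v \<partial>Q)"
    unfolding \<theta>_def by (subst emeasure_distr) (auto simp: emeasure_density)
  then have "emeasure \<theta> UNIV < \<infinity>" using bump_integral_finite by simp
  moreover have "sets \<theta> = sets borel" by (simp add: \<theta>_def)
  ultimately obtain c where c: "continuous_on UNIV c" "\<forall>z. 0 \<le> c z \<and> c z \<le> 1"
    "(\<integral>\<^sup>+z. ennreal \<bar>c z - indicator A z\<bar> \<partial>\<theta>) < ennreal (e/2)"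
    using continuous_approx_indicator[of \<theta> A "e/2"] A e2 by auto
  have [measurable]: "c \<in> borel_measurable borel" using c(1) by (rule borel_measurable_continuous_onI)
  note A [measurable]
  have "(\<integral>\<^sup>+z. ennreal \<bar>c z - indicator A z\<bar> \<partial>\<theta>) = (\<integral>\<^sup>+v. eb v * ennreal \<bar>c (pr v) - indicator A (pr v)\<bar> \<partial>Q)"
    unfolding \<theta>_def by (subst nn_integral_distr) (auto simp: nn_integral_density)
  then have c3: "(\<integral>\<^sup>+v. ennreal (\<bar>c (pr v) - indicator A (pr v)\<bar> * bump v) \<partial>Q) < ennreal (e/2)"
    using c(3) by (simp add: ennreal_mult bump_nonneg mult.commute)
  have "(\<lambda>j. \<integral>\<^sup>+v. ennreal (min (bump v) (inverse (real (Suc j)))) \<partial>Q) \<longlonglongrightarrow> (\<integral>\<^sup>+v. 0 \<partial>Q)"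
  proof (rule nn_integral_dominated_convergence[where w = eb])
    show "(\<integral>\<^sup>+v. eb v \<partial>Q) < \<infinity>" by (rule bump_integral_finite)
    show "AE v in Q. (\<lambda>j. ennreal (min (bump v) (inverse (real (Suc j))))) \<longlonglongrightarrow> 0"
    proof (rule AE_I2)
      fix v
      have "(\<lambda>j. min (bump v) (inverse (real (Suc j)))) \<longlonglongrightarrow> min (bump v) 0"
        by (intro tendsto_min tendsto_const LIMSEQ_inverse_real_of_nat)
      then show "(\<lambda>j. ennreal (min (bump v) (inverse (real (Suc j))))) \<longlonglongrightarrow> 0"
        using tendsto_ennrealI bump_nonneg[of v] by fastforce
    qed
  qed (auto intro!: ennreal_leI)
  then have "(\<lambda>j. \<integral>\<^sup>+v. ennreal (min (bump v) (inverse (real (Suc j)))) \<partial>Q) \<longlonglongrightarrow> 0" by simp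
  then have "\<forall>\<^sub>F j in sequentially. (\<integral>\<^sup>+v. ennreal (min (bump v) (inverse (real (Suc j)))) \<partial>Q) < ennreal (e/2)"
    using e2 by (intro order_tendstoD(2)) auto
  then obtain j where j: "(\<integral>\<^sup>+v. ennreal (min (bump v) (inverse (real (Suc j)))) \<partial>Q) < ennreal (e/2)"
    by (auto simp: eventually_sequentially)
  define \<eta> where "\<eta> = inverse (real (Suc j))"
  have \<eta>: "\<eta> > 0" by (simp add: \<eta>_def)
  have "(\<integral>\<^sup>+v. ennreal (err c A \<eta> v) \<partial>Q) = (\<integral>\<^sup>+v. ennreal (\<bar>c (pr v) - indicator A (pr v)\<bar> * bump v) + ennreal (min (bump v) \<eta>) \<partial>Q)"
    using \<eta> by (intro nn_integral_cong) (simp add: err_def pr_def bump_nonneg)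
  also have "\<dots> = (\<integral>\<^sup>+v. ennreal (\<bar>c (pr v) - indicator A (pr v)\<bar> * bump v) \<partial>Q) + (\<integral>\<^sup>+v. ennreal (min (bump v) \<eta>) \<partial>Q)"
    by (rule nn_integral_add) measurable
  also have "\<dots> < ennreal e"
  proof -
    obtain a where a: "(\<integral>\<^sup>+v. ennreal (\<bar>c (pr v) - indicator A (pr v)\<bar> * bump v) \<partial>Q) = ennreal a" "a \<ge> 0"
      using c3 by (cases "\<integral>\<^sup>+v. ennreal (\<bar>c (pr v) - indicator A (pr v)\<bar> * bump v) \<partial>Q") auto
    obtain b where b: "(\<integral>\<^sup>+v. ennreal (min (bump v) \<eta>) \<partial>Q) = ennreal b" "b \<ge> 0"
      using j by (cases "\<integral>\<^sup>+v. ennreal (min (bump v) \<eta>) \<partial>Q") (auto simp: \<eta>_def)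
    have "a < e/2" "b < e/2" using c3 j a b by (auto simp: ennreal_less_iff \<eta>_def)
    then have lt: "ennreal (a + b) < ennreal e" using e a b by (intro ennreal_lessI) auto
    have eq: "ennreal a + ennreal b = ennreal (a + b)" using a b by simp
    show ?thesis unfolding a(1) b(1) eq by (rule lt)
  qed
  finally show ?thesis using c \<eta> by blast
qed

text \<open>The orbit sum of an integrable function is infinite only on a null set, and the flow
  preserves null sets. Finiteness is what permits real arithmetic in
  \<open>hopf_contradiction\<close>.\<close>

lemma AE_osum_finite: "AE v in Q. \<forall>i::nat. osum eb (cover_flow (real i) v) \<noteq> \<infinity>"
proof -
  define P where "P = {v. osum eb v = \<infinity>}"
  have Pm [measurable]: "P \<in> sets borel" unfolding P_def by measurable
  have Pi: "inv_set P" by (auto simp: inv_set_def P_def osum_act)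
  have P0: "emeasure Q P = 0"
    by (rule null_of_infinite[OF Pm Pi _ bump_integral_finite]) (auto simp: P_def)
  have "AE v in Q. cover_flow (real i) v \<notin> P" for i :: nat
  proof -
    have "(\<integral>\<^sup>+v. indicator P (cover_flow (real i) v) \<partial>Q) = (\<integral>\<^sup>+v. indicator P v \<partial>Q)" by (rule nn_integral_flow) measurable
    also have "\<dots> = 0" using P0 by simp
    finally have "AE v in Q. indicator P (cover_flow (real i) v) = (0::ennreal)" by (subst (asm) nn_integral_0_iff_AE) auto
    then show ?thesis by eventually_elim (auto simp: indicator_def split: if_splits)
  qed
  then show ?thesis unfolding AE_all_countable by (simp add: P_def)
qed

text \<open>The \<open>k\<close>-th approximation has error below a sixth of \<open>(1/2)^k\<close>.
  By the maximal inequality the bad set \<open>E k\<close>, where the sums of the error exceed a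
  sixth of those of \<open>bump\<close> for some \<open>n\<close>, has \<open>bump\<close>-mass at
  most \<open>(1/2)^k\<close>. By Borel-Cantelli almost every point with positive
  \<open>bump\<close> is in only finitely many of them, so any two such points are outside a common
  \<open>E k\<close>, and \<open>hopf_contradiction\<close> forbids them to lie on different sides
  of \<open>A\<close> over the same \<open>y\<close> and \<open>t\<close>.\<close>

theorem hopf:
  assumes A: "A \<in> sets borel"
    and inv: "\<And>g x y. g \<in> \<Gamma> \<Longrightarrow> x \<in> limit_set \<Gamma> \<Longrightarrow> y \<in> limit_set \<Gamma> \<Longrightarrow> x \<noteq> y \<Longrightarrow> (g x, g y) \<in> A \<longleftrightarrow> (x, y) \<in> A"
  shows "AE y in \<mu>. (AE x in \<mu>'. x \<in> limit_set \<Gamma> \<and> x \<noteq> y \<longrightarrow> (x, y) \<in> A) \<or> (AE x in \<mu>'. x \<in> limit_set \<Gamma> \<and> x \<noteq> y \<longrightarrow> (x, y) \<notin> A)"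
proof -
  have "\<forall>k::nat. \<exists>z. continuous_on UNIV (fst z) \<and> (\<forall>u. 0 \<le> fst z u \<and> fst z u \<le> 1) \<and> snd z > 0 \<and> (\<integral>\<^sup>+v. ennreal (err (fst z) A (snd z) v) \<partial>Q) < ennreal ((1/2)^k / 6)"
  proof
    fix k :: nat
    have "(1/2::real)^k / 6 > 0" by simp
    from err_small[OF A this] show "\<exists>z. continuous_on UNIV (fst z) \<and> (\<forall>u. 0 \<le> fst z u \<and> fst z u \<le> 1) \<and> snd z > 0 \<and> (\<integral>\<^sup>+v. ennreal (err (fst z) A (snd z) v) \<partial>Q) < ennreal ((1/2)^k / 6)"
      by auto
  qed
  from choice[OF this] obtain z where z: "\<And>k::nat. continuous_on UNIV (fst (z k))" "\<And>k u. 0 \<le> fst (z k) u" "\<And>k u. fst (z k) u \<le> 1"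
    "\<And>k. snd (z k) > 0" "\<And>k. (\<integral>\<^sup>+v. ennreal (err (fst (z k)) A (snd (z k)) v) \<partial>Q) < ennreal ((1/2)^k / 6)" by auto
  define w where "w k v = ennreal (err (fst (z k)) A (snd (z k)) v)" for k v
  have zm: "fst (z k) \<in> borel_measurable borel" for k using z(1) by (rule borel_measurable_continuous_onI)
  have pr: "(\<lambda>v :: 'm \<times> 'm \<times> real. (fst v, fst (snd v))) \<in> borel_measurable borel"
    by (intro borel_measurable_continuous_onI continuous_intros)
  have wm [measurable]: "w k \<in> borel_measurable borel" for k
  proof -
    have 1: "(\<lambda>v :: 'm \<times> 'm \<times> real. fst (z k) (fst v, fst (snd v))) \<in> borel_measurable borel" by (rule measurable_compose[OF pr zm])
    have 2: "(\<lambda>v :: 'm \<times> 'm \<times> real. indicator A (fst v, fst (snd v)) :: real) \<in> borel_measurable borel"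
      by (rule measurable_compose[OF pr borel_measurable_indicator[OF A]])
    have "(\<lambda>v. err (fst (z k)) A (snd (z k)) v) \<in> borel_measurable borel"
      unfolding err_def
      by (intro borel_measurable_add borel_measurable_times borel_measurable_abs borel_measurable_diff borel_measurable_min
          borel_measurable_const bump_borel 1 2)
    then show ?thesis unfolding w_def[abs_def] by (rule measurable_compose[OF _ measurable_ennreal])
  qed
  define E where "E k = {v. \<exists>n. tsum n (\<lambda>v. ennreal (1/6) * eb v) v < tsum n (w k) v}" for k
  have Em [measurable]: "E k \<in> sets borel" for k
  proof -
    have "E k = (\<Union>n. {v. tsum n (\<lambda>v. ennreal (1/6) * eb v) v < tsum n (w k) v})" by (auto simp: E_def)
    moreover have "{v. tsum n (\<lambda>v. ennreal (1/6) * eb v) v < tsum n (w k) v} \<in> sets borel" for n by measurable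
    ultimately show ?thesis by (simp add: sets.countable_UN'')
  qed
  \<comment> \<open>Borel-Cantelli is applied in this measure; its null sets see the region where
    \<open>bump\<close> is positive.\<close>
  define M1 where "M1 = density Q eb"
  have E1: "emeasure M1 (E k) \<le> ennreal ((1/2)^k)" for k
  proof -
    have "(\<integral>\<^sup>+v. ennreal (1/6) * eb v * indicator (E k) v \<partial>Q) \<le> (\<integral>\<^sup>+v. w k v \<partial>Q)"
      unfolding E_def by (rule maximal_inequality) measurable
    also have "\<dots> \<le> ennreal ((1/2)^k / 6)" unfolding w_def using z(5) by (rule less_imp_le)
    also have "(\<integral>\<^sup>+v. ennreal (1/6) * eb v * indicator (E k) v \<partial>Q) = ennreal (1/6) * emeasure M1 (E k)"
      unfolding M1_def by (simp add: emeasure_density nn_integral_cmult mult.assoc)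
    finally have "ennreal 6 * (ennreal (1/6) * emeasure M1 (E k)) \<le> ennreal 6 * ennreal ((1/2)^k / 6)"
      by (rule mult_left_mono) simp
    moreover have "ennreal 6 * ennreal (1/6) = 1" by (subst ennreal_mult[symmetric]) auto
    moreover have "ennreal 6 * ennreal ((1/2)^k / 6) = ennreal ((1/2)^k)" by (subst ennreal_mult[symmetric]) auto
    ultimately show ?thesis by (simp only: mult.assoc[symmetric] mult_1)
  qed
  have "AE v in M1. \<forall>\<^sub>F k in sequentially. v \<in> space M1 - E k"
  proof (rule borel_cantelli_AE1)
    show "E k \<in> sets M1" for k by (simp add: M1_def)
    show fin: "emeasure M1 (E k) < \<infinity>" for k using E1[of k] by (rule le_less_trans) simp
    have "measure M1 (E k) \<le> (1/2)^k" for k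
      using E1[of k] unfolding measure_def by (simp add: enn2real_leI)
    then show "summable (\<lambda>k. measure M1 (E k))"
      by (intro summable_comparison_test'[OF summable_geometric[of "1/2::real"]]) auto
  qed
  then have ev: "AE v in Q. bump v > 0 \<longrightarrow> (\<forall>\<^sub>F k in sequentially. v \<notin> E k)"
    unfolding M1_def by (subst (asm) AE_density) auto
  have "AE v in Q. (bump v > 0 \<longrightarrow> (\<forall>\<^sub>F k in sequentially. v \<notin> E k)) \<and> (\<forall>i::nat. osum eb (cover_flow (real i) v) \<noteq> \<infinity>)"
    using ev AE_osum_finite by eventually_elim simp
  then have good: "AE v in prod3. v \<in> cover_space \<Gamma> \<longrightarrow> (bump v > 0 \<longrightarrow> (\<forall>\<^sub>F k in sequentially. v \<notin> E k)) \<and> (\<forall>i::nat. osum eb (cover_flow (real i) v) \<noteq> \<infinity>)"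
    unfolding AE_Q .
  obtain K where K: "{v \<in> space prod3. \<not> (v \<in> cover_space \<Gamma> \<longrightarrow> (bump v > 0 \<longrightarrow> (\<forall>\<^sub>F k in sequentially. v \<notin> E k)) \<and> (\<forall>i::nat. osum eb (cover_flow (real i) v) \<noteq> \<infinity>))} \<subseteq> K"
    "emeasure prod3 K = 0" "K \<in> sets prod3" using AE_E[OF good] by blast
  have Kgood: "(bump v > 0 \<longrightarrow> (\<forall>\<^sub>F k in sequentially. v \<notin> E k)) \<and> (\<forall>i::nat. osum eb (cover_flow (real i) v) \<noteq> \<infinity>)" if "v \<notin> K" "v \<in> cover_space \<Gamma>" for v
    using K(1) that by auto
  interpret P1: pair_sigma_finite \<mu>' "\<mu> \<Otimes>\<^sub>M (lborel :: real measure)" by unfold_locales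
  interpret P2: pair_sigma_finite \<mu> "lborel :: real measure" by unfold_locales
  have "AE v in \<mu>' \<Otimes>\<^sub>M (\<mu> \<Otimes>\<^sub>M lborel). v \<notin> K"
    using K(2,3) unfolding prod3_def by (intro AE_not_in) auto
  then have "AE x in \<mu>'. AE u in \<mu> \<Otimes>\<^sub>M lborel. (x, u) \<notin> K" by (rule P1.AE_pair)
  moreover have "{u \<in> space (\<mu>' \<Otimes>\<^sub>M (\<mu> \<Otimes>\<^sub>M lborel)). (fst u, snd u) \<notin> K} \<in> sets (\<mu>' \<Otimes>\<^sub>M (\<mu> \<Otimes>\<^sub>M lborel))"
  proof -
    have "{u \<in> space (\<mu>' \<Otimes>\<^sub>M (\<mu> \<Otimes>\<^sub>M lborel)). (fst u, snd u) \<notin> K} = space (\<mu>' \<Otimes>\<^sub>M (\<mu> \<Otimes>\<^sub>M lborel)) - K" by auto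
    then show ?thesis using sets.compl_sets[OF K(3)[unfolded prod3_def]] by (simp only:)
  qed
  ultimately have "AE u in \<mu> \<Otimes>\<^sub>M lborel. AE x in \<mu>'. (x, u) \<notin> K"
    using P1.AE_commute[of "\<lambda>x u. (x, u) \<notin> K"] by (simp only: fst_conv snd_conv)
  then have "AE y in \<mu>. AE t in lborel. AE x in \<mu>'. (x, y, t) \<notin> K" using P2.AE_pair by fastforce
  with AE_conical AE_limit_set show ?thesis
  proof eventually_elim
    case (elim y)
    \<comment> \<open>By Fubini one time \<open>t\<close> can be fixed for all \<open>x\<close> over
      the same \<open>y\<close>. Any \<open>t\<close> in this interval makes \<open>bump\<close>
      positive at distinct endpoints.\<close>
    have "\<exists>t. t \<in> {-1<..<1} \<and> (AE x in \<mu>'. (x, y, t) \<notin> K)"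
    proof (rule ccontr)
      assume no: "\<not> ?thesis"
      have "AE t in lborel. t \<notin> {-1<..<1::real}" using elim(3) by eventually_elim (use no in blast)
      then have "emeasure lborel {-1<..<1::real} = 0" by (subst (asm) AE_iff_measurable[of "{-1<..<1}"]) auto
      then show False by simp
    qed
    then obtain t where t: "t \<in> {-1<..<1}" and tx: "AE x in \<mu>'. (x, y, t) \<notin> K" by blast
    have same: "(x', y) \<in> A" if x: "(x, y, t) \<notin> K" "(x', y, t) \<notin> K" "x \<in> limit_set \<Gamma>" "x' \<in> limit_set \<Gamma>" "x \<noteq> y" "x' \<noteq> y" and xA: "(x, y) \<in> A" for x x'
    proof (rule ccontr)
      assume xA': "(x', y) \<notin> A"
      have v: "(x, y, t) \<in> cover_space \<Gamma>" "(x', y, t) \<in> cover_space \<Gamma>" using x elim(2) by (auto simp: cover_space_def)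
      have b: "bump (x, y, t) > 0" "bump (x', y, t) > 0" using t x by (auto simp: bump_def intro!: mult_pos_pos rho_pos)
      have "\<forall>\<^sub>F k in sequentially. (x, y, t) \<notin> E k \<and> (x', y, t) \<notin> E k"
        using Kgood[OF x(1) v(1)] Kgood[OF x(2) v(2)] b by (simp add: eventually_conj)
      then obtain k where k: "(x, y, t) \<notin> E k" "(x', y, t) \<notin> E k" by (auto simp: eventually_sequentially)
      have tb: "tsum n (w k) v \<le> ennreal (1/6) * tsum n eb v" if "v \<notin> E k" for n v
      proof -
        have "\<not> tsum n (\<lambda>v. ennreal (1/6) * eb v) v < tsum n (w k) v" using that by (auto simp: E_def)
        then show ?thesis unfolding tsum_cmult by (simp add: not_less)
      qed
      show False
      proof (rule hopf_contradiction[OF z(1)[of k] z(2)[of k] z(3)[of k] z(4)[of k] v elim(1), of A])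
        show "(g x, g y) \<in> A" if "g \<in> \<Gamma>" for g using inv[OF that, of x y] x xA elim(2) by simp
        show "(g x', g y) \<notin> A" if "g \<in> \<Gamma>" for g using inv[OF that, of x' y] x xA' elim(2) by simp
        show "osum eb (cover_flow (real i) (x, y, t)) \<noteq> \<infinity>" for i :: nat using Kgood[OF x(1) v(1)] by blast
        show "osum eb (cover_flow (real i) (x', y, t)) \<noteq> \<infinity>" for i :: nat using Kgood[OF x(2) v(2)] by blast
      qed (use tb[OF k(1)] tb[OF k(2)] in \<open>auto simp: w_def[abs_def]\<close>)
    qed
    show ?case
    proof (cases "\<exists>x. (x, y, t) \<notin> K \<and> x \<in> limit_set \<Gamma> \<and> x \<noteq> y \<and> (x, y) \<in> A")
      case True
      then obtain x where x: "(x, y, t) \<notin> K" "x \<in> limit_set \<Gamma>" "x \<noteq> y" "(x, y) \<in> A" by blast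
      have "AE x in \<mu>'. x \<in> limit_set \<Gamma> \<and> x \<noteq> y \<longrightarrow> (x, y) \<in> A"
        using tx by eventually_elim (use same[OF x(1) _ x(2) _ x(3) _ x(4)] in blast)
      then show ?thesis by simp
    next
      case False
      have "AE x in \<mu>'. x \<in> limit_set \<Gamma> \<and> x \<noteq> y \<longrightarrow> (x, y) \<notin> A"
        using tx by eventually_elim (use False in blast)
      then show ?thesis by simp
    qed
  qed
qed

end

section \<open>Double ergodicity and descent to the flow space\<close>

lemma infsum_eq_suminf_ennreal:
  fixes f :: "nat \<Rightarrow> ennreal"
  shows "(\<Sum>\<^sub>\<infinity>n. f n) = (\<Sum>n. f n)"
proof (subst nonneg_infsum_complete, simp, rule antisym)
  show "(SUP F\<in>{F. finite F \<and> F \<subseteq> UNIV}. sum f F) \<le> (\<Sum>n. f n)"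
    by (intro SUP_least sum_le_suminf) auto
  show "(\<Sum>n. f n) \<le> (SUP F\<in>{F. finite F \<and> F \<subseteq> UNIV}. sum f F)"
    unfolding suminf_eq_SUP by (intro SUP_least SUP_upper) auto
qed

context GPS
begin

lemma osum_infsum: "(\<Sum>\<^sub>\<infinity>\<gamma>\<in>\<Gamma>. f (cover_act \<sigma> \<gamma> v)) = osum f v"
proof -
  let ?e = "from_nat_into \<Gamma>"
  have b: "bij_betw ?e UNIV \<Gamma>" using countable infinite by (rule bij_betw_from_nat_into)
  have "(\<Sum>\<^sub>\<infinity>\<gamma>\<in>\<Gamma>. f (cover_act \<sigma> \<gamma> v)) = (\<Sum>\<^sub>\<infinity>n. f (cover_act \<sigma> (?e n) v))"
    by (rule infsum_reindex_bij_betw[OF b, symmetric])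
  also have "\<dots> = osum f v"
    unfolding osum_def infsum_eq_suminf_ennreal
    using nn_integral_bij_count_space[OF b, of "\<lambda>\<gamma>. f (cover_act \<sigma> \<gamma> v)"]
    by (simp add: nn_integral_count_space_nat)
  finally show ?thesis .
qed

end

context GPS_conformal
begin

lemma divergent_swap: "poincare_series \<Gamma> (\<lambda>g. N (inv g)) \<delta> = \<infinity>"
proof -
  have "bij_betw inv \<Gamma> \<Gamma>" using inj_inv inv_image by (simp add: bij_betw_def)
  from infsum_reindex_bij_betw[OF this, of "\<lambda>g. ennreal (exp (- \<delta> * N g))"]
  show ?thesis using divergent by (simp add: poincare_series_def)
qed

end

section \<open>Exchange of the two endpoints\<close>

context GPS_pair
begin

lemma GPS_pair_swap: "GPS_pair \<Gamma> d \<sigma>' \<sigma> (\<lambda>(x, y). G (y, x)) (\<lambda>g. N (inv g)) \<delta> \<mu>' \<mu>"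
  by (intro GPS_pair.intro GPS_conformal.intro GPS_pair_axioms.intro GPS_conformal_axioms.intro GPS_swap
      conformal conformal' \<delta>_nonneg divergent_swap)

text \<open>With the new time coordinate \<open>G (x, y) - t\<close>, exchanging the endpoints conjugates the action to
  that of the system with \<open>\<sigma>\<close> and \<open>\<sigma>'\<close> exchanged, and reverses the flow.\<close>

definition flip :: "'m \<times> 'm \<times> real \<Rightarrow> 'm \<times> 'm \<times> real" where
  "flip v = (fst (snd v), fst v, indicator (cover_space \<Gamma>) v *\<^sub>R G (fst v, fst (snd v)) - snd (snd v))"

lemma flip_mem: "v \<in> cover_space \<Gamma> \<Longrightarrow> flip v \<in> cover_space \<Gamma>"
  by (auto simp: flip_def cover_space_def)

lemma flip_act:
  assumes g: "g \<in> \<Gamma>" and v: "v \<in> cover_space \<Gamma>"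
  shows "flip (cover_act \<sigma> g v) = cover_act \<sigma>' g (flip v)"
proof -
  obtain x y t where vx: "v = (x, y, t)" by (metis prod.collapse)
  have "x \<noteq> y" using v by (auto simp: vx cover_space_def)
  from G_eq[OF g this] have G: "G (g x, g y) = G (x, y) + \<sigma>' g x + \<sigma> g y" by simp
  have "indicator (cover_space \<Gamma>) (cover_act \<sigma> g v) = (1::real)" "indicator (cover_space \<Gamma>) v = (1::real)"
    using v cover_act_mem[OF g v] by auto
  then show ?thesis unfolding flip_def by (simp add: vx cover_act_def G)
qed

lemma flip_borel [measurable]: "flip \<in> borel_measurable borel"
proof -
  have g0: "continuous_on {(x, y). x \<noteq> y} G" using gps by (simp add: continuous_GPS_system_def)
  have c: "continuous_on (cover_space \<Gamma>) (\<lambda>v. (fst v, fst (snd v)))" by (intro continuous_intros)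
  have "continuous_on (cover_space \<Gamma>) (\<lambda>v. G (fst v, fst (snd v)))"
    by (rule continuous_on_compose2[OF g0 c]) (auto simp: cover_space_def)
  from borel_measurable_continuous_on_indicator[OF cover_borel this]
  have 1: "(\<lambda>v. indicator (cover_space \<Gamma>) v *\<^sub>R G (fst v, fst (snd v))) \<in> borel_measurable borel" .
  have 2: "(\<lambda>v :: 'm \<times> 'm \<times> real. fst (snd v)) \<in> borel_measurable borel" "(\<lambda>v :: 'm \<times> 'm \<times> real. fst v) \<in> borel_measurable borel"
    "(\<lambda>v :: 'm \<times> 'm \<times> real. snd (snd v)) \<in> borel_measurable borel"
    by (intro borel_measurable_continuous_onI continuous_intros)+
  show ?thesis unfolding flip_def[abs_def] by (intro borel_measurable_Pair borel_measurable_diff 1 2)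
qed

text \<open>The weight is symmetric in the endpoints. After exchanging the order of integration,
  \<open>flip\<close> is a reflection \<open>a - t\<close> on each fibre, which preserves Lebesgue
  measure.\<close>

lemma nn_integral_flip:
  assumes f: "f \<in> borel_measurable borel"
  shows "(\<integral>\<^sup>+v. f v \<partial>GPS_pair.Q \<Gamma> (\<lambda>(x, y). G (y, x)) \<delta> \<mu>' \<mu>) = (\<integral>\<^sup>+v. f (flip v) \<partial>Q)"
proof -
  interpret sw: GPS_pair \<Gamma> d \<sigma>' \<sigma> "\<lambda>(x, y). G (y, x)" "\<lambda>g. N (inv g)" \<delta> \<mu>' \<mu> by (rule GPS_pair_swap)
  interpret P: pair_sigma_finite \<mu>' \<mu> by unfold_locales
  define k where "k v = sw.weight v * f v" for v
  have km: "k \<in> borel_measurable borel"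
    unfolding k_def[abs_def] using sw.weight_borel f by (rule borel_measurable_times_ennreal)
  define h where "h z = (\<integral>\<^sup>+s. k (snd z, fst z, s) \<partial>lborel)" for z :: "'m \<times> 'm"
  have hm: "h \<in> borel_measurable (\<mu>' \<Otimes>\<^sub>M \<mu>)"
  proof -
    have "(\<lambda>u :: ('m \<times> 'm) \<times> real. (snd (fst u), fst (fst u), snd u)) \<in> borel_measurable borel"
      by (intro borel_measurable_continuous_onI continuous_intros)
    from measurable_compose[OF this km]
    have "(\<lambda>u. k (snd (fst u), fst (fst u), snd u)) \<in> borel_measurable (borel :: (('m \<times> 'm) \<times> real) measure)" .
    moreover have "sets ((\<mu>' \<Otimes>\<^sub>M \<mu>) \<Otimes>\<^sub>M (lborel :: real measure)) = sets (borel :: (('m \<times> 'm) \<times> real) measure)"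
    proof -
      have "sets (\<mu>' \<Otimes>\<^sub>M \<mu>) = sets (borel :: ('m \<times> 'm) measure)"
        by (subst borel_prod[symmetric]) (intro sets_pair_measure_cong; simp)
      then show ?thesis by (subst borel_prod[symmetric]) (intro sets_pair_measure_cong; simp)
    qed
    ultimately have "(\<lambda>u. k (snd (fst u), fst (fst u), snd u)) \<in> borel_measurable ((\<mu>' \<Otimes>\<^sub>M \<mu>) \<Otimes>\<^sub>M (lborel :: real measure))"
      using measurable_cong_sets by blast
    then have "(\<lambda>(z, s). k (snd z, fst z, s)) \<in> borel_measurable ((\<mu>' \<Otimes>\<^sub>M \<mu>) \<Otimes>\<^sub>M (lborel :: real measure))"
      by (simp add: case_prod_unfold)
    from sigma_finite_measure.borel_measurable_nn_integral[OF sigma_finite_lborel this] show ?thesis unfolding h_def[abs_def] .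
  qed
  have "(\<integral>\<^sup>+v. f v \<partial>sw.Q) = (\<integral>\<^sup>+v. k v \<partial>sw.prod3)" unfolding k_def by (rule sw.nn_integral_Q[OF f])
  also have "\<dots> = (\<integral>\<^sup>+y. \<integral>\<^sup>+x. h (x, y) \<partial>\<mu>' \<partial>\<mu>)" unfolding sw.nn_integral_prod3[OF km] h_def by simp
  also have "\<dots> = (\<integral>\<^sup>+x. \<integral>\<^sup>+y. h (x, y) \<partial>\<mu> \<partial>\<mu>')" by (rule P.Fubini[OF hm])
  also have "\<dots> = (\<integral>\<^sup>+x. \<integral>\<^sup>+y. \<integral>\<^sup>+t. weight (x, y, t) * f (flip (x, y, t)) \<partial>lborel \<partial>\<mu> \<partial>\<mu>')"
  proof (rule nn_integral_cong, rule nn_integral_cong)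
    fix x y
    define a where "a = (if x \<in> limit_set \<Gamma> \<and> y \<in> limit_set \<Gamma> \<and> x \<noteq> y then G (x, y) else 0)"
    have "(\<lambda>s. (y, x, s)) \<in> borel_measurable (borel :: real measure)" by (intro borel_measurable_continuous_onI continuous_intros)
    from measurable_compose[OF this km] have "(\<lambda>s. k (y, x, s)) \<in> borel_measurable borel" .
    from nn_integral_real_affine[OF this, of "-1" a]
    have "h (x, y) = (\<integral>\<^sup>+t. k (y, x, a + -1 * t) \<partial>lborel)" by (simp add: h_def)
    also have "\<dots> = (\<integral>\<^sup>+t. weight (x, y, t) * f (flip (x, y, t)) \<partial>lborel)"
    proof (rule nn_integral_cong)
      fix t
      have "flip (x, y, t) = (y, x, a + -1 * t)" by (auto simp: flip_def a_def cover_space_def indicator_def)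
      moreover have "sw.weight (y, x, a + -1 * t) = weight (x, y, t)"
        by (auto simp: weight_def sw.weight_def cover_space_def indicator_def)
      ultimately show "k (y, x, a + -1 * t) = weight (x, y, t) * f (flip (x, y, t))" by (simp add: k_def)
    qed
    finally show "h (x, y) = (\<integral>\<^sup>+t. weight (x, y, t) * f (flip (x, y, t)) \<partial>lborel)" .
  qed
  also have "\<dots> = (\<integral>\<^sup>+v. weight v * f (flip v) \<partial>prod3)"
    by (rule nn_integral_prod3[symmetric]) (intro borel_measurable_times_ennreal weight_borel measurable_compose[OF flip_borel f])
  also have "\<dots> = (\<integral>\<^sup>+v. f (flip v) \<partial>Q)"
    by (rule nn_integral_Q[symmetric]) (rule measurable_compose[OF flip_borel f])
  finally show ?thesis .
qed

end

context GPS_flow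
begin

text \<open>Orbit sums of \<open>f\<close> composed with \<open>flip\<close> are orbit sums of
  \<open>f\<close> for the exchanged action, so \<open>comparison\<close> carries over.\<close>

lemma GPS_flow_swap: "GPS_flow \<Gamma> d \<sigma>' \<sigma> (\<lambda>(x, y). G (y, x)) (\<lambda>g. N (inv g)) \<delta> \<mu>' \<mu>"
proof -
  interpret sw: GPS_pair \<Gamma> d \<sigma>' \<sigma> "\<lambda>(x, y). G (y, x)" "\<lambda>g. N (inv g)" \<delta> \<mu>' \<mu> by (rule GPS_pair_swap)
  show ?thesis
  proof (intro GPS_flow.intro GPS_flow_axioms.intro GPS_pair_swap)
    fix f g :: "'m \<times> 'm \<times> real \<Rightarrow> ennreal"
    assume f: "f \<in> borel_measurable borel" and g: "g \<in> borel_measurable borel"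
      and le: "\<And>v. v \<in> cover_space \<Gamma> \<Longrightarrow> sw.osum f v \<le> sw.osum g v"
    have eq: "osum (\<lambda>v. f (flip v)) v = sw.osum f (flip v)" if v: "v \<in> cover_space \<Gamma>" for f v
      unfolding osum_def sw.osum_def using flip_act[OF _ v] by (intro nn_integral_cong) simp
    have "(\<integral>\<^sup>+v. f (flip v) \<partial>Q) \<le> (\<integral>\<^sup>+v. g (flip v) \<partial>Q)"
      by (rule comparison[OF measurable_compose[OF flip_borel f] measurable_compose[OF flip_borel g]])
        (simp add: eq le flip_mem)
    then show "(\<integral>\<^sup>+v. f v \<partial>sw.Q) \<le> (\<integral>\<^sup>+v. g v \<partial>sw.Q)"
      unfolding nn_integral_flip[OF f] nn_integral_flip[OF g] .
  qed
qed

text \<open>By the Hopf argument almost every slice of an invariant set, in either direction, is null or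
  conull. If both kinds of slices occurred with positive measure in both directions, almost every
  point would be one of two given points.\<close>

theorem double_ergodic:
  assumes A: "A \<in> sets borel"
    and inv: "\<And>g x y. g \<in> \<Gamma> \<Longrightarrow> x \<in> limit_set \<Gamma> \<Longrightarrow> y \<in> limit_set \<Gamma> \<Longrightarrow> x \<noteq> y \<Longrightarrow> (g x, g y) \<in> A \<longleftrightarrow> (x, y) \<in> A"
  shows "(AE v in Q. (fst v, fst (snd v)) \<in> A) \<or> (AE v in Q. (fst v, fst (snd v)) \<notin> A)"
proof -
  interpret sw: GPS_flow \<Gamma> d \<sigma>' \<sigma> "\<lambda>(x, y). G (y, x)" "\<lambda>g. N (inv g)" \<delta> \<mu>' \<mu> by (rule GPS_flow_swap)
  interpret P: pair_sigma_finite \<mu>' \<mu> by unfold_locales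
  have sP: "sets (\<mu>' \<Otimes>\<^sub>M \<mu>) = sets (borel :: ('m \<times> 'm) measure)"
    by (subst borel_prod[symmetric]) (intro sets_pair_measure_cong; simp)
  have spP: "space (\<mu>' \<Otimes>\<^sub>M \<mu>) = UNIV" by (simp add: space_pair_measure)
  define U where "U = {z :: 'm \<times> 'm. fst z \<in> limit_set \<Gamma> \<and> snd z \<in> limit_set \<Gamma> \<and> fst z \<noteq> snd z}"
  have U: "U \<in> sets borel"
  proof -
    have L: "limit_set \<Gamma> \<in> sets borel" using closed_limit_set by (rule borel_closed)
    have "U = fst -` limit_set \<Gamma> \<inter> snd -` limit_set \<Gamma> \<inter> {z. fst z \<noteq> snd z}" by (auto simp: U_def)
    also have "\<dots> \<in> sets borel"
      by (intro sets.Int measurable_sets_borel[OF _ L] borel_measurable_continuous_onI borel_open open_Collect_neq continuous_intros)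
    finally show ?thesis .
  qed
  define A1 where "A1 = U \<inter> A"
  define A2 where "A2 = U - A"
  have A12: "A1 \<in> sets borel" "A2 \<in> sets borel" using U A by (auto simp: A1_def A2_def)
  have swap_borel: "prod.swap -` A \<in> sets borel"
    by (rule measurable_sets_borel[OF _ A]) (intro borel_measurable_continuous_onI continuous_on_swap)
  have "AE y in \<mu>. (AE x in \<mu>'. x \<in> limit_set \<Gamma> \<and> x \<noteq> y \<longrightarrow> (x, y) \<in> A) \<or> (AE x in \<mu>'. x \<in> limit_set \<Gamma> \<and> x \<noteq> y \<longrightarrow> (x, y) \<notin> A)"
    by (rule hopf[OF A inv])
  then have H1: "AE y in \<mu>. (AE x in \<mu>'. (x, y) \<notin> A2) \<or> (AE x in \<mu>'. (x, y) \<notin> A1)"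
  proof eventually_elim
    case (elim y)
    then show ?case
    proof (elim disjE)
      assume "AE x in \<mu>'. x \<in> limit_set \<Gamma> \<and> x \<noteq> y \<longrightarrow> (x, y) \<in> A"
      then have "AE x in \<mu>'. (x, y) \<notin> A2" by eventually_elim (auto simp: A2_def U_def)
      then show ?thesis by simp
    next
      assume "AE x in \<mu>'. x \<in> limit_set \<Gamma> \<and> x \<noteq> y \<longrightarrow> (x, y) \<notin> A"
      then have "AE x in \<mu>'. (x, y) \<notin> A1" by eventually_elim (auto simp: A1_def U_def)
      then show ?thesis by simp
    qed
  qed
  have "AE x in \<mu>'. (AE y in \<mu>. y \<in> limit_set \<Gamma> \<and> y \<noteq> x \<longrightarrow> (y, x) \<in> prod.swap -` A) \<or> (AE y in \<mu>. y \<in> limit_set \<Gamma> \<and> y \<noteq> x \<longrightarrow> (y, x) \<notin> prod.swap -` A)"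
    by (rule sw.hopf[OF swap_borel]) (use inv in auto)
  then have H2: "AE x in \<mu>'. (AE y in \<mu>. (x, y) \<notin> A2) \<or> (AE y in \<mu>. (x, y) \<notin> A1)"
  proof eventually_elim
    case (elim x)
    then show ?case
    proof (elim disjE)
      assume "AE y in \<mu>. y \<in> limit_set \<Gamma> \<and> y \<noteq> x \<longrightarrow> (y, x) \<in> prod.swap -` A"
      then have "AE y in \<mu>. (x, y) \<notin> A2" by eventually_elim (auto simp: A2_def U_def)
      then show ?thesis by simp
    next
      assume "AE y in \<mu>. y \<in> limit_set \<Gamma> \<and> y \<noteq> x \<longrightarrow> (y, x) \<notin> prod.swap -` A"
      then have "AE y in \<mu>. (x, y) \<notin> A1" by eventually_elim (auto simp: A1_def U_def)
      then show ?thesis by simp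
    qed
  qed
  have lift: "AE v in Q. (fst v, fst (snd v)) \<notin> B" if B: "B \<in> sets borel" and ae: "AE x in \<mu>'. AE y in \<mu>. (x, y) \<notin> B" for B
  proof -
    have prm: "(\<lambda>v :: 'm \<times> 'm \<times> real. (fst v, fst (snd v))) \<in> borel_measurable borel"
      by (intro borel_measurable_continuous_onI continuous_intros)
    define C where "C = (\<lambda>v :: 'm \<times> 'm \<times> real. (fst v, fst (snd v))) -` B"
    have C: "C \<in> sets borel" unfolding C_def by (rule measurable_sets_borel[OF prm B])
    have "(\<integral>\<^sup>+v. indicator C v \<partial>prod3) = (\<integral>\<^sup>+x. \<integral>\<^sup>+y. \<integral>\<^sup>+t. indicator C (x, y, t) \<partial>lborel \<partial>\<mu> \<partial>\<mu>')"
      by (rule nn_integral_prod3) (use C in measurable)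
    also have "\<dots> = (\<integral>\<^sup>+x. 0 \<partial>\<mu>')"
    proof (rule nn_integral_cong_AE)
      show "AE x in \<mu>'. (\<integral>\<^sup>+y. \<integral>\<^sup>+t. indicator C (x, y, t) \<partial>lborel \<partial>\<mu>) = 0"
        using ae
      proof eventually_elim
        case (elim x)
        have "(\<integral>\<^sup>+y. \<integral>\<^sup>+t. indicator C (x, y, t) \<partial>lborel \<partial>\<mu>) = (\<integral>\<^sup>+y. 0 \<partial>\<mu>)"
          using elim by (intro nn_integral_cong_AE) (auto simp: C_def indicator_def elim!: eventually_mono)
        then show ?case by simp
      qed
    qed
    finally have "emeasure prod3 C = 0" using C by simp
    then have "C \<in> null_sets prod3" using C by auto
    then have "AE v in prod3. v \<notin> C" by (rule AE_not_in)
    then show ?thesis unfolding AE_Q by eventually_elim (auto simp: C_def)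
  qed
  show ?thesis
  proof (cases "(AE x in \<mu>'. AE y in \<mu>. (x, y) \<notin> A2) \<or> (AE x in \<mu>'. AE y in \<mu>. (x, y) \<notin> A1)")
    case True
    then show ?thesis
    proof
      assume "AE x in \<mu>'. AE y in \<mu>. (x, y) \<notin> A2"
      with lift[OF A12(2)] have "AE v in Q. (fst v, fst (snd v)) \<notin> A2" by blast
      with AE_Q_cover have "AE v in Q. (fst v, fst (snd v)) \<in> A"
        by eventually_elim (auto simp: A2_def U_def cover_space_def)
      then show ?thesis by simp
    next
      assume "AE x in \<mu>'. AE y in \<mu>. (x, y) \<notin> A1"
      with lift[OF A12(1)] have "AE v in Q. (fst v, fst (snd v)) \<notin> A1" by blast
      with AE_Q_cover have "AE v in Q. (fst v, fst (snd v)) \<notin> A"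
        by eventually_elim (auto simp: A1_def U_def cover_space_def)
      then show ?thesis by simp
    qed
  next
    case False
    \<comment> \<open>\<open>Y\<close> consists of the \<open>y\<close> over which \<open>B\<close>
      is null in the first coordinate. Over such \<open>y\<close>, almost every \<open>x\<close>
      avoids \<open>B\<close>; the quantifiers over \<open>x\<close> and \<open>y\<close> are then
      exchanged, for which \<open>Y\<close> has to be measurable.\<close>
    have slice: "AE x in \<mu>'. AE y in \<mu>. (AE x in \<mu>'. (x, y) \<notin> B) \<longrightarrow> (x, y) \<notin> B" if B: "B \<in> sets borel" for B
    proof -
      have B': "B \<in> sets (\<mu>' \<Otimes>\<^sub>M \<mu>)" using B unfolding sP .
      define Y where "Y = {y. emeasure \<mu>' ((\<lambda>x. (x, y)) -` B) = 0}"
      have Bs: "(\<lambda>x. (x, y)) -` B \<in> sets \<mu>'" for y using sets_Pair2[OF B', of y] .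
      have Yae: "y \<in> Y \<longleftrightarrow> (AE x in \<mu>'. (x, y) \<notin> B)" for y
        unfolding Y_def using AE_iff_measurable[of "(\<lambda>x. (x, y)) -` B" \<mu>' "\<lambda>x. (x, y) \<notin> B"] Bs by auto
      have "(\<lambda>y. emeasure \<mu>' ((\<lambda>x. (x, y)) -` B)) \<in> borel_measurable \<mu>" by (rule P.measurable_emeasure_Pair2[OF B'])
      from measurable_sets[OF this, of "{0}"] have Y: "Y \<in> sets borel" by (simp add: Y_def vimage_def)
      have "AE y in \<mu>. AE x in \<mu>'. y \<in> Y \<longrightarrow> (x, y) \<notin> B" by (rule AE_I2) (auto simp: Yae elim: eventually_mono)
      moreover have "{z \<in> space (\<mu>' \<Otimes>\<^sub>M \<mu>). snd z \<in> Y \<longrightarrow> (fst z, snd z) \<notin> B} \<in> sets (\<mu>' \<Otimes>\<^sub>M \<mu>)"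
      proof -
        have "{z \<in> space (\<mu>' \<Otimes>\<^sub>M \<mu>). snd z \<in> Y \<longrightarrow> (fst z, snd z) \<notin> B} = - (snd -` Y \<inter> B)" by (auto simp: spP)
        moreover have "snd -` Y \<in> sets (borel :: ('m \<times> 'm) measure)"
          by (rule measurable_sets_borel[OF _ Y]) (intro borel_measurable_continuous_onI continuous_intros)
        ultimately show ?thesis unfolding sP using B by auto
      qed
      ultimately have "AE x in \<mu>'. AE y in \<mu>. y \<in> Y \<longrightarrow> (x, y) \<notin> B"
        using P.AE_commute[of "\<lambda>x y. y \<in> Y \<longrightarrow> (x, y) \<notin> B"] by (simp only:)
      then show ?thesis unfolding Yae .
    qed
    have AEL: "AE x in \<mu>'. x \<in> limit_set \<Gamma>" by (rule sw.AE_limit_set)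
    \<comment> \<open>Since \<open>B'\<close> is not null, some typical \<open>x\<close> in the
      limit set has a \<open>B\<close>-null slice. Almost every \<open>y\<close> whose slice is
      \<open>B'\<close>-null then has \<open>(x, y)\<close> in neither set, and as the two sets
      cover all pairs of distinct limit points, \<open>y = x\<close>.\<close>
    have pick: "\<exists>x. x \<in> limit_set \<Gamma> \<and> (AE y in \<mu>. (AE x in \<mu>'. (x, y) \<notin> B') \<longrightarrow> y = x)"
      if no: "\<not> (AE x in \<mu>'. AE y in \<mu>. (x, y) \<notin> B')" and H: "AE x in \<mu>'. (AE y in \<mu>. (x, y) \<notin> B) \<or> (AE y in \<mu>. (x, y) \<notin> B')"
        and B': "B' \<in> sets borel" and UB: "U \<subseteq> B \<union> B'" for B B'
    proof (rule ccontr)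
      assume none: "\<not> ?thesis"
      have cov: "(x, y) \<in> B \<or> (x, y) \<in> B'" if "x \<in> limit_set \<Gamma>" "y \<in> limit_set \<Gamma>" "y \<noteq> x" for x y
      proof -
        have "(x, y) \<in> U" using that by (auto simp: U_def)
        then show ?thesis using UB by blast
      qed
      have "AE x in \<mu>'. AE y in \<mu>. (x, y) \<notin> B'"
        using H slice[OF B'] AEL
      proof eventually_elim
        case (elim x)
        have "\<not> (AE y in \<mu>. (x, y) \<notin> B)"
        proof
          assume "AE y in \<mu>. (x, y) \<notin> B"
          with elim(2) AE_limit_set have "AE y in \<mu>. (AE x in \<mu>'. (x, y) \<notin> B') \<longrightarrow> y = x"
            by eventually_elim (use cov[OF elim(3)] in blast)
          then show False using none elim(3) by blast
        qed
        then show ?case using elim(1) by blast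
      qed
      then show False using no by simp
    qed
    have "U \<subseteq> A2 \<union> A1" "U \<subseteq> A1 \<union> A2" by (auto simp: A1_def A2_def)
    have H2': "AE x in \<mu>'. (AE y in \<mu>. (x, y) \<notin> A1) \<or> (AE y in \<mu>. (x, y) \<notin> A2)" using H2 by eventually_elim auto
    obtain x1 where x1: "AE y in \<mu>. (AE x in \<mu>'. (x, y) \<notin> A1) \<longrightarrow> y = x1"
      using pick[OF _ H2 A12(1) \<open>U \<subseteq> A2 \<union> A1\<close>] False by blast
    obtain x2 where x2: "AE y in \<mu>. (AE x in \<mu>'. (x, y) \<notin> A2) \<longrightarrow> y = x2"
      using pick[OF _ H2' A12(2) \<open>U \<subseteq> A1 \<union> A2\<close>] False by blast
    \<comment> \<open>Almost every \<open>y\<close> has a slice that is null for \<open>A1\<close>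
      or for \<open>A2\<close>, and is accordingly equal to \<open>x1\<close> or
      \<open>x2\<close>.\<close>
    have "AE y in \<mu>. y \<notin> - {x1, x2}" using H1 x1 x2 by eventually_elim auto
    moreover have "- {x1, x2} \<in> sets \<mu>" by auto
    ultimately have "nu.prob (- {x1, x2}) = 0" by (subst nu.prob_eq_0) auto
    then show ?thesis using compl_pair_pos[of x1 x2] by simp
  qed
qed

end

section \<open>Descent to the flow space\<close>

context GPS_pair
begin

lemma nn_integral_BMS:
  assumes f: "f \<in> borel_measurable borel"
  shows "f \<in> borel_measurable (BMS_cover_measure \<Gamma> G \<delta> \<mu>' \<mu>)"
    and "(\<integral>\<^sup>+v. f v \<partial>BMS_cover_measure \<Gamma> G \<delta> \<mu>' \<mu>) = (\<integral>\<^sup>+v. f v \<partial>Q)"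
proof -
  let ?R = "restrict_space prod3 (cover_space \<Gamma>)"
  let ?e = "\<lambda>(x, y, t). ennreal (exp (\<delta> * G (x, y)))"
  have B: "BMS_cover_measure \<Gamma> G \<delta> \<mu>' \<mu> = density ?R ?e" by (simp add: BMS_cover_measure_def prod3_def)
  have f': "f \<in> borel_measurable prod3" using f by (simp add: measurable_cong_sets[OF sets_prod3 refl])
  have fR: "f \<in> borel_measurable ?R" by (rule measurable_restrict_space1[OF f'])
  then show "f \<in> borel_measurable (BMS_cover_measure \<Gamma> G \<delta> \<mu>' \<mu>)" unfolding B by simp
  have w': "weight \<in> borel_measurable prod3" using weight_borel by (simp add: measurable_cong_sets[OF sets_prod3 refl])
  have "weight \<in> borel_measurable ?R" by (rule measurable_restrict_space1[OF w'])
  moreover have "weight v = ?e v" if "v \<in> space ?R" for v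
    using that by (cases v) (simp add: weight_def space_restrict_space)
  ultimately have eR: "?e \<in> borel_measurable ?R" by (subst measurable_cong[of ?R ?e weight]) auto
  have "(\<integral>\<^sup>+v. f v \<partial>density ?R ?e) = (\<integral>\<^sup>+v. ?e v * f v \<partial>?R)" by (rule nn_integral_density[OF eR fR])
  also have "\<dots> = (\<integral>\<^sup>+v. ?e v * f v * indicator (cover_space \<Gamma>) v \<partial>prod3)"
    by (rule nn_integral_restrict_space) simp
  also have "\<dots> = (\<integral>\<^sup>+v. weight v * f v \<partial>prod3)"
    by (intro nn_integral_cong) (auto simp: weight_def indicator_def)
  also have "\<dots> = (\<integral>\<^sup>+v. f v \<partial>Q)" by (rule nn_integral_Q[OF f, symmetric])
  finally show "(\<integral>\<^sup>+v. f v \<partial>BMS_cover_measure \<Gamma> G \<delta> \<mu>' \<mu>) = (\<integral>\<^sup>+v. f v \<partial>Q)" unfolding B .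
qed

lemma flow_orbit_act: "g \<in> \<Gamma> \<Longrightarrow> flow_orbit \<Gamma> \<sigma> (cover_act \<sigma> g v) = flow_orbit \<Gamma> \<sigma> v"
proof -
  assume g: "g \<in> \<Gamma>"
  show ?thesis
  proof (intro set_eqI iffI)
    fix u assume "u \<in> flow_orbit \<Gamma> \<sigma> (cover_act \<sigma> g v)"
    then obtain h where "h \<in> \<Gamma>" "u = cover_act \<sigma> h (cover_act \<sigma> g v)" by (auto simp: flow_orbit_def)
    then show "u \<in> flow_orbit \<Gamma> \<sigma> v" using g by (auto simp: flow_orbit_def cover_act_comp)
  next
    fix u assume "u \<in> flow_orbit \<Gamma> \<sigma> v"
    then obtain h where h: "h \<in> \<Gamma>" "u = cover_act \<sigma> h v" by (auto simp: flow_orbit_def)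
    have "u = cover_act \<sigma> (h \<circ> inv g) (cover_act \<sigma> g v)" using g h by (simp add: cover_act_comp o_assoc[symmetric])
    then show "u \<in> flow_orbit \<Gamma> \<sigma> (cover_act \<sigma> g v)" using g h by (auto simp: flow_orbit_def)
  qed
qed

context
  fixes m
  assumes desc: "descends_to \<Gamma> \<sigma> (BMS_cover_measure \<Gamma> G \<delta> \<mu>' \<mu>) m"
begin

lemma space_m: "space m = flow_space \<Gamma> \<sigma>"
  and sets_m: "sets m = sigma_sets (flow_space \<Gamma> \<sigma>) {W. openin (flow_space_topology \<Gamma> \<sigma>) W}"
  using desc by (auto simp: descends_to_def)

lemma nn_integral_m:
  assumes f: "f \<in> borel_measurable borel" and h: "\<And>v. v \<in> cover_space \<Gamma> \<Longrightarrow> h (flow_orbit \<Gamma> \<sigma> v) = osum f v"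
  shows "(\<integral>\<^sup>+v. f v \<partial>Q) = (\<integral>\<^sup>+u. h u \<partial>m)"
proof -
  have "f \<in> borel_measurable (BMS_cover_measure \<Gamma> G \<delta> \<mu>' \<mu>) \<and> (\<forall>v\<in>cover_space \<Gamma>. h (flow_orbit \<Gamma> \<sigma> v) = (\<Sum>\<^sub>\<infinity>\<gamma>\<in>\<Gamma>. f (cover_act \<sigma> \<gamma> v)))"
    using nn_integral_BMS(1)[OF f] h by (simp add: osum_infsum)
  then have "(\<integral>\<^sup>+v. f v \<partial>BMS_cover_measure \<Gamma> G \<delta> \<mu>' \<mu>) = (\<integral>\<^sup>+u. h u \<partial>m)"
    using desc unfolding descends_to_def by blast
  then show ?thesis by (simp add: nn_integral_BMS(2)[OF f])
qed

text \<open>Orbit sums are functions on the quotient, and there their pointwise order passes to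
  integrals. \<open>nn_integral_mono\<close> asks for no measurability, so choosing a representative
  of each orbit is harmless.\<close>

lemma flow_of_descends: "GPS_flow \<Gamma> d \<sigma> \<sigma>' G N \<delta> \<mu> \<mu>'"
proof (intro GPS_flow.intro GPS_flow_axioms.intro GPS_pair_axioms)
  fix f g :: "'m \<times> 'm \<times> real \<Rightarrow> ennreal"
  assume f: "f \<in> borel_measurable borel" and g: "g \<in> borel_measurable borel"
    and le: "\<And>v. v \<in> cover_space \<Gamma> \<Longrightarrow> osum f v \<le> osum g v"
  define h where "h f u = osum f (SOME v. v \<in> cover_space \<Gamma> \<and> flow_orbit \<Gamma> \<sigma> v = u)" for f u
  have h: "h f (flow_orbit \<Gamma> \<sigma> v) = osum f v" if v: "v \<in> cover_space \<Gamma>" for f v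
  proof -
    define v' where "v' = (SOME v'. v' \<in> cover_space \<Gamma> \<and> flow_orbit \<Gamma> \<sigma> v' = flow_orbit \<Gamma> \<sigma> v)"
    have "v' \<in> cover_space \<Gamma> \<and> flow_orbit \<Gamma> \<sigma> v' = flow_orbit \<Gamma> \<sigma> v" unfolding v'_def by (rule someI[of _ v]) (simp add: v)
    moreover have "v' \<in> flow_orbit \<Gamma> \<sigma> v'" unfolding flow_orbit_def by (rule image_eqI[of _ _ id]) auto
    ultimately have "v' \<in> flow_orbit \<Gamma> \<sigma> v" by simp
    then obtain k where "k \<in> \<Gamma>" "v' = cover_act \<sigma> k v" by (auto simp: flow_orbit_def)
    then show ?thesis by (simp add: h_def v'_def[symmetric] osum_act)
  qed
  have "(\<integral>\<^sup>+v. f v \<partial>Q) = (\<integral>\<^sup>+u. h f u \<partial>m)" using f h by (rule nn_integral_m)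
  also have "\<dots> \<le> (\<integral>\<^sup>+u. h g u \<partial>m)"
  proof (rule nn_integral_mono)
    fix u assume "u \<in> space m"
    then obtain v where "v \<in> cover_space \<Gamma>" "u = flow_orbit \<Gamma> \<sigma> v" by (auto simp: space_m flow_space_def)
    then show "h f u \<le> h g u" by (simp add: h le)
  qed
  also have "\<dots> = (\<integral>\<^sup>+v. g v \<partial>Q)" using g h by (rule nn_integral_m[symmetric])
  finally show "(\<integral>\<^sup>+v. f v \<partial>Q) \<le> (\<integral>\<^sup>+v. g v \<partial>Q)" .
qed

definition lift_set :: "('m \<times> 'm \<times> real) set set \<Rightarrow> ('m \<times> 'm \<times> real) set" where
  "lift_set W = {v \<in> cover_space \<Gamma>. flow_orbit \<Gamma> \<sigma> v \<in> W}"

lemma lift_set_borel: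
  assumes "W \<in> sets m"
  shows "lift_set W \<in> sets borel"
  using assms unfolding sets_m
proof (induction rule: sigma_sets.induct)
  case (Basic W)
  then have "openin (top_of_set (cover_space \<Gamma>)) (lift_set W)" by (simp add: openin_flow_space_topology lift_set_def)
  then obtain T where "open T" "lift_set W = cover_space \<Gamma> \<inter> T" by (auto simp: openin_open)
  then show ?case using cover_borel by auto
next
  case Empty
  then show ?case by (simp add: lift_set_def)
next
  case (Compl W)
  have "lift_set (flow_space \<Gamma> \<sigma> - W) = cover_space \<Gamma> - lift_set W" by (auto simp: lift_set_def flow_space_def)
  then show ?case using Compl cover_borel by auto
next
  case (Union W)
  have "lift_set (\<Union>i. W i) = (\<Union>i. lift_set (W i))" by (auto simp: lift_set_def)
  then show ?case using Union by auto
qed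

lemma lift_set_inv: "inv_set (lift_set W)"
  by (auto simp: inv_set_def lift_set_def flow_orbit_act cover_act_mem)

text \<open>The lift is invariant and \<Gamma> is infinite, so the orbit sum of its indicator is
  \<infinity> on \<open>W\<close>. Hence the lift has \<infinity> times the measure of
  \<open>W\<close>, which decides exactly whether it is null.\<close>

lemma emeasure_m_eq_0: 
  assumes W: "W \<in> sets m"
  shows "emeasure m W = 0 \<longleftrightarrow> emeasure Q (lift_set W) = 0"
proof -
  have L: "lift_set W \<in> sets borel" by (rule lift_set_borel[OF W])
  have "(\<integral>\<^sup>+v. indicator (lift_set W) v \<partial>Q) = (\<integral>\<^sup>+u. \<infinity> * indicator W u \<partial>m)"
  proof (rule nn_integral_m)
    show "indicator (lift_set W) \<in> borel_measurable borel" using L by simp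
    fix v assume v: "v \<in> cover_space \<Gamma>"
    have eq: "(indicator (lift_set W) :: _ \<Rightarrow> ennreal) = (\<lambda>v. 1 * indicator (lift_set W) v)" by auto
    show "\<infinity> * indicator W (flow_orbit \<Gamma> \<sigma> v) = osum (indicator (lift_set W)) v"
      by (subst eq, subst osum_indicator[OF lift_set_inv v])
        (cases "flow_orbit \<Gamma> \<sigma> v \<in> W"; use v in \<open>simp add: osum_const lift_set_def\<close>)
  qed
  then have "emeasure Q (lift_set W) = \<infinity> * emeasure m W" using L W by (simp add: nn_integral_cmult_indicator)
  then show ?thesis by (auto simp: ennreal_mult_eq_top_iff)
qed

lemma AE_lift:
  assumes "AE u in m. R u"
  shows "AE v in Q. R (flow_orbit \<Gamma> \<sigma> v)"
proof -
  obtain K where K: "{u \<in> space m. \<not> R u} \<subseteq> K" "emeasure m K = 0" "K \<in> sets m" using AE_E[OF assms] by blast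
  have "emeasure Q (lift_set K) = 0" using K emeasure_m_eq_0 by blast
  then have "lift_set K \<in> null_sets Q" using lift_set_borel[OF K(3)] by auto
  then have "AE v in Q. v \<notin> lift_set K" by (rule AE_not_in)
  with AE_Q_cover show ?thesis
    by eventually_elim (use K(1) in \<open>auto simp: lift_set_def space_m flow_space_def\<close>)
qed

lemma conservative_m: "conservative_flow m quotient_flow"
  unfolding conservative_flow_def
proof (intro allI impI)
  fix W assume "wandering_set m quotient_flow W"
  then have W: "W \<in> sets m" and ae: "AE u in m. u \<in> W \<longrightarrow> compact (closure {t. quotient_flow t u \<in> W})"
    by (auto simp: wandering_set_def)
  interpret fl: GPS_flow \<Gamma> d \<sigma> \<sigma>' G N \<delta> \<mu> \<mu>' by (rule flow_of_descends)
  have "AE v in Q. v \<in> lift_set W \<longrightarrow> (\<exists>n::nat. \<forall>k\<ge>n. cover_flow (real k) v \<notin> lift_set W)"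
    using AE_lift[OF ae]
  proof eventually_elim
    case (elim v)
    show ?case
    proof
      assume v: "v \<in> lift_set W"
      then have "compact (closure {t. quotient_flow t (flow_orbit \<Gamma> \<sigma> v) \<in> W})" using elim by (simp add: lift_set_def)
      then have "bounded {t. quotient_flow t (flow_orbit \<Gamma> \<sigma> v) \<in> W}"
        by (meson bounded_closure_image bounded_subset closure_subset compact_imp_bounded)
      then obtain B where B: "\<forall>t. quotient_flow t (flow_orbit \<Gamma> \<sigma> v) \<in> W \<longrightarrow> \<bar>t\<bar> \<le> B" by (auto simp: bounded_iff)
      obtain n :: nat where n: "B < real n" using reals_Archimedean2 by auto
      have "cover_flow (real k) v \<notin> lift_set W" if "k \<ge> n" for k
      proof
        assume "cover_flow (real k) v \<in> lift_set W"
        then have "quotient_flow (real k) (flow_orbit \<Gamma> \<sigma> v) \<in> W" by (simp add: lift_set_def quotient_flow_orbit)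
        then have "\<bar>real k\<bar> \<le> B" using B by blast
        then show False using n that by simp
      qed
      then show "\<exists>n::nat. \<forall>k\<ge>n. cover_flow (real k) v \<notin> lift_set W" by blast
    qed
  qed
  from fl.conservative_cover[OF lift_set_borel[OF W] lift_set_inv this]
  show "emeasure m W = 0" using emeasure_m_eq_0[OF W] by simp
qed

lemma ergodic_m: "ergodic_flow m quotient_flow"
  unfolding ergodic_flow_def
proof (intro ballI impI)
  fix A assume A: "A \<in> sets m" and inv: "\<forall>t. quotient_flow t -` A \<inter> space m = A"
  interpret fl: GPS_flow \<Gamma> d \<sigma> \<sigma>' G N \<delta> \<mu> \<mu>' by (rule flow_of_descends)
  have flow_inv: "cover_flow t v \<in> lift_set A \<longleftrightarrow> v \<in> lift_set A" for t v
  proof (cases "v \<in> cover_space \<Gamma>")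
    case True
    then have "flow_orbit \<Gamma> \<sigma> v \<in> space m" by (auto simp: space_m flow_space_def)
    then have "flow_orbit \<Gamma> \<sigma> v \<in> A \<longleftrightarrow> quotient_flow t (flow_orbit \<Gamma> \<sigma> v) \<in> A" using inv by blast
    then show ?thesis using True by (simp add: lift_set_def quotient_flow_orbit)
  qed (simp add: lift_set_def)
  \<comment> \<open>The slice at time 0. Invariance under the flow makes membership in the lift
    depend on the endpoints alone, which reduces ergodicity to
    \<open>double_ergodic\<close>.\<close>
  define A0 where "A0 = (\<lambda>z. (fst z, snd z, 0)) -` lift_set A"
  have A0: "A0 \<in> sets borel" unfolding A0_def
    by (rule measurable_sets_borel[OF _ lift_set_borel[OF A]]) (intro borel_measurable_continuous_onI continuous_intros)
  have mem: "(fst v, fst (snd v)) \<in> A0 \<longleftrightarrow> v \<in> lift_set A" for v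
    using flow_inv[of "- snd (snd v)" v] by (simp add: A0_def cover_flow_def case_prod_unfold)
  have "(g x, g y) \<in> A0 \<longleftrightarrow> (x, y) \<in> A0" if "g \<in> \<Gamma>" "x \<in> limit_set \<Gamma>" "y \<in> limit_set \<Gamma>" "x \<noteq> y" for g x y
  proof -
    have v: "(x, y, 0) \<in> cover_space \<Gamma>" using that by (simp add: cover_space_def)
    have "(g x, g y) \<in> A0 \<longleftrightarrow> cover_act \<sigma> g (x, y, 0) \<in> lift_set A"
      using mem[of "cover_act \<sigma> g (x, y, 0)"] by (simp add: cover_act_def)
    also have "\<dots> \<longleftrightarrow> (x, y, 0) \<in> lift_set A" using lift_set_inv that(1) v by (auto simp: inv_set_def)
    also have "\<dots> \<longleftrightarrow> (x, y) \<in> A0" using mem[of "(x, y, 0)"] by simp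
    finally show ?thesis .
  qed
  from fl.double_ergodic[OF A0 this]
  have "(AE v in Q. v \<in> lift_set A) \<or> (AE v in Q. v \<notin> lift_set A)" by (simp add: mem)
  then show "emeasure m A = 0 \<or> emeasure m (space m - A) = 0"
  proof
    assume "AE v in Q. v \<in> lift_set A"
    then have "AE v in Q. v \<notin> lift_set (space m - A)" by eventually_elim (auto simp: lift_set_def)
    moreover have A': "space m - A \<in> sets m" using A by auto
    moreover note lift_set_borel[OF A']
    ultimately have "emeasure Q (lift_set (space m - A)) = 0" by (subst (asm) AE_iff_measurable[of "lift_set (space m - A)"]) auto
    then show ?thesis using emeasure_m_eq_0[OF A'] by simp
  next
    assume "AE v in Q. v \<notin> lift_set A"
    then have "emeasure Q (lift_set A) = 0" using lift_set_borel[OF A] by (subst (asm) AE_iff_measurable[of "lift_set A"]) auto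
    then show ?thesis using emeasure_m_eq_0[OF A] by simp
  qed
qed

end

end

theorem theorem11p2:
  fixes \<Gamma> :: "('m::{metric_space, second_countable_topology} \<Rightarrow> 'm) set"
    and d :: "('m \<Rightarrow> 'm) + 'm \<Rightarrow> ('m \<Rightarrow> 'm) + 'm \<Rightarrow> real"
    and \<sigma> \<sigma>' :: "('m \<Rightarrow> 'm) \<Rightarrow> 'm \<Rightarrow> real"
    and G :: "'m \<times> 'm \<Rightarrow> real"
    and N :: "('m \<Rightarrow> 'm) \<Rightarrow> real"
    and \<delta> :: real
    and m :: "('m \<times> 'm \<times> real) set measure"
  assumes "compact (UNIV :: 'm set)"
    and "convergence_group \<Gamma>"
    and "non_elementary \<Gamma>"
    and "compatible_metric \<Gamma> d"
    and "continuous_GPS_system \<Gamma> d \<sigma> \<sigma>' G"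
    and "is_magnitude \<Gamma> d \<sigma> N"
    and "critical_exponent \<Gamma> N < \<infinity>"
    and "\<delta> = real_of_ereal (critical_exponent \<Gamma> N)"
    and "poincare_series \<Gamma> N \<delta> = \<infinity>"
    and "is_BMS_measure \<Gamma> \<sigma> \<sigma>' G \<delta> m"
  shows "conservative_flow m quotient_flow \<and> ergodic_flow m quotient_flow"
proof -
  obtain \<mu> \<mu>' where \<mu>: "conformal_measure \<Gamma> \<sigma> \<delta> \<mu>" "conformal_measure \<Gamma> \<sigma>' \<delta> \<mu>'"
    and m: "descends_to \<Gamma> \<sigma> (BMS_cover_measure \<Gamma> G \<delta> \<mu>' \<mu>) m"
    using assms(10) by (auto simp: is_BMS_measure_def)
  have "critical_exponent \<Gamma> N \<ge> 0"
    unfolding critical_exponent_def by (rule Inf_greatest) auto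
  then have "\<delta> \<ge> 0" unfolding assms(8) by (rule real_of_ereal_pos)
  interpret GPS_pair \<Gamma> d \<sigma> \<sigma>' G N \<delta> \<mu> \<mu>'
    by unfold_locales (use assms \<mu> \<open>\<delta> \<ge> 0\<close> in auto)
  show ?thesis using conservative_m[OF m] ergodic_m[OF m] by simp
qed

end
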